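(* Let $K$ be a perfect field, $n\ge1$, $k\ge2$, $A=K[X_1,\dots,X_n]$, $\mathfrak{q}=\langle X_1,\dots,X_n\rangle$, $S=A/\mathfrak{q}^k$, and let $1\le m\le n$. Then the Hilbert function of the graded $S$-module $\Omega^m_{S/K}$ is given by $$\mathrm{HF}_{\Omega^m_{S/K}}(i)=\begin{cases}\binom{n}{m}\binom{n+i-m-1}{n-1}&\text{if } i<m+k-1,\\ \binom{n}{m}\binom{n+k-2}{n-1}-\delta&\text{if } i=m+k-1,\\ 0&\text{if } i>m+k-1,\end{cases}$$ where $\delta=\dim_K\big(d\mathfrak{q}^k\wedge\Omega^{m-1}_{A/K}\big)_{m+k-1}$.
   Context: For a $K$-algebra $B$, $\Omega^m_{B/K}=\Lambda^m_B\Omega^1_{B/K}$ is the module of Kähler differential $m$-forms, with $\Omega^0_{B/K}=B$. $A$ and $S$ carry the standard grading, and the modules of differential forms are graded with $\deg(dX_i)=1$ (resp. $\deg(dx_i)=1$). $d\mathfrak{q}^k$ denotes the $A$-submodule of $\Omega^1_{A/K}$ generated by $\{df\mid f\in\mathfrak{q}^k\}$, and $d\mathfrak{q}^k\wedge\Omega^{m-1}_{A/K}$ is the $A$-submodule of $\Omega^m_{A/K}$ generated by products $u\wedge w$ with $u\in d\mathfrak{q}^k$, $w\in\Omega^{m-1}_{A/K}$; the subscript denotes the homogeneous component. For a graded module $M$, $\mathrm{HF}_M(i)=\dim_K M_i$. Binomial coefficients $\binom{a}{b}$ with $b\ge 0$ are $0$ if $a<b$ (in particular for negative $a$). *)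

theory Defs
  imports
    "HOL-Algebra.Ideal_Product"
    "HOL-Algebra.QuotRing"
    "HOL-Library.Poly_Mapping"
    "Jordan_Normal_Form.VS_Connect"
begin

definition perfect_field :: "'k::field itself \<Rightarrow> bool" where
  "perfect_field _ \<longleftrightarrow> CHAR('k) = 0 \<or> (\<forall>a::'k. \<exists>b. b ^ CHAR('k) = a)"

section \<open>Free modules, quotients, restriction of scalars\<close>

text \<open>
  The record type \<^typ>\<open>('a, 'b) module\<close> extends \<^typ>\<open>'b ring\<close>; for a mere module the
  multiplicative fields carry no meaning.
\<close>

definition free_module ::
    "('b, 'r) ring_scheme \<Rightarrow> 'x set \<Rightarrow> ('b, 'x \<Rightarrow> 'b) module" where
  "free_module B I =
    \<lparr> carrier = {f. (\<forall>x\<in>I. f x \<in> carrier B) \<and> (\<forall>x. x \<notin> I \<longrightarrow> f x = \<zero>\<^bsub>B\<^esub>) \<and>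
                    finite {x. f x \<noteq> \<zero>\<^bsub>B\<^esub>}},
      monoid.mult = undefined,
      monoid.one = undefined,
      ring.zero = (\<lambda>x. \<zero>\<^bsub>B\<^esub>),
      add = (\<lambda>f g x. f x \<oplus>\<^bsub>B\<^esub> g x),
      module.smult = (\<lambda>b f x. b \<otimes>\<^bsub>B\<^esub> f x) \<rparr>"

definition free_gen :: "('b, 'r) ring_scheme \<Rightarrow> 'x \<Rightarrow> 'x \<Rightarrow> 'b" where
  "free_gen B x = (\<lambda>y. if y = x then \<one>\<^bsub>B\<^esub> else \<zero>\<^bsub>B\<^esub>)"

text \<open>
  \<^const>\<open>FactRing\<close> with the induced scalar multiplication. It serves both for the quotient of
  a module by a submodule and for the quotient of an algebra by an ideal.
\<close>

definition quot_module :: "('a, 'b, 'r) module_scheme \<Rightarrow> 'b set \<Rightarrow> ('a, 'b set) module" where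
  "quot_module M N =
    \<lparr> carrier = carrier (M Quot N),
      monoid.mult = monoid.mult (M Quot N),
      monoid.one = monoid.one (M Quot N),
      ring.zero = ring.zero (M Quot N),
      add = add (M Quot N),
      module.smult = (\<lambda>a C. \<Union>x\<in>C. N +>\<^bsub>M\<^esub> (a \<odot>\<^bsub>M\<^esub> x)) \<rparr>"

definition restrict_scalars ::
    "('k, 'b, 's) module_scheme \<Rightarrow> ('b, 'x, 't) module_scheme \<Rightarrow> ('k, 'x) module" where
  "restrict_scalars B M =
    \<lparr> carrier = carrier M,
      monoid.mult = monoid.mult M,
      monoid.one = monoid.one M,
      ring.zero = ring.zero M,
      add = add M,
      module.smult = (\<lambda>c x. (c \<odot>\<^bsub>B\<^esub> \<one>\<^bsub>B\<^esub>) \<odot>\<^bsub>M\<^esub> x) \<rparr>"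

section \<open>Exterior powers\<close>

text \<open>
  The \<open>m\<close>-th exterior power of the \<open>B\<close>-module \<open>M\<close> is the free \<open>B\<close>-module on the
  \<open>m\<close>-tuples of elements of \<open>M\<close> modulo the multilinear and alternating relations. For
  \<open>m = 0\<close> there are no relations, and the result is \<open>B\<close> up to isomorphism.
\<close>

definition tuples :: "('b, 'x, 't) module_scheme \<Rightarrow> nat \<Rightarrow> 'x list set" where
  "tuples M m = {xs. length xs = m \<and> set xs \<subseteq> carrier M}"

definition ext_rels ::
    "('b, 'r) ring_scheme \<Rightarrow> ('b, 'x, 't) module_scheme \<Rightarrow> nat \<Rightarrow> ('x list \<Rightarrow> 'b) set" where
  "ext_rels B M m =
    (let F = free_module B (tuples M m); e = free_gen B in
      {e (xs[j := x \<oplus>\<^bsub>M\<^esub> y]) \<ominus>\<^bsub>F\<^esub> (e (xs[j := x]) \<oplus>\<^bsub>F\<^esub> e (xs[j := y])) | xs j x y.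
         xs \<in> tuples M m \<and> j < m \<and> x \<in> carrier M \<and> y \<in> carrier M}
    \<union> {e (xs[j := b \<odot>\<^bsub>M\<^esub> x]) \<ominus>\<^bsub>F\<^esub> (b \<odot>\<^bsub>F\<^esub> e (xs[j := x])) | xs j b x.
         xs \<in> tuples M m \<and> j < m \<and> b \<in> carrier B \<and> x \<in> carrier M}
    \<union> {e xs | xs. xs \<in> tuples M m \<and> (\<exists>i j. i < j \<and> j < m \<and> xs ! i = xs ! j)})"

definition ext_kernel ::
    "('b, 'r) ring_scheme \<Rightarrow> ('b, 'x, 't) module_scheme \<Rightarrow> nat \<Rightarrow> ('x list \<Rightarrow> 'b) set" where
  "ext_kernel B M m =
    LinearCombinations.module.span B (free_module B (tuples M m)) (ext_rels B M m)"

definition ext_power ::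
    "('b, 'r) ring_scheme \<Rightarrow> ('b, 'x, 't) module_scheme \<Rightarrow> nat \<Rightarrow>
      ('b, ('x list \<Rightarrow> 'b) set) module" where
  "ext_power B M m = quot_module (free_module B (tuples M m)) (ext_kernel B M m)"

text \<open>\<open>ext_prod B M [x\<^sub>1, \<dots>, x\<^sub>m]\<close> is \<open>x\<^sub>1 \<and> \<dots> \<and> x\<^sub>m\<close>.\<close>

definition ext_prod ::
    "('b, 'r) ring_scheme \<Rightarrow> ('b, 'x, 't) module_scheme \<Rightarrow> 'x list \<Rightarrow> ('x list \<Rightarrow> 'b) set" where
  "ext_prod B M xs =
    ext_kernel B M (length xs) +>\<^bsub>free_module B (tuples M (length xs))\<^esub> free_gen B xs"

text \<open>
  \<open>ext_mult B M m u W\<close> is \<open>u \<and> W\<close> in the \<open>m\<close>-th exterior power, for \<open>u\<close> in \<open>M\<close> and \<open>W\<close> in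
  the exterior power of degree \<open>m - 1\<close>, where \<open>m \<ge> 1\<close>. On representatives it is the
  linear map that prepends \<open>u\<close> to every tuple.
\<close>

definition ext_mult ::
    "('b, 'r) ring_scheme \<Rightarrow> ('b, 'x, 't) module_scheme \<Rightarrow> nat \<Rightarrow> 'x \<Rightarrow>
      ('x list \<Rightarrow> 'b) set \<Rightarrow> ('x list \<Rightarrow> 'b) set" where
  "ext_mult B M m u W =
    (\<Union>f\<in>W. ext_kernel B M m +>\<^bsub>free_module B (tuples M m)\<^esub>
       (\<lambda>xs. case xs of [] \<Rightarrow> \<zero>\<^bsub>B\<^esub> | y # ys \<Rightarrow> if y = u then f ys else \<zero>\<^bsub>B\<^esub>))"

section \<open>Kaehler differentials of a \<open>K\<close>-algebra \<open>B\<close>\<close>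

text \<open>
  The module of Kaehler differentials is the free \<open>B\<close>-module on symbols \<open>d b\<close>, \<open>b \<in> B\<close>,
  modulo additivity, the Leibniz rule, and \<open>d c = 0\<close> for the scalars \<open>c \<in> K\<close>.
\<close>

definition kaehler_rels ::
    "('k, 'r) ring_scheme \<Rightarrow> ('k, 'b, 's) module_scheme \<Rightarrow> ('b \<Rightarrow> 'b) set" where
  "kaehler_rels K B =
    (let F = free_module B (carrier B); \<delta> = free_gen B in
      {\<delta> (a \<oplus>\<^bsub>B\<^esub> b) \<ominus>\<^bsub>F\<^esub> (\<delta> a \<oplus>\<^bsub>F\<^esub> \<delta> b) | a b. a \<in> carrier B \<and> b \<in> carrier B}
    \<union> {\<delta> (a \<otimes>\<^bsub>B\<^esub> b) \<ominus>\<^bsub>F\<^esub> ((a \<odot>\<^bsub>F\<^esub> \<delta> b) \<oplus>\<^bsub>F\<^esub> (b \<odot>\<^bsub>F\<^esub> \<delta> a)) | a b.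
         a \<in> carrier B \<and> b \<in> carrier B}
    \<union> {\<delta> (c \<odot>\<^bsub>B\<^esub> \<one>\<^bsub>B\<^esub>) | c. c \<in> carrier K})"

definition kaehler_kernel ::
    "('k, 'r) ring_scheme \<Rightarrow> ('k, 'b, 's) module_scheme \<Rightarrow> ('b \<Rightarrow> 'b) set" where
  "kaehler_kernel K B =
    LinearCombinations.module.span B (free_module B (carrier B)) (kaehler_rels K B)"

definition kaehler ::
    "('k, 'r) ring_scheme \<Rightarrow> ('k, 'b, 's) module_scheme \<Rightarrow> ('b, ('b \<Rightarrow> 'b) set) module" where
  "kaehler K B = quot_module (free_module B (carrier B)) (kaehler_kernel K B)"

definition univ_deriv ::
    "('k, 'r) ring_scheme \<Rightarrow> ('k, 'b, 's) module_scheme \<Rightarrow> 'b \<Rightarrow> ('b \<Rightarrow> 'b) set" where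
  "univ_deriv K B b = kaehler_kernel K B +>\<^bsub>free_module B (carrier B)\<^esub> free_gen B b"

definition forms ::
    "('k, 'r) ring_scheme \<Rightarrow> ('k, 'b, 's) module_scheme \<Rightarrow> nat \<Rightarrow>
      ('b, (('b \<Rightarrow> 'b) set list \<Rightarrow> 'b) set) module" where
  "forms K B m = ext_power B (kaehler K B) m"

text \<open>
  Here \<open>B\<close> is graded with homogeneous components \<open>G d\<close>, and is generated as an algebra by
  the elements \<open>x j\<close> of degree 1, \<open>j < n\<close>. As \<open>deg (d x\<^sub>j) = 1\<close>, the component of degree \<open>i\<close>
  is spanned by the forms \<open>s dx\<^sub>j\<^sub>1 \<and> \<dots> \<and> dx\<^sub>j\<^sub>m\<close> with \<open>s\<close> homogeneous of degree \<open>i - m\<close>.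
\<close>

definition forms_component ::
    "('k, 'r) ring_scheme \<Rightarrow> ('k, 'b, 's) module_scheme \<Rightarrow> (nat \<Rightarrow> 'b set) \<Rightarrow> (nat \<Rightarrow> 'b) \<Rightarrow>
      nat \<Rightarrow> nat \<Rightarrow> int \<Rightarrow> (('b \<Rightarrow> 'b) set list \<Rightarrow> 'b) set set" where
  "forms_component K B G x n m i =
    LinearCombinations.module.span K (restrict_scalars B (forms K B m))
      {s \<odot>\<^bsub>forms K B m\<^esub> ext_prod B (kaehler K B) (map (\<lambda>j. univ_deriv K B (x j)) js) | s d js.
         s \<in> G d \<and> length js = m \<and> set js \<subseteq> {..<n} \<and> int d + int m = i}"

section \<open>The algebras \<open>A = K[X\<^sub>1, \<dots>, X\<^sub>n]\<close> and \<open>S = A/q\<^sup>k\<close>\<close>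

abbreviation ground :: "'k::field ring" where
  "ground \<equiv> class_ring"

type_synonym 'k mpoly = "(nat \<Rightarrow>\<^sub>0 nat) \<Rightarrow>\<^sub>0 'k"

text \<open>The variables \<open>X\<^sub>1, \<dots>, X\<^sub>n\<close> are indexed by \<open>0, \<dots>, n - 1\<close>.\<close>

definition polys :: "nat \<Rightarrow> ('k::field, 'k mpoly) module" where
  "polys n =
    \<lparr> carrier = {p. \<forall>t\<in>Poly_Mapping.keys p. Poly_Mapping.keys t \<subseteq> {..<n}},
      monoid.mult = (*),
      monoid.one = 1,
      ring.zero = 0,
      add = (+),
      module.smult = (\<lambda>c p. Poly_Mapping.single 0 c * p) \<rparr>"

definition polyvar :: "nat \<Rightarrow> 'k::field mpoly" where
  "polyvar j = Poly_Mapping.single (Poly_Mapping.single j 1) 1"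

definition polys_component :: "nat \<Rightarrow> nat \<Rightarrow> 'k::field mpoly set" where
  "polys_component n d =
    {p \<in> carrier (polys n).
      \<forall>t\<in>Poly_Mapping.keys p. (\<Sum>j\<in>Poly_Mapping.keys t. Poly_Mapping.lookup t j) = d}"

definition irrelevant_pow :: "nat \<Rightarrow> nat \<Rightarrow> 'k::field mpoly set" where
  "irrelevant_pow n k =
    genideal (polys n) (polyvar ` {..<n}) [^]\<^bsub>ideals_set (polys n)\<^esub> k"

definition fat_point :: "nat \<Rightarrow> nat \<Rightarrow> ('k::field, 'k mpoly set) module" where
  "fat_point n k = quot_module (polys n) (irrelevant_pow n k)"

definition fat_point_class :: "nat \<Rightarrow> nat \<Rightarrow> 'k::field mpoly \<Rightarrow> 'k mpoly set" where
  "fat_point_class n k p = irrelevant_pow n k +>\<^bsub>polys n\<^esub> p"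

section \<open>Hilbert function and \<open>\<delta>\<close>\<close>

text \<open>\<open>V\<close> is a vector space over \<open>K\<close>, graded with homogeneous components \<open>C i\<close>.\<close>

definition hilbert_function ::
    "('k, 'r) ring_scheme \<Rightarrow> ('k, 'x, 's) module_scheme \<Rightarrow> (int \<Rightarrow> 'x set) \<Rightarrow> int \<Rightarrow> nat" where
  "hilbert_function K V C i = vectorspace.dim K (V\<lparr>carrier := C i\<rparr>)"

definition fat_point_forms ::
    "nat \<Rightarrow> nat \<Rightarrow> nat \<Rightarrow>
      ('k::field, (('k mpoly set \<Rightarrow> 'k mpoly set) set list \<Rightarrow> 'k mpoly set) set) module" where
  "fat_point_forms n k m = restrict_scalars (fat_point n k) (forms ground (fat_point n k) m)"

definition fat_point_forms_component ::
    "nat \<Rightarrow> nat \<Rightarrow> nat \<Rightarrow> int \<Rightarrow>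
      (('k::field mpoly set \<Rightarrow> 'k mpoly set) set list \<Rightarrow> 'k mpoly set) set set" where
  "fat_point_forms_component n k m =
    forms_component ground (fat_point n k)
      (\<lambda>d. fat_point_class n k ` polys_component n d) (\<lambda>j. fat_point_class n k (polyvar j)) n m"

definition d_irrelevant_pow ::
    "nat \<Rightarrow> nat \<Rightarrow> ('k::field mpoly \<Rightarrow> 'k mpoly) set set" where
  "d_irrelevant_pow n k =
    LinearCombinations.module.span (polys n) (kaehler ground (polys n))
      (univ_deriv ground (polys n) ` irrelevant_pow n k)"

definition d_irrelevant_pow_wedge ::
    "nat \<Rightarrow> nat \<Rightarrow> nat \<Rightarrow> (('k::field mpoly \<Rightarrow> 'k mpoly) set list \<Rightarrow> 'k mpoly) set set" where
  "d_irrelevant_pow_wedge n k m =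
    LinearCombinations.module.span (polys n) (forms ground (polys n) m)
      {ext_mult (polys n) (kaehler ground (polys n)) m u w | u w.
         u \<in> d_irrelevant_pow n k \<and> w \<in> carrier (forms ground (polys n) (m - 1))}"

definition delta_space ::
    "nat \<Rightarrow> nat \<Rightarrow> nat \<Rightarrow>
      ('k::field, (('k mpoly \<Rightarrow> 'k mpoly) set list \<Rightarrow> 'k mpoly) set) module" where
  "delta_space n k m =
    (restrict_scalars (polys n) (forms ground (polys n) m))
      \<lparr> carrier := d_irrelevant_pow_wedge n k m \<inter>
          forms_component ground (polys n) (polys_component n) polyvar n m
            (int m + int k - 1) \<rparr>"

definition delta :: "'k::field itself \<Rightarrow> nat \<Rightarrow> nat \<Rightarrow> nat \<Rightarrow> nat" where
  "delta _ n k m = vectorspace.dim (ground :: 'k ring) (delta_space n k m)"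

text \<open>
  The convention is that the binomial coefficient vanishes for negative \<open>a\<close>; in
  particular it is then \<open>0\<close>, not \<open>1\<close>, for \<open>b = 0\<close>.
\<close>

definition int_binomial :: "int \<Rightarrow> nat \<Rightarrow> nat" where
  "int_binomial a b = (if a < 0 then 0 else nat a choose b)"

end

theory Submission
  imports Defs "HOL-Library.Function_Algebras"
begin

text \<open>
  Let \<open>A\<close> be the polynomial ring and \<open>B = A / I\<close>. Mapping the coordinates \<open>(w\<^sub>J)\<close> to the form
  \<open>\<Sum> w\<^sub>J dx\<^sub>J\<close> identifies the module of \<open>m\<close>-forms of \<open>B\<close> with the quotient of the free module
  \<open>\<Omega>\<^sup>m\<close> of \<open>A\<close> by \<open>I \<Omega>\<^sup>m + dI \<and> \<Omega>\<^sup>m\<^sup>-\<^sup>1\<close>. For \<open>I = 0\<close> this says that \<open>\<Omega>\<^sup>m\<close> of \<open>A\<close> is free on the \<open>dx\<^sub>J\<close>.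
  For \<open>I = q\<^sup>k\<close> the first summand lives in degrees \<open>\<ge> m + k\<close> and fills them, while the second one
  lives in degrees \<open>\<ge> m + k - 1\<close>. So nothing is divided out below degree \<open>m + k - 1\<close>, a space of
  dimension \<open>\<delta>\<close> is divided out in that degree, and everything above it.
\<close>

section \<open>Modules\<close>

text \<open>The difficulty is the kernel of the coordinate map. That the two summands map to 0 is
  the easy inclusion. That nothing else does calls for a map back, from tuples of differentials to
  polynomial coordinates; made from arbitrary representatives it is not linear, so it is computed
  modulo the relations only. This is done once for every surjection from A onto a ring B, because
  both sides of the formula use it: with B = S, rank and nullity give the Hilbert function, and with
  B = A, where the coordinate map is injective, \<delta> becomes the dimension of a space of
  coordinate functions. In the critical degree only the second summand counts: a derivative of a
  polynomial of order k has order at least k - 1, while the first summand has coefficients of order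
  at least k. Elements of the sum need not be homogeneous, so the point to prove is that their
  lowest part already lies in the second summand. Coefficients are measured without the m factors
  dX_j of degree 1, so the bounds k - 1 and k for coefficients stand for the form degrees m + k - 1
  and m + k.\<close>

context Module.module
begin

lemma span_induct [consumes 2, case_names zero gen add smult]:
  assumes S: "S \<subseteq> carrier M" and x: "x \<in> span S"
    and "P \<zero>\<^bsub>M\<^esub>"
    and "\<And>x. x \<in> S \<Longrightarrow> P x"
    and "\<And>x y. x \<in> carrier M \<Longrightarrow> y \<in> carrier M \<Longrightarrow> P x \<Longrightarrow> P y \<Longrightarrow> P (x \<oplus>\<^bsub>M\<^esub> y)"
    and "\<And>a x. a \<in> carrier R \<Longrightarrow> x \<in> carrier M \<Longrightarrow> P x \<Longrightarrow> P (a \<odot>\<^bsub>M\<^esub> x)"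
  shows "P x"
proof -
  have "LinearCombinations.submodule R {x \<in> carrier M. P x} M"
    using assms by unfold_locales auto
  then have "span S \<subseteq> {x \<in> carrier M. P x}"
    using assms by (intro span_is_subset) auto
  then show ?thesis using x by auto
qed

lemma span_gen: "S \<subseteq> carrier M \<Longrightarrow> x \<in> S \<Longrightarrow> x \<in> span S"
  using in_own_span by blast

lemma submodule_uminus:
  assumes "LinearCombinations.submodule R N M" "x \<in> N"
  shows "\<ominus>\<^bsub>M\<^esub> x \<in> N"
  using assms smult_minus_1 submodule.smult_closed submodule.subset
  by (metis R.add.inv_closed R.one_closed subsetD)

lemma submodule_abelian_subgroup:
  assumes "LinearCombinations.submodule R N M"
  shows "abelian_subgroup N M"
proof -
  interpret N: LinearCombinations.submodule R N M by fact
  have "additive_subgroup N M"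
    using N.subset N.zero_closed submodule_uminus[OF assms]
    by (intro additive_subgroupI add.subgroupI) (auto simp: a_inv_def simp del: N.zero_closed)
  then show ?thesis
    by (intro abelian_subgroupI3) (auto intro: M.abelian_group_axioms)
qed

end

text \<open>The axioms pass along any surjection that respects the operations, so \<open>M'\<close>
  needs no prior structure. It serves for quotients and, over the ground field, for images of
  coordinate forms under \<open>\<Psi>\<close>.\<close>

lemma module_image:
  assumes "module R M"
    and c: "carrier M' = q ` carrier M"
    and z: "\<zero>\<^bsub>M'\<^esub> = q \<zero>\<^bsub>M\<^esub>"
    and a: "\<And>x y. x \<in> carrier M \<Longrightarrow> y \<in> carrier M \<Longrightarrow> q x \<oplus>\<^bsub>M'\<^esub> q y = q (x \<oplus>\<^bsub>M\<^esub> y)"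
    and s: "\<And>b x. b \<in> carrier R \<Longrightarrow> x \<in> carrier M \<Longrightarrow> b \<odot>\<^bsub>M'\<^esub> q x = q (b \<odot>\<^bsub>M\<^esub> x)"
  shows "module R M'"
proof -
  interpret Module.module R M by fact
  show ?thesis
  proof (rule module_criteria)
    show "\<forall>v\<in>carrier M'. \<exists>w\<in>carrier M'. v \<oplus>\<^bsub>M'\<^esub> w = \<zero>\<^bsub>M'\<^esub>"
    proof
      fix v assume "v \<in> carrier M'"
      then obtain x where x: "x \<in> carrier M" "v = q x" using c by auto
      then have "v \<oplus>\<^bsub>M'\<^esub> q (\<ominus>\<^bsub>M\<^esub> x) = \<zero>\<^bsub>M'\<^esub>" by (simp add: a z M.r_neg)
      then show "\<exists>w\<in>carrier M'. v \<oplus>\<^bsub>M'\<^esub> w = \<zero>\<^bsub>M'\<^esub>" using x c by blast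
    qed
  qed (auto simp: c z a s M.a_ac smult_assoc1 smult_l_distr smult_r_distr R.cring_axioms)
qed

subsection \<open>Quotients\<close>

locale quotient_module = Module.module R M for R and M (structure) +
  fixes N
  assumes N: "LinearCombinations.submodule R N M"
begin

sublocale N: LinearCombinations.submodule R N M by (rule N)
sublocale N: abelian_subgroup N M by (rule submodule_abelian_subgroup[OF N])

abbreviation cls where "cls x \<equiv> N +>\<^bsub>M\<^esub> x"

lemma cls_eq_iff:
  assumes "x \<in> carrier M" "y \<in> carrier M"
  shows "cls x = cls y \<longleftrightarrow> x \<ominus> y \<in> N"
proof -
  have "x \<in> cls y \<longleftrightarrow> x \<ominus> y \<in> N"
    using assms N.a_rcos_module[of y x] by (simp add: a_minus_def)
  then show ?thesis
    using assms N.a_rcos_self N.a_repr_independence' by metis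
qed

lemma cls_eq_zero_iff: "x \<in> carrier M \<Longrightarrow> cls x = N \<longleftrightarrow> x \<in> N"
  by (metis N.a_rcos_const N.a_rcos_self)

lemma carrier_quot: "carrier (quot_module M N) = cls ` carrier M"
  by (auto simp: quot_module_def FactRing_def A_RCOSETS_def')

lemma zero_quot: "\<zero>\<^bsub>quot_module M N\<^esub> = N"
  by (simp add: quot_module_def FactRing_def)

lemma add_quot:
  "x \<in> carrier M \<Longrightarrow> y \<in> carrier M \<Longrightarrow> cls x \<oplus>\<^bsub>quot_module M N\<^esub> cls y = cls (x \<oplus> y)"
  by (simp add: quot_module_def FactRing_def N.a_rcos_sum)

lemma mem_cls: "x \<in> carrier M \<Longrightarrow> y \<in> cls x \<Longrightarrow> y \<in> carrier M \<and> cls y = cls x"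
  using N.a_elemrcos_carrier N.a_repr_independence' by blast

text \<open>Scalar multiplication on \<open>quot_module\<close> and the product
  \<open>ext_mult\<close> are unions over all representatives of a coset. When the united sets do
  not depend on the representative, the union collapses to one of them.\<close>

lemma Union_cls:
  assumes "x \<in> carrier M" "\<And>y. y \<in> carrier M \<Longrightarrow> y \<ominus> x \<in> N \<Longrightarrow> g y = g x"
  shows "(\<Union>y\<in>cls x. g y) = g x"
proof -
  have "g y = g x" if "y \<in> cls x" for y
    using that assms mem_cls cls_eq_iff by metis
  moreover have "x \<in> cls x" using assms N.a_rcos_self by simp
  ultimately show ?thesis by blast
qed

lemma smult_quot:
  assumes "a \<in> carrier R" "x \<in> carrier M"
  shows "a \<odot>\<^bsub>quot_module M N\<^esub> cls x = cls (a \<odot> x)"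
proof -
  have "(\<Union>y\<in>cls x. cls (a \<odot> y)) = cls (a \<odot> x)"
  proof (rule Union_cls)
    fix y assume y: "y \<in> carrier M" "y \<ominus> x \<in> N"
    have "a \<odot> y \<ominus> a \<odot> x = a \<odot> (y \<ominus> x)"
      using assms y by (simp add: a_minus_def smult_r_distr smult_r_minus)
    then show "cls (a \<odot> y) = cls (a \<odot> x)" using assms y by (simp add: cls_eq_iff)
  qed fact
  then show ?thesis by (simp add: quot_module_def)
qed

lemma module_quot: "module R (quot_module M N)"
proof (rule module_image[where q = cls, OF module_axioms])
  show "\<zero>\<^bsub>quot_module M N\<^esub> = cls \<zero>"
    unfolding zero_quot using cls_eq_zero_iff[of \<zero>] N.zero_closed M.zero_closed by blast
qed (auto simp: carrier_quot add_quot smult_quot)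

end

subsection \<open>Free modules\<close>

context cring
begin

lemma free_module_simps:
  "f \<oplus>\<^bsub>free_module R X\<^esub> g = (\<lambda>x. f x \<oplus> g x)"
  "\<zero>\<^bsub>free_module R X\<^esub> = (\<lambda>x. \<zero>)"
  "b \<odot>\<^bsub>free_module R X\<^esub> f = (\<lambda>x. b \<otimes> f x)"
  by (auto simp: free_module_def)

lemma free_module_memD:
  assumes "f \<in> carrier (free_module R X)"
  shows "f x \<in> carrier R" "x \<notin> X \<Longrightarrow> f x = \<zero>" "finite {x. f x \<noteq> \<zero>}"
  using assms by (cases "x \<in> X"; auto simp: free_module_def)+

lemma free_module_memI:
  assumes "\<And>x. x \<in> X \<Longrightarrow> f x \<in> carrier R" "\<And>x. x \<notin> X \<Longrightarrow> f x = \<zero>" "finite {x. f x \<noteq> \<zero>}"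
  shows "f \<in> carrier (free_module R X)"
  using assms by (auto simp: free_module_def)

lemma module_free_module: "module R (free_module R X)"
proof (rule module_criteria)
  let ?F = "free_module R X"
  show "cring R" by (rule is_cring)
  show "\<zero>\<^bsub>?F\<^esub> \<in> carrier ?F" by (simp add: free_module_def)
  show "\<forall>v w. v \<in> carrier ?F \<and> w \<in> carrier ?F \<longrightarrow> v \<oplus>\<^bsub>?F\<^esub> w \<in> carrier ?F"
  proof clarify
    fix v w assume vw: "v \<in> carrier ?F" "w \<in> carrier ?F"
    have "{x. v x \<oplus> w x \<noteq> \<zero>} \<subseteq> {x. v x \<noteq> \<zero>} \<union> {x. w x \<noteq> \<zero>}" by auto
    then have "finite {x. v x \<oplus> w x \<noteq> \<zero>}"
      using vw free_module_memD(3) finite_subset by (metis finite_UnI)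
    then show "v \<oplus>\<^bsub>?F\<^esub> w \<in> carrier ?F"
      unfolding free_module_simps using vw by (intro free_module_memI) (auto simp: free_module_memD)
  qed
  show "\<forall>v\<in>carrier ?F. \<exists>w\<in>carrier ?F. v \<oplus>\<^bsub>?F\<^esub> w = \<zero>\<^bsub>?F\<^esub>"
  proof
    fix v assume v: "v \<in> carrier ?F"
    have "{x. \<ominus> v x \<noteq> \<zero>} \<subseteq> {x. v x \<noteq> \<zero>}" by auto
    then have "(\<lambda>x. \<ominus> v x) \<in> carrier ?F"
      using v finite_subset by (intro free_module_memI) (auto simp: free_module_memD)
    moreover have "v \<oplus>\<^bsub>?F\<^esub> (\<lambda>x. \<ominus> v x) = \<zero>\<^bsub>?F\<^esub>"
      using v by (auto simp: free_module_simps free_module_memD r_neg)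
    ultimately show "\<exists>w\<in>carrier ?F. v \<oplus>\<^bsub>?F\<^esub> w = \<zero>\<^bsub>?F\<^esub>" by blast
  qed
  show "\<forall>c v. c \<in> carrier R \<and> v \<in> carrier ?F \<longrightarrow> c \<odot>\<^bsub>?F\<^esub> v \<in> carrier ?F"
  proof clarify
    fix c v assume cv: "c \<in> carrier R" "v \<in> carrier ?F"
    have "{x. c \<otimes> v x \<noteq> \<zero>} \<subseteq> {x. v x \<noteq> \<zero>}" using cv by auto
    then have "finite {x. c \<otimes> v x \<noteq> \<zero>}"
      using cv free_module_memD(3) finite_subset by metis
    then show "c \<odot>\<^bsub>?F\<^esub> v \<in> carrier ?F"
      unfolding free_module_simps using cv
      by (intro free_module_memI) (auto simp: free_module_memD)
  qed
qed (auto simp: free_module_simps free_module_memD a_ac m_assoc l_distr r_distr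
    intro!: ext)

lemma free_gen_closed: "x \<in> X \<Longrightarrow> free_gen R x \<in> carrier (free_module R X)"
  by (intro free_module_memI) (auto simp: free_gen_def)

text \<open>Induction on the finite support: one point is removed from it, and the value there is
  put back as a multiple of a generator.\<close>

lemma free_module_induct [consumes 1, case_names zero gen add smult]:
  assumes f: "f \<in> carrier (free_module R X)"
    and "P (\<lambda>x. \<zero>)"
    and "\<And>x. x \<in> X \<Longrightarrow> P (free_gen R x)"
    and "\<And>f g. f \<in> carrier (free_module R X) \<Longrightarrow> g \<in> carrier (free_module R X) \<Longrightarrow> P f \<Longrightarrow> P g
      \<Longrightarrow> P (\<lambda>x. f x \<oplus> g x)"
    and "\<And>b f. b \<in> carrier R \<Longrightarrow> f \<in> carrier (free_module R X) \<Longrightarrow> P f \<Longrightarrow> P (\<lambda>x. b \<otimes> f x)"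
  shows "P f"
proof -
  interpret F: Module.module R "free_module R X" by (rule module_free_module)
  have "P f" if "finite Y" "f \<in> carrier (free_module R X)" "{x. f x \<noteq> \<zero>} \<subseteq> Y" "Y \<subseteq> X" for Y f
    using that
  proof (induction arbitrary: f)
    case empty
    then have "f = (\<lambda>x. \<zero>)" by auto
    then show ?case using assms(2) by simp
  next
    case (insert y Y)
    let ?g = "\<lambda>x. if x = y then \<zero> else f x"
    have g: "?g \<in> carrier (free_module R X)"
      using insert.prems free_module_memD[OF insert.prems(1)]
      by (intro free_module_memI) (auto elim: rev_finite_subset)
    have "P ?g" using insert.prems insert.hyps by (intro insert.IH g) auto
    moreover have e: "free_gen R y \<in> carrier (free_module R X)" "P (free_gen R y)"
      using insert.prems free_gen_closed assms(3) by auto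
    moreover have fy: "f y \<in> carrier R" using insert.prems free_module_memD by auto
    moreover have "(\<lambda>x. f y \<otimes> free_gen R y x) \<in> carrier (free_module R X)"
      using F.smult_closed[OF fy e(1)] by (simp add: free_module_simps)
    ultimately have "P (\<lambda>x. f y \<otimes> free_gen R y x \<oplus> ?g x)"
      using g assms(4,5) by blast
    moreover have "(\<lambda>x. f y \<otimes> free_gen R y x \<oplus> ?g x) = f"
      using fy free_module_memD(1)[OF insert.prems(1)] by (auto simp: free_gen_def)
    ultimately show ?case by simp
  qed
  from this[of "{x. f x \<noteq> \<zero>}" f] f show ?thesis using free_module_memD[OF f] by auto
qed

end

section \<open>Kaehler differentials\<close>

text \<open>The Kaehler relations see the scalars only through the elements
  \<open>c \<odot> \<one>\<close>, so this is where the action of \<open>K\<close> is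
  constrained.\<close>

locale algebra_over = cring B for K :: "('k, 'r) ring_scheme" and B :: "('k, 'b, 's) module_scheme" (structure) +
  assumes unit_smult_closed: "c \<in> carrier K \<Longrightarrow> c \<odot> \<one> \<in> carrier B"
begin

abbreviation "FB \<equiv> free_module B (carrier B)"

sublocale FB: Module.module B FB by (rule module_free_module)

lemma kaehler_rels_closed: "kaehler_rels K B \<subseteq> carrier FB"
  unfolding kaehler_rels_def Let_def
  by (auto intro!: FB.M.minus_closed FB.M.a_closed FB.smult_closed free_gen_closed unit_smult_closed)

sublocale KB: quotient_module B FB "kaehler_kernel K B"
  by (intro quotient_module.intro quotient_module_axioms.intro FB.module_axioms)
    (unfold kaehler_kernel_def, rule FB.span_is_submodule[OF kaehler_rels_closed])

lemma kaehler_quot: "kaehler K B = quot_module FB (kaehler_kernel K B)"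
  by (simp add: kaehler_def)

lemma univ_deriv_cls: "univ_deriv K B b = KB.cls (free_gen B b)"
  by (simp add: univ_deriv_def)

lemma module_kaehler: "Module.module B (kaehler K B)"
  unfolding kaehler_quot by (rule KB.module_quot)

lemma kaehler_kernelI: "r \<in> kaehler_rels K B \<Longrightarrow> r \<in> kaehler_kernel K B"
  unfolding kaehler_kernel_def by (intro FB.span_gen kaehler_rels_closed)

lemma kaehler_relsI:
  "a \<in> carrier B \<Longrightarrow> b \<in> carrier B \<Longrightarrow>
    free_gen B (a \<oplus> b) \<ominus>\<^bsub>FB\<^esub> (free_gen B a \<oplus>\<^bsub>FB\<^esub> free_gen B b) \<in> kaehler_rels K B"
  "a \<in> carrier B \<Longrightarrow> b \<in> carrier B \<Longrightarrow>
    free_gen B (a \<otimes> b) \<ominus>\<^bsub>FB\<^esub> ((a \<odot>\<^bsub>FB\<^esub> free_gen B b) \<oplus>\<^bsub>FB\<^esub> (b \<odot>\<^bsub>FB\<^esub> free_gen B a))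
      \<in> kaehler_rels K B"
  "c \<in> carrier K \<Longrightarrow> free_gen B (c \<odot> \<one>) \<in> kaehler_rels K B"
  unfolding kaehler_rels_def Let_def
  subgoal by (rule UnI1, rule UnI1, intro CollectI exI conjI, rule refl)
  subgoal by (rule UnI1, rule UnI2, intro CollectI exI conjI, rule refl)
  subgoal by (rule UnI2, intro CollectI exI conjI, rule refl)
  done

lemma univ_deriv_closed: "b \<in> carrier B \<Longrightarrow> univ_deriv K B b \<in> carrier (kaehler K B)"
  by (auto simp: kaehler_quot univ_deriv_cls KB.carrier_quot free_gen_closed)

lemma univ_deriv_add:
  assumes "a \<in> carrier B" "b \<in> carrier B"
  shows "univ_deriv K B (a \<oplus> b) = univ_deriv K B a \<oplus>\<^bsub>kaehler K B\<^esub> univ_deriv K B b"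
proof -
  have "free_gen B (a \<oplus> b) \<ominus>\<^bsub>FB\<^esub> (free_gen B a \<oplus>\<^bsub>FB\<^esub> free_gen B b) \<in> kaehler_kernel K B"
    using assms by (intro kaehler_kernelI kaehler_relsI)
  then show ?thesis
    using assms
    by (simp add: kaehler_quot univ_deriv_cls KB.add_quot KB.cls_eq_iff free_gen_closed)
qed

lemma univ_deriv_mult:
  assumes "a \<in> carrier B" "b \<in> carrier B"
  shows "univ_deriv K B (a \<otimes> b) =
    a \<odot>\<^bsub>kaehler K B\<^esub> univ_deriv K B b \<oplus>\<^bsub>kaehler K B\<^esub> b \<odot>\<^bsub>kaehler K B\<^esub> univ_deriv K B a"
proof -
  have "free_gen B (a \<otimes> b) \<ominus>\<^bsub>FB\<^esub> ((a \<odot>\<^bsub>FB\<^esub> free_gen B b) \<oplus>\<^bsub>FB\<^esub> (b \<odot>\<^bsub>FB\<^esub> free_gen B a))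
      \<in> kaehler_kernel K B"
    using assms by (intro kaehler_kernelI kaehler_relsI)
  then show ?thesis
    using assms
    by (simp add: kaehler_quot univ_deriv_cls KB.add_quot KB.smult_quot KB.cls_eq_iff free_gen_closed)
qed

lemma univ_deriv_unit_smult:
  assumes "c \<in> carrier K"
  shows "univ_deriv K B (c \<odot> \<one>) = \<zero>\<^bsub>kaehler K B\<^esub>"
proof -
  have "free_gen B (c \<odot> \<one>) \<in> kaehler_kernel K B"
    using assms by (intro kaehler_kernelI kaehler_relsI)
  then show ?thesis
    using assms unit_smult_closed
    by (simp add: kaehler_quot univ_deriv_cls KB.zero_quot KB.cls_eq_zero_iff free_gen_closed)
qed

lemma kaehler_induct [consumes 1, case_names zero gen add smult]:
  assumes x: "x \<in> carrier (kaehler K B)"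
    and z: "P \<zero>\<^bsub>kaehler K B\<^esub>"
    and g: "\<And>b. b \<in> carrier B \<Longrightarrow> P (univ_deriv K B b)"
    and a: "\<And>x y. x \<in> carrier (kaehler K B) \<Longrightarrow> y \<in> carrier (kaehler K B) \<Longrightarrow> P x \<Longrightarrow> P y
      \<Longrightarrow> P (x \<oplus>\<^bsub>kaehler K B\<^esub> y)"
    and s: "\<And>b x. b \<in> carrier B \<Longrightarrow> x \<in> carrier (kaehler K B) \<Longrightarrow> P x
      \<Longrightarrow> P (b \<odot>\<^bsub>kaehler K B\<^esub> x)"
  shows "P x"
proof -
  obtain f where f: "f \<in> carrier FB" "x = KB.cls f"
    using x by (auto simp: kaehler_quot KB.carrier_quot)
  have "P (KB.cls f)" using f(1)
  proof (induction rule: free_module_induct)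
    case zero
    have "KB.cls (\<lambda>x. \<zero>) = \<zero>\<^bsub>kaehler K B\<^esub>"
      using KB.cls_eq_zero_iff[of "\<lambda>x. \<zero>"] KB.N.zero_closed FB.M.zero_closed
      by (simp add: kaehler_quot KB.zero_quot free_module_simps)
    then show ?case using z by simp
  next
    case (gen b)
    then show ?case using g by (simp add: univ_deriv_cls)
  next
    case (add f h)
    have "KB.cls f \<in> carrier (kaehler K B)" "KB.cls h \<in> carrier (kaehler K B)"
      using add by (auto simp: kaehler_quot KB.carrier_quot)
    from a[OF this] add show ?case
      by (simp add: kaehler_quot KB.add_quot) (simp add: free_module_simps)
  next
    case (smult b f)
    have "KB.cls f \<in> carrier (kaehler K B)"
      using smult by (auto simp: kaehler_quot KB.carrier_quot)
    from s[OF smult(1) this] smult show ?case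
      by (simp add: kaehler_quot KB.smult_quot) (simp add: free_module_simps)
  qed
  then show ?thesis using f by simp
qed

end

section \<open>Exterior powers\<close>

lemma tuples_iff: "xs \<in> tuples M m \<longleftrightarrow> length xs = m \<and> set xs \<subseteq> carrier M"
  by (simp add: tuples_def)

lemma tuples_list_update: "xs \<in> tuples M m \<Longrightarrow> x \<in> carrier M \<Longrightarrow> xs[j := x] \<in> tuples M m"
  using set_update_subset_insert by (fastforce simp: tuples_iff)

text \<open>The map on representatives inside \<open>ext_mult\<close>, named so that its linearity
  can be stated.\<close>

definition prepend :: "('b, 'r) ring_scheme \<Rightarrow> 'x \<Rightarrow> ('x list \<Rightarrow> 'b) \<Rightarrow> 'x list \<Rightarrow> 'b" where
  "prepend B u f = (\<lambda>xs. case xs of [] \<Rightarrow> \<zero>\<^bsub>B\<^esub> | y # ys \<Rightarrow> if y = u then f ys else \<zero>\<^bsub>B\<^esub>)"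

lemma prepend_simps [simp]:
  "prepend B u f [] = \<zero>\<^bsub>B\<^esub>"
  "prepend B u f (y # ys) = (if y = u then f ys else \<zero>\<^bsub>B\<^esub>)"
  by (simp_all add: prepend_def)

lemma prepend_free_gen: "prepend B u (free_gen B xs) = free_gen B (u # xs)"
  by (auto simp: prepend_def free_gen_def split: list.splits)

locale exterior = Module.module R M for R (structure) and M (structure)
begin

abbreviation "F m \<equiv> free_module R (tuples M m)"
abbreviation "e \<equiv> free_gen R"

sublocale F: Module.module R "F m" for m by (rule module_free_module)

lemma e_closed: "length xs = m \<Longrightarrow> set xs \<subseteq> carrier M \<Longrightarrow> e xs \<in> carrier (F m)"
  by (intro free_gen_closed) (simp add: tuples_iff)

lemma e_update_closed: "xs \<in> tuples M m \<Longrightarrow> x \<in> carrier M \<Longrightarrow> e (xs[j := x]) \<in> carrier (F m)"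
  by (intro free_gen_closed tuples_list_update)

lemma ext_rels_cases [consumes 1, case_names add smult alt]:
  assumes "r \<in> ext_rels R M m"
  obtains xs j x y where "xs \<in> tuples M m" "j < m" "x \<in> carrier M" "y \<in> carrier M"
      "r = e (xs[j := x \<oplus>\<^bsub>M\<^esub> y]) \<ominus>\<^bsub>F m\<^esub> (e (xs[j := x]) \<oplus>\<^bsub>F m\<^esub> e (xs[j := y]))"
    | xs j b x where "xs \<in> tuples M m" "j < m" "b \<in> carrier R" "x \<in> carrier M"
      "r = e (xs[j := b \<odot>\<^bsub>M\<^esub> x]) \<ominus>\<^bsub>F m\<^esub> (b \<odot>\<^bsub>F m\<^esub> e (xs[j := x]))"
    | xs i j where "xs \<in> tuples M m" "i < j" "j < m" "xs ! i = xs ! j" "r = e xs"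
  using assms unfolding ext_rels_def Let_def
  by (elim UnE CollectE exE conjE) (simp_all only: that)

lemma ext_rels_add:
  "xs \<in> tuples M m \<Longrightarrow> j < m \<Longrightarrow> x \<in> carrier M \<Longrightarrow> y \<in> carrier M \<Longrightarrow>
    e (xs[j := x \<oplus>\<^bsub>M\<^esub> y]) \<ominus>\<^bsub>F m\<^esub> (e (xs[j := x]) \<oplus>\<^bsub>F m\<^esub> e (xs[j := y])) \<in> ext_rels R M m"
  unfolding ext_rels_def Let_def
  by (rule UnI1, rule UnI1, intro CollectI exI conjI, rule refl)

lemma ext_rels_smult:
  "xs \<in> tuples M m \<Longrightarrow> j < m \<Longrightarrow> b \<in> carrier R \<Longrightarrow> x \<in> carrier M \<Longrightarrow>
    e (xs[j := b \<odot>\<^bsub>M\<^esub> x]) \<ominus>\<^bsub>F m\<^esub> (b \<odot>\<^bsub>F m\<^esub> e (xs[j := x])) \<in> ext_rels R M m"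
  unfolding ext_rels_def Let_def
  by (rule UnI1, rule UnI2, intro CollectI exI conjI, rule refl)

lemma ext_rels_alt:
  "xs \<in> tuples M m \<Longrightarrow> i < j \<Longrightarrow> j < m \<Longrightarrow> xs ! i = xs ! j \<Longrightarrow> e xs \<in> ext_rels R M m"
  unfolding ext_rels_def Let_def
  by (rule UnI2, intro CollectI exI conjI, rule refl)

lemma ext_rels_closed: "ext_rels R M m \<subseteq> carrier (F m)"
proof
  fix r assume "r \<in> ext_rels R M m"
  then show "r \<in> carrier (F m)"
    by (cases rule: ext_rels_cases)
      (auto intro!: F.M.minus_closed F.M.a_closed F.smult_closed free_gen_closed tuples_list_update)
qed

sublocale E: quotient_module R "F m" "ext_kernel R M m" for m
  by (intro quotient_module.intro quotient_module_axioms.intro F.module_axioms)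
    (unfold ext_kernel_def, rule F.span_is_submodule[OF ext_rels_closed])

abbreviation "\<Lambda> m \<equiv> ext_power R M m"

lemma ext_power_quot: "\<Lambda> m = quot_module (F m) (ext_kernel R M m)"
  by (simp add: ext_power_def)

lemma ext_prod_cls: "length xs = m \<Longrightarrow> ext_prod R M xs = E.cls m (e xs)"
  by (auto simp: ext_prod_def)

lemma module_ext_power: "Module.module R (\<Lambda> m)"
  unfolding ext_power_quot by (rule E.module_quot)

sublocale L: Module.module R "\<Lambda> m" for m by (rule module_ext_power)

lemma ext_kernelI: "r \<in> ext_rels R M m \<Longrightarrow> r \<in> ext_kernel R M m"
  unfolding ext_kernel_def by (intro F.span_gen ext_rels_closed)

lemma ext_prod_closed: "length xs = m \<Longrightarrow> set xs \<subseteq> carrier M \<Longrightarrow> ext_prod R M xs \<in> carrier (\<Lambda> m)"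
  by (auto simp: ext_power_quot ext_prod_cls[of _ m] E.carrier_quot e_closed)

text \<open>Additivity in the first slot becomes additivity of \<open>ext_mult\<close> in its left
  factor.\<close>

lemma ext_prod_Cons_add:
  assumes "x \<in> carrier M" "y \<in> carrier M" "set xs \<subseteq> carrier M" "length xs = m"
  shows "ext_prod R M ((x \<oplus>\<^bsub>M\<^esub> y) # xs) =
    ext_prod R M (x # xs) \<oplus>\<^bsub>\<Lambda> (Suc m)\<^esub> ext_prod R M (y # xs)"
  using ext_kernelI[OF ext_rels_add, of "x # xs" "Suc m" 0 x y] assms
  by (simp add: tuples_iff ext_prod_cls[of _ "Suc m"] ext_power_quot E.add_quot E.cls_eq_iff e_closed)

lemma ext_prod_Cons_smult:
  assumes "b \<in> carrier R" "x \<in> carrier M" "set xs \<subseteq> carrier M" "length xs = m"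
  shows "ext_prod R M ((b \<odot>\<^bsub>M\<^esub> x) # xs) = b \<odot>\<^bsub>\<Lambda> (Suc m)\<^esub> ext_prod R M (x # xs)"
  using ext_kernelI[OF ext_rels_smult, of "x # xs" "Suc m" 0 b x] assms
  by (simp add: tuples_iff ext_prod_cls[of _ "Suc m"] ext_power_quot E.smult_quot E.cls_eq_iff e_closed)

lemma ext_prod_Cons_Cons_same:
  assumes "x \<in> carrier M" "set xs \<subseteq> carrier M" "length xs = m"
  shows "ext_prod R M (x # x # xs) = \<zero>\<^bsub>\<Lambda> (Suc (Suc m))\<^esub>"
  using ext_kernelI[OF ext_rels_alt, of "x # x # xs" "Suc (Suc m)" 0 1] assms
  by (simp add: tuples_iff ext_prod_cls[of _ "Suc (Suc m)"] ext_power_quot E.zero_quot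
      E.cls_eq_zero_iff e_closed)

lemma ext_power_induct [consumes 1, case_names zero gen add smult]:
  assumes x: "x \<in> carrier (\<Lambda> m)"
    and z: "P \<zero>\<^bsub>\<Lambda> m\<^esub>"
    and g: "\<And>xs. length xs = m \<Longrightarrow> set xs \<subseteq> carrier M \<Longrightarrow> P (ext_prod R M xs)"
    and a: "\<And>x y. x \<in> carrier (\<Lambda> m) \<Longrightarrow> y \<in> carrier (\<Lambda> m) \<Longrightarrow> P x \<Longrightarrow> P y \<Longrightarrow> P (x \<oplus>\<^bsub>\<Lambda> m\<^esub> y)"
    and s: "\<And>b x. b \<in> carrier R \<Longrightarrow> x \<in> carrier (\<Lambda> m) \<Longrightarrow> P x \<Longrightarrow> P (b \<odot>\<^bsub>\<Lambda> m\<^esub> x)"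
  shows "P x"
proof -
  obtain f where f: "f \<in> carrier (F m)" "x = E.cls m f"
    using x by (auto simp: ext_power_quot E.carrier_quot)
  have "P (E.cls m f)" using f(1)
  proof (induction rule: free_module_induct)
    case zero
    have "E.cls m (\<lambda>x. \<zero>) = \<zero>\<^bsub>\<Lambda> m\<^esub>"
      using E.cls_eq_zero_iff[of "\<lambda>x. \<zero>" m] E.N.zero_closed[of m] F.M.zero_closed[of m]
      by (simp add: ext_power_quot E.zero_quot free_module_simps)
    then show ?case using z by simp
  next
    case (gen xs)
    then show ?case using g[of xs] by (auto simp: ext_prod_cls[of _ m] tuples_iff)
  next
    case (add f h)
    have "E.cls m f \<in> carrier (\<Lambda> m)" "E.cls m h \<in> carrier (\<Lambda> m)"
      using add by (auto simp: ext_power_quot E.carrier_quot)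
    from a[OF this] add show ?case
      by (simp add: ext_power_quot E.add_quot) (simp add: free_module_simps)
  next
    case (smult b f)
    have "E.cls m f \<in> carrier (\<Lambda> m)"
      using smult by (auto simp: ext_power_quot E.carrier_quot)
    from s[OF smult(1) this] smult show ?case
      by (simp add: ext_power_quot E.smult_quot) (simp add: free_module_simps)
  qed
  then show ?thesis using f by simp
qed

subsection \<open>Left multiplication by a vector\<close>

lemma prepend_closed:
  assumes "u \<in> carrier M" "f \<in> carrier (F m)"
  shows "prepend R u f \<in> carrier (F (Suc m))"
proof (rule free_module_memI)
  have "{xs. prepend R u f xs \<noteq> \<zero>} \<subseteq> (#) u ` {xs. f xs \<noteq> \<zero>}"
  proof
    fix xs assume "xs \<in> {xs. prepend R u f xs \<noteq> \<zero>}"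
    then show "xs \<in> (#) u ` {xs. f xs \<noteq> \<zero>}" by (cases xs) (auto split: if_splits)
  qed
  then show "finite {xs. prepend R u f xs \<noteq> \<zero>}"
    using free_module_memD(3)[OF assms(2)] finite_surj by blast
  show "prepend R u f xs \<in> carrier R" for xs
    using free_module_memD(1)[OF assms(2)] by (cases xs) auto
  show "prepend R u f xs = \<zero>" if "xs \<notin> tuples M (Suc m)" for xs
    using that assms(1) free_module_memD(2)[OF assms(2)]
    by (cases xs) (auto simp: tuples_iff)
qed

lemma prepend_hom:
  assumes "u \<in> carrier M"
  shows "mod_hom R (F m) (F (Suc m)) (prepend R u)"
proof (intro mod_hom.intro mod_hom_axioms.intro module_free_module)
  show "prepend R u \<in> LinearCombinations.module_hom R (F m) (F (Suc m))"
    unfolding LinearCombinations.module_hom_def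
    using assms
    by (auto simp: prepend_closed) (auto simp: free_module_simps prepend_def split: list.splits)
qed

text \<open>Prepending \<open>u\<close> turns a multilinear or alternating relation into one of the
  same kind, one position further right. Hence left multiplication by \<open>u\<close> descends to
  the quotients.\<close>

lemma prepend_ext_kernel:
  assumes u: "u \<in> carrier M" and f: "f \<in> ext_kernel R M m"
  shows "prepend R u f \<in> ext_kernel R M (Suc m)"
proof -
  interpret P: mod_hom R "F m" "F (Suc m)" "prepend R u"
    using u by (rule prepend_hom)
  have "f \<in> F.span m (ext_rels R M m)" using f by (simp add: ext_kernel_def)
  with ext_rels_closed show ?thesis
  proof (induction rule: F.span_induct)
    case zero
    then show ?case using P.f0_is_0 E.N.zero_closed[of "Suc m"] by simp
  next
    case (gen r)
    then have "prepend R u r \<in> ext_rels R M (Suc m)"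
    proof (cases rule: ext_rels_cases)
      case (add xs j x y)
      then show ?thesis
        using ext_rels_add[of "u # xs" "Suc m" "Suc j" x y] u
        by (simp add: e_update_closed prepend_free_gen tuples_iff)
    next
      case (smult xs j b x)
      then show ?thesis
        using ext_rels_smult[of "u # xs" "Suc m" "Suc j" b x] u
        by (simp add: e_update_closed prepend_free_gen tuples_iff)
    next
      case (alt xs i j)
      then show ?thesis
        using ext_rels_alt[of "u # xs" "Suc m" "Suc i" "Suc j"] u
        by (simp add: prepend_free_gen tuples_iff)
    qed
    then show ?case by (rule ext_kernelI)
  next
    case (add x y)
    then show ?case using E.N.m_closed[of _ "Suc m"] by simp
  next
    case (smult a x)
    then show ?case using E.N.smult_closed[of _ _ "Suc m"] by simp
  qed
qed

lemma ext_mult_cls: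
  assumes u: "u \<in> carrier M" and f: "f \<in> carrier (F m)"
  shows "ext_mult R M (Suc m) u (E.cls m f) = E.cls (Suc m) (prepend R u f)"
proof -
  interpret P: mod_hom R "F m" "F (Suc m)" "prepend R u"
    using u by (rule prepend_hom)
  have "(\<Union>g\<in>E.cls m f. E.cls (Suc m) (prepend R u g)) = E.cls (Suc m) (prepend R u f)"
  proof (rule E.Union_cls[OF f])
    fix g assume g: "g \<in> carrier (F m)" "g \<ominus>\<^bsub>F m\<^esub> f \<in> ext_kernel R M m"
    have "prepend R u g \<ominus>\<^bsub>F (Suc m)\<^esub> prepend R u f \<in> ext_kernel R M (Suc m)"
      using prepend_ext_kernel[OF u g(2)] f g(1) by simp
    then show "E.cls (Suc m) (prepend R u g) = E.cls (Suc m) (prepend R u f)"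
      using E.cls_eq_iff[of _ "Suc m"] f g(1) by simp
  qed
  then show ?thesis by (simp add: ext_mult_def prepend_def)
qed

lemma ext_mult_hom:
  assumes "u \<in> carrier M"
  shows "mod_hom R (\<Lambda> m) (\<Lambda> (Suc m)) (ext_mult R M (Suc m) u)"
proof (intro mod_hom.intro mod_hom_axioms.intro module_ext_power)
  interpret P: mod_hom R "F m" "F (Suc m)" "prepend R u"
    using assms by (rule prepend_hom)
  show "ext_mult R M (Suc m) u \<in> LinearCombinations.module_hom R (\<Lambda> m) (\<Lambda> (Suc m))"
    unfolding LinearCombinations.module_hom_def ext_power_quot using assms
    by (auto simp: E.carrier_quot ext_mult_cls E.add_quot E.smult_quot)
qed

lemma ext_mult_closed:
  "u \<in> carrier M \<Longrightarrow> W \<in> carrier (\<Lambda> m) \<Longrightarrow> ext_mult R M (Suc m) u W \<in> carrier (\<Lambda> (Suc m))"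
  using mod_hom.f_im[OF ext_mult_hom] .

lemma ext_mult_ext_prod:
  "u \<in> carrier M \<Longrightarrow> set xs \<subseteq> carrier M \<Longrightarrow> length xs = m \<Longrightarrow>
    ext_mult R M (Suc m) u (ext_prod R M xs) = ext_prod R M (u # xs)"
  by (simp add: ext_prod_cls[of _ m] ext_prod_cls[of _ "Suc m"] ext_mult_cls e_closed prepend_free_gen)

lemma ext_mult_add_left:
  assumes "u \<in> carrier M" "v \<in> carrier M" "W \<in> carrier (\<Lambda> m)"
  shows "ext_mult R M (Suc m) (u \<oplus>\<^bsub>M\<^esub> v) W =
    ext_mult R M (Suc m) u W \<oplus>\<^bsub>\<Lambda> (Suc m)\<^esub> ext_mult R M (Suc m) v W"
proof -
  interpret U: mod_hom R "\<Lambda> m" "\<Lambda> (Suc m)" "ext_mult R M (Suc m) u" using assms by (intro ext_mult_hom)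
  interpret V: mod_hom R "\<Lambda> m" "\<Lambda> (Suc m)" "ext_mult R M (Suc m) v" using assms by (intro ext_mult_hom)
  interpret UV: mod_hom R "\<Lambda> m" "\<Lambda> (Suc m)" "ext_mult R M (Suc m) (u \<oplus>\<^bsub>M\<^esub> v)"
    using assms by (intro ext_mult_hom) simp
  show ?thesis using assms(3)
  proof (induction rule: ext_power_induct)
    case (gen xs)
    then show ?case using assms by (simp add: ext_mult_ext_prod ext_prod_Cons_add)
  qed (use assms in \<open>auto simp: L.M.a_ac L.smult_r_distr\<close>)
qed

lemma ext_mult_smult_left:
  assumes "b \<in> carrier R" "u \<in> carrier M" "W \<in> carrier (\<Lambda> m)"
  shows "ext_mult R M (Suc m) (b \<odot>\<^bsub>M\<^esub> u) W = b \<odot>\<^bsub>\<Lambda> (Suc m)\<^esub> ext_mult R M (Suc m) u W"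
proof -
  interpret U: mod_hom R "\<Lambda> m" "\<Lambda> (Suc m)" "ext_mult R M (Suc m) u" using assms by (intro ext_mult_hom)
  interpret V: mod_hom R "\<Lambda> m" "\<Lambda> (Suc m)" "ext_mult R M (Suc m) (b \<odot>\<^bsub>M\<^esub> u)"
    using assms by (intro ext_mult_hom) simp
  show ?thesis using assms(3)
  proof (induction rule: ext_power_induct)
    case (gen xs)
    then show ?case using assms by (simp add: ext_mult_ext_prod ext_prod_Cons_smult)
  next
    case (smult c x)
    then have "c \<odot>\<^bsub>\<Lambda> (Suc m)\<^esub> (b \<odot>\<^bsub>\<Lambda> (Suc m)\<^esub> ext_mult R M (Suc m) u x) =
        b \<odot>\<^bsub>\<Lambda> (Suc m)\<^esub> (c \<odot>\<^bsub>\<Lambda> (Suc m)\<^esub> ext_mult R M (Suc m) u x)"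
      using assms by (metis L.smult_assoc1 R.m_comm U.f_im)
    with smult assms show ?case by simp
  qed (use assms in \<open>auto simp: L.smult_r_distr\<close>)
qed

lemma ext_mult_same:
  assumes "u \<in> carrier M" "W \<in> carrier (\<Lambda> m)"
  shows "ext_mult R M (Suc (Suc m)) u (ext_mult R M (Suc m) u W) = \<zero>\<^bsub>\<Lambda> (Suc (Suc m))\<^esub>"
proof -
  interpret U: mod_hom R "\<Lambda> m" "\<Lambda> (Suc m)" "ext_mult R M (Suc m) u" using assms by (intro ext_mult_hom)
  interpret V: mod_hom R "\<Lambda> (Suc m)" "\<Lambda> (Suc (Suc m))" "ext_mult R M (Suc (Suc m)) u"
    using assms by (intro ext_mult_hom) simp
  show ?thesis using assms(2)
    by (induction rule: ext_power_induct)
      (use assms in \<open>auto simp: ext_mult_ext_prod ext_prod_Cons_Cons_same\<close>)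
qed

text \<open>Polarization: in the square of u + v the two pure squares vanish, so the mixed terms are
  opposite.\<close>

lemma ext_mult_swap:
  assumes "u \<in> carrier M" "v \<in> carrier M" "W \<in> carrier (\<Lambda> m)"
  shows "ext_mult R M (Suc (Suc m)) u (ext_mult R M (Suc m) v W) =
    \<ominus>\<^bsub>\<Lambda> (Suc (Suc m))\<^esub> ext_mult R M (Suc (Suc m)) v (ext_mult R M (Suc m) u W)"
    (is "?uv = \<ominus>\<^bsub>_\<^esub> ?vu")
proof -
  let ?L = "\<Lambda> (Suc (Suc m))"
  interpret U: mod_hom R "\<Lambda> (Suc m)" ?L "ext_mult R M (Suc (Suc m)) u"
    using assms by (intro ext_mult_hom)
  interpret V: mod_hom R "\<Lambda> (Suc m)" ?L "ext_mult R M (Suc (Suc m)) v"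
    using assms by (intro ext_mult_hom)
  have c: "?uv \<in> carrier ?L" "?vu \<in> carrier ?L"
    using assms by (auto intro!: ext_mult_closed)
  have "\<zero>\<^bsub>?L\<^esub> = ext_mult R M (Suc (Suc m)) (u \<oplus>\<^bsub>M\<^esub> v) (ext_mult R M (Suc m) (u \<oplus>\<^bsub>M\<^esub> v) W)"
    using assms by (intro ext_mult_same[symmetric]) auto
  also have "\<dots> = ?uv \<oplus>\<^bsub>?L\<^esub> ?vu"
    using assms c by (simp add: ext_mult_add_left ext_mult_closed ext_mult_same)
  finally show ?thesis using c L.M.minus_equality by metis
qed

end

section \<open>Polynomials\<close>

abbreviation "keys \<equiv> Poly_Mapping.keys"
abbreviation "lookup \<equiv> Poly_Mapping.lookup"
abbreviation "single \<equiv> Poly_Mapping.single"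

type_synonym 'k form = "nat set \<Rightarrow> 'k mpoly"

section \<open>Total degree of monomials\<close>

definition mdeg :: "(nat \<Rightarrow>\<^sub>0 nat) \<Rightarrow> nat" where
  "mdeg t = (\<Sum>j\<in>keys t. lookup t j)"

lemma mdeg_add: "mdeg (s + t) = mdeg s + mdeg t"
  unfolding mdeg_def by (rule setsum_keys_plus_distrib) auto

lemma mdeg_zero [simp]: "mdeg 0 = 0"
  by (simp add: mdeg_def)

lemma mdeg_single [simp]: "mdeg (single j a) = a"
  by (cases "a = 0") (auto simp: mdeg_def)

lemma mdeg_eq_0_iff: "mdeg t = 0 \<longleftrightarrow> t = 0"
proof
  assume "mdeg t = 0"
  then have "lookup t j = 0" for j
    by (cases "j \<in> keys t") (auto simp: mdeg_def in_keys_iff)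
  then show "t = 0" by (intro poly_mapping_eqI) simp
qed simp

lemma minus_single_add:
  fixes t :: "nat \<Rightarrow>\<^sub>0 nat"
  assumes "lookup t j > 0"
  shows "t - single j 1 + single j 1 = t"
  using assms by (intro poly_mapping_eqI) (auto simp: lookup_add lookup_minus lookup_single when_def)

lemma keys_minus_subset: "keys (t - s) \<subseteq> keys (t :: nat \<Rightarrow>\<^sub>0 nat)"
  by (auto simp: in_keys_iff lookup_minus)

lemma sum_single: "(\<Sum>t\<in>keys p. single t (lookup p t)) = p"
proof (rule poly_mapping_eqI)
  fix s
  have "lookup (\<Sum>t\<in>keys p. single t (lookup p t)) s
     = (\<Sum>t\<in>keys p. if t = s then lookup p t else 0)"
    unfolding lookup_sum by (intro sum.cong) (auto simp: lookup_single when_def)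
  then show "lookup (\<Sum>t\<in>keys p. single t (lookup p t)) s
     = lookup p s"
    by (simp add: in_keys_iff)
qed

text \<open>The monomials in the second case are limited to those of \<open>p\<close>, so that what
  is known about the support of \<open>p\<close> remains available for single terms.\<close>

lemma mpoly_induct [case_names zero single add]:
  fixes p :: "'a \<Rightarrow>\<^sub>0 'b::comm_monoid_add"
  assumes "P 0"
    and s: "\<And>t c. t \<in> keys p \<Longrightarrow> P (single t c)"
    and a: "\<And>q r. P q \<Longrightarrow> P r \<Longrightarrow> P (q + r)"
  shows "P p"
proof -
  have "P (\<Sum>t\<in>T. single t (lookup p t))"
    if "T \<subseteq> keys p" for T
    using finite_subset[OF that finite_keys] that
    by (induction T rule: finite_induct) (simp_all add: assms)
  from this[of "keys p"] show ?thesis by (simp add: sum_single)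
qed

text \<open>The formal derivative by the variable \<open>j\<close>. Exponents are subtracted with
  truncation, which is harmless: where the exponent of \<open>j\<close> is 0, the coefficient
  becomes 0.\<close>

definition pd :: "nat \<Rightarrow> 'k::field mpoly \<Rightarrow> 'k mpoly" where
  "pd j p = (\<Sum>t\<in>keys p.
     single (t - single j 1)
       (of_nat (lookup t j) * lookup p t))"

lemma pd_single:
  "pd j (single t c) =
    single (t - single j 1) (of_nat (lookup t j) * c)"
  by (cases "c = 0") (auto simp: pd_def)

lemma pd_add: "pd j (p + q) = pd j p + pd j q"
  unfolding pd_def
  by (rule setsum_keys_plus_distrib) (auto simp: single_add distrib_left)

lemma pd_zero [simp]: "pd j 0 = 0"
  by (simp add: pd_def)

lemma pd_uminus: "pd j (- p) = - pd j p"
  using pd_add[of j p "- p"] by (simp add: eq_neg_iff_add_eq_0 add.commute)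

lemma pd_diff: "pd j (p - q) = pd j p - pd j q"
  using pd_add[of j p "- q"] by (simp add: pd_uminus)

lemma pd_mult_single:
  "pd j (single s a * single t b) =
    single s a * pd j (single t b) +
    single t b * pd j (single s a)"
proof -
  \<comment> \<open>Truncated subtraction commutes with adding \<open>s\<close> when
    \<open>j\<close> occurs in \<open>t\<close>; otherwise both coefficients are 0.\<close>
  have *: "single (s + t - single j 1) (of_nat (lookup t j) * (a * b))
      = single (s + (t - single j 1)) (of_nat (lookup t j) * (a * b))"
    for s t and a b :: 'a
  proof (cases "lookup t j = 0")
    case False
    then have "s + t - single j 1 = s + (t - single j 1)"
      by (intro poly_mapping_eqI) (auto simp: lookup_add lookup_minus lookup_single when_def)
    then show ?thesis by simp
  qed simp
  have "pd j (single s a * single t b) =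
      single (s + t - single j 1) (of_nat (lookup t j) * (a * b)) +
      single (t + s - single j 1) (of_nat (lookup s j) * (b * a))"
    by (simp add: mult_single pd_single lookup_add distrib_right single_add add.commute[of t s]
        mult.commute[of b a] add.commute)
  also have "\<dots> = single s a * pd j (single t b) +
      single t b * pd j (single s a)"
    unfolding * by (simp add: mult_single pd_single mult.left_commute)
  finally show ?thesis .
qed

lemma pd_mult: "pd j (p * q) = p * pd j q + q * pd j p"
proof (induction p rule: mpoly_induct)
  case (single t c)
  show ?case
    by (induction q rule: mpoly_induct) (auto simp: pd_mult_single distrib_left distrib_right pd_add)
qed (auto simp: pd_add distrib_left distrib_right)

section \<open>Polynomials in the first n variables\<close>

abbreviation "pcarrier n \<equiv> carrier (polys n)"

lemma pcarrier_iff: "p \<in> pcarrier n \<longleftrightarrow> (\<forall>t\<in>keys p. keys t \<subseteq> {..<n})"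
  by (simp add: polys_def)

lemma polys_simps [simp]:
  "\<one>\<^bsub>polys n\<^esub> = 1" "\<zero>\<^bsub>polys n\<^esub> = 0" "p \<otimes>\<^bsub>polys n\<^esub> q = p * q" "p \<oplus>\<^bsub>polys n\<^esub> q = p + q"
  "c \<odot>\<^bsub>polys n\<^esub> p = single 0 c * p"
  by (simp_all add: polys_def)

lemma pcarrier_zero [simp]: "0 \<in> pcarrier n"
  and pcarrier_one [simp]: "1 \<in> pcarrier n"
  and pcarrier_const [simp]: "single 0 c \<in> pcarrier n"
  by (auto simp: pcarrier_iff)

lemma pcarrier_add [intro]: "p \<in> pcarrier n \<Longrightarrow> q \<in> pcarrier n \<Longrightarrow> p + q \<in> pcarrier n"
  using Poly_Mapping.keys_add[of p q] by (auto simp: pcarrier_iff)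

lemma pcarrier_mult [intro]: "p \<in> pcarrier n \<Longrightarrow> q \<in> pcarrier n \<Longrightarrow> p * q \<in> pcarrier n"
proof -
  assume p: "p \<in> pcarrier n" and q: "q \<in> pcarrier n"
  have "keys (s + t) \<subseteq> {..<n}"
    if "s \<in> keys p" "t \<in> keys q" for s t
    using Poly_Mapping.keys_add[of s t] that p q unfolding pcarrier_iff by blast
  then show ?thesis
    using keys_mult[of p q] unfolding pcarrier_iff by blast
qed

lemma pcarrier_uminus [intro]: "p \<in> pcarrier n \<Longrightarrow> - p \<in> pcarrier n"
  by (auto simp: pcarrier_iff in_keys_iff)

lemma pcarrier_diff [intro]: "p \<in> pcarrier n \<Longrightarrow> q \<in> pcarrier n \<Longrightarrow> p - q \<in> pcarrier n"
  using pcarrier_add[of p n "- q"] by auto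

lemma pcarrier_sum: "(\<And>x. x \<in> X \<Longrightarrow> f x \<in> pcarrier n) \<Longrightarrow> sum f X \<in> pcarrier n"
  by (induction X rule: infinite_finite_induct) auto

lemma pcarrier_power [intro]: "p \<in> pcarrier n \<Longrightarrow> p ^ k \<in> pcarrier n"
  by (induction k) auto

lemma pcarrier_singleI: "keys t \<subseteq> {..<n} \<Longrightarrow> single t c \<in> pcarrier n"
  by (auto simp: pcarrier_iff)

lemma pcarrier_polyvar: "j < n \<Longrightarrow> polyvar j \<in> pcarrier n"
  by (auto simp: polyvar_def intro!: pcarrier_singleI)

lemma pcarrier_pd:
  assumes "p \<in> pcarrier n"
  shows "pd j p \<in> pcarrier n"
  unfolding pd_def
proof (intro pcarrier_sum pcarrier_singleI)
  fix t assume "t \<in> keys p"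
  then show "keys (t - single j 1) \<subseteq> {..<n}"
    using assms keys_minus_subset[of t] by (auto simp: pcarrier_iff)
qed

lemma pd_eq_0:
  assumes "p \<in> pcarrier n" "\<not> j < n"
  shows "pd j p = 0"
  unfolding pd_def
proof (rule sum.neutral, safe)
  fix t assume "t \<in> keys p"
  then have "j \<notin> keys t" using assms by (auto simp: pcarrier_iff)
  then show "single (t - single j 1)
      (of_nat (lookup t j) * lookup p t) = 0"
    by (simp add: in_keys_iff)
qed

lemma pd_polyvar: "pd i (polyvar j) = (if i = j then 1 else 0)"
  by (auto simp: polyvar_def pd_single lookup_single when_def)

lemma pd_const: "pd i (single 0 c) = 0"
  by (simp add: pd_single)

lemma single_eq_polyvar_mult:
  "lookup t j > 0 \<Longrightarrow>
    single t c = polyvar j * single (t - single j 1) c"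
  using minus_single_add[of t j] by (simp add: polyvar_def mult_single add.commute)

text \<open>The polynomials are generated as an algebra by constants and variables. For monomials
  this is an induction on the total degree that peels off one variable at a time.\<close>

lemma pcarrier_induct [consumes 1, case_names const var add mult]:
  assumes p: "p \<in> pcarrier n"
    and c: "\<And>c. Q (single 0 c)"
    and v: "\<And>j. j < n \<Longrightarrow> Q (polyvar j)"
    and a: "\<And>p q. p \<in> pcarrier n \<Longrightarrow> q \<in> pcarrier n \<Longrightarrow> Q p \<Longrightarrow> Q q \<Longrightarrow> Q (p + q)"
    and m: "\<And>p q. p \<in> pcarrier n \<Longrightarrow> q \<in> pcarrier n \<Longrightarrow> Q p \<Longrightarrow> Q q \<Longrightarrow> Q (p * q)"
  shows "Q p"
proof -
  have mono: "Q (single t c)" if "keys t \<subseteq> {..<n}" for t c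
    using that
  proof (induction "mdeg t" arbitrary: t)
    case 0
    then show ?case using c mdeg_eq_0_iff[of t] by simp
  next
    case (Suc d)
    then have "t \<noteq> 0" by auto
    then obtain j where j: "j \<in> keys t" by (metis keys_eq_empty ex_in_conv)
    let ?s = "t - single j 1"
    have l: "lookup t j > 0" using j by (simp add: in_keys_iff)
    have k: "keys ?s \<subseteq> {..<n}"
      using Suc(3) keys_minus_subset[of t "single j 1"] by blast
    have "mdeg ?s + 1 = mdeg t"
      using mdeg_add[of ?s "single j 1"] minus_single_add[OF l] by simp
    then have "Q (single ?s c)" using Suc k by simp
    moreover have "j < n" using j Suc(3) by auto
    ultimately show ?case
      unfolding single_eq_polyvar_mult[OF l] using k
      by (intro m v) (auto intro: pcarrier_polyvar pcarrier_singleI)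
  qed
  have "p \<in> pcarrier n \<and> Q p"
  proof (induction p rule: mpoly_induct)
    case zero
    then show ?case using c[of 0] by simp
  next
    case (single t c)
    then show ?case using p mono by (simp add: pcarrier_iff)
  next
    case (add q r)
    then show ?case using a pcarrier_add by blast
  qed
  then show ?thesis by simp
qed

subsection \<open>Homogeneous polynomials and the order filtration\<close>

definition homog :: "nat \<Rightarrow> 'k::field mpoly set" where
  "homog d = {p. \<forall>t\<in>keys p. mdeg t = d}"

text \<open>The order filtration. Inside \<open>pcarrier n\<close> it is the filtration by powers of
  the irrelevant ideal, as \<open>irrelevant_pow_eq\<close> shows.\<close>

definition order_ge :: "nat \<Rightarrow> 'k::field mpoly set" where
  "order_ge d = {p. \<forall>t\<in>keys p. d \<le> mdeg t}"

lemma polys_component_eq: "polys_component n d = pcarrier n \<inter> homog d"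
  by (auto simp: polys_component_def homog_def mdeg_def)

lemma homog_zero [simp]: "0 \<in> homog d" and order_ge_zero [simp]: "0 \<in> order_ge d"
  by (auto simp: homog_def order_ge_def)

lemma homog_add: "p \<in> homog d \<Longrightarrow> q \<in> homog d \<Longrightarrow> p + q \<in> homog d"
  and order_ge_add: "p \<in> order_ge d \<Longrightarrow> q \<in> order_ge d \<Longrightarrow> p + q \<in> order_ge d"
  using Poly_Mapping.keys_add[of p q] by (auto simp: homog_def order_ge_def)

lemma homog_mult: "p \<in> homog d \<Longrightarrow> q \<in> homog d' \<Longrightarrow> p * q \<in> homog (d + d')"
  and order_ge_mult: "p \<in> order_ge d \<Longrightarrow> q \<in> order_ge d' \<Longrightarrow> p * q \<in> order_ge (d + d')"
proof -
  have *: "\<exists>s\<in>keys p. \<exists>u\<in>keys q. mdeg t = mdeg s + mdeg u"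
    if "t \<in> keys (p * q)" for t
    using keys_mult[of p q] that mdeg_add by blast
  show "p \<in> homog d \<Longrightarrow> q \<in> homog d' \<Longrightarrow> p * q \<in> homog (d + d')"
    using * unfolding homog_def by fastforce
  show "p \<in> order_ge d \<Longrightarrow> q \<in> order_ge d' \<Longrightarrow> p * q \<in> order_ge (d + d')"
    using * add_mono unfolding order_ge_def by fastforce
qed

lemma homog_uminus: "p \<in> homog d \<Longrightarrow> - p \<in> homog d"
  and order_ge_uminus: "p \<in> order_ge d \<Longrightarrow> - p \<in> order_ge d"
  by (auto simp: homog_def order_ge_def in_keys_iff)

lemma homog_diff: "p \<in> homog d \<Longrightarrow> q \<in> homog d \<Longrightarrow> p - q \<in> homog d"
  using homog_add[of p d "- q"] by (auto intro: homog_uminus)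

lemma homog_sum: "(\<And>x. x \<in> X \<Longrightarrow> f x \<in> homog d) \<Longrightarrow> sum f X \<in> homog d"
  by (induction X rule: infinite_finite_induct) (auto intro: homog_add)

lemma order_ge_sum: "(\<And>x. x \<in> X \<Longrightarrow> f x \<in> order_ge d) \<Longrightarrow> sum f X \<in> order_ge d"
  by (induction X rule: infinite_finite_induct) (auto intro: order_ge_add)

lemma order_ge_0: "order_ge 0 = UNIV"
  by (auto simp: order_ge_def)

lemma order_ge_mono: "d \<le> d' \<Longrightarrow> order_ge d' \<subseteq> order_ge d"
  by (auto simp: order_ge_def)

lemma homog_le_order_ge: "homog d \<subseteq> order_ge d"
  by (auto simp: homog_def order_ge_def)

lemma homog_single: "mdeg t = d \<Longrightarrow> single t c \<in> homog d"
  by (auto simp: homog_def)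

lemma order_ge_single: "d \<le> mdeg t \<Longrightarrow> single t c \<in> order_ge d"
  by (auto simp: order_ge_def)

lemma homog_const: "single 0 c \<in> homog 0"
  by (rule homog_single) simp

lemma homog_sign: "(-1) ^ k * p \<in> homog d \<longleftrightarrow> p \<in> homog d"
  and order_ge_sign: "(-1) ^ k * p \<in> order_ge d \<longleftrightarrow> p \<in> order_ge d"
  using homog_uminus[of p d] homog_uminus[of "- p" d]
      order_ge_uminus[of p d] order_ge_uminus[of "- p" d]
  by (cases "even k"; force)+

lemma homog_order_ge: "p \<in> homog d \<Longrightarrow> p \<in> order_ge d' \<Longrightarrow> d < d' \<Longrightarrow> p = 0"
  by (force simp: homog_def order_ge_def)

lemma mdeg_minus_single:
  "lookup t j > 0 \<Longrightarrow> mdeg (t - single j 1) = mdeg t - 1"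
  using mdeg_add[of "t - single j 1" "single j 1"]
  by (simp add: minus_single_add[unfolded One_nat_def])

text \<open>The truncated \<open>d - 1\<close> is right for d = 0 as well: constants have derivative
  0, and \<open>order_ge 0\<close> is everything.\<close>

lemma homog_pd: "p \<in> homog d \<Longrightarrow> pd j p \<in> homog (d - 1)"
  and order_ge_pd: "p \<in> order_ge d \<Longrightarrow> pd j p \<in> order_ge (d - 1)"
proof -
  show "pd j p \<in> homog (d - 1)" if p: "p \<in> homog d"
    unfolding pd_def
  proof (rule homog_sum)
    fix t assume "t \<in> keys p"
    then show "single (t - single j 1)
      (of_nat (lookup t j) * lookup p t) \<in> homog (d - 1)"
      using p mdeg_minus_single[of t j]
      by (cases "lookup t j = 0") (auto simp: homog_def)
  qed
  show "pd j p \<in> order_ge (d - 1)" if p: "p \<in> order_ge d"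
    unfolding pd_def
  proof (rule order_ge_sum)
    fix t assume "t \<in> keys p"
    then show "single (t - single j 1)
      (of_nat (lookup t j) * lookup p t) \<in> order_ge (d - 1)"
      using p mdeg_minus_single[of t j]
      by (cases "lookup t j = 0") (auto simp: order_ge_def)
  qed
qed

definition hpart :: "nat \<Rightarrow> 'k::field mpoly \<Rightarrow> 'k mpoly" where
  "hpart d p = (\<Sum>t | t \<in> keys p \<and> mdeg t = d. single t (lookup p t))"

lemma hpart_homog: "hpart d p \<in> homog d"
  unfolding hpart_def by (auto intro!: homog_sum homog_single)

lemma hpart_zero [simp]: "hpart d 0 = 0"
  by (simp add: hpart_def)

lemma pcarrier_hpart: "p \<in> pcarrier n \<Longrightarrow> hpart d p \<in> pcarrier n"
  unfolding hpart_def by (intro pcarrier_sum pcarrier_singleI) (simp add: pcarrier_iff)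

lemma order_ge_minus_hpart:
  assumes "p \<in> order_ge d"
  shows "p - hpart d p \<in> order_ge (Suc d)"
proof -
  let ?s = "\<lambda>t. single t (lookup p t)"
  let ?Q = "{t \<in> keys p. mdeg t = d}" and ?R = "{t \<in> keys p. mdeg t \<noteq> d}"
  have "sum ?s (?Q \<union> ?R) = sum ?s ?Q + sum ?s ?R"
    by (intro sum.union_disjoint) auto
  moreover have "?Q \<union> ?R = keys p" by auto
  ultimately have "sum ?s ?R + hpart d p = p" by (simp add: sum_single hpart_def add.commute)
  then have "p - hpart d p = sum ?s ?R" by (rule diff_eq_eq[THEN iffD2, OF sym])
  also have "\<dots> \<in> order_ge (Suc d)"
    using assms by (intro order_ge_sum order_ge_single) (force simp: order_ge_def)
  finally show ?thesis .
qed

section \<open>Alternating forms in coordinates\<close>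

lemma sum_fun_apply: "sum f X x = (\<Sum>i\<in>X. f i x)"
  by (induction X rule: infinite_finite_induct) auto

definition scal :: "'a::comm_ring_1 \<Rightarrow> ('j \<Rightarrow> 'a) \<Rightarrow> 'j \<Rightarrow> 'a" where
  "scal p w = (\<lambda>J. p * w J)"

text \<open>
  An element \<open>w\<close> of the exterior power is stored as its coordinate function on the basis elements
  \<open>e\<^sub>J\<close>, which are indexed by finite sets \<open>J\<close>.
\<close>

definition wedge :: "(nat \<Rightarrow> 'a::comm_ring_1) \<Rightarrow> (nat set \<Rightarrow> 'a) \<Rightarrow> nat set \<Rightarrow> 'a" where
  "wedge v w = (\<lambda>J. \<Sum>j\<in>J. (-1) ^ card {i \<in> J. i < j} * v j * w (J - {j}))"

definition unit :: "'j \<Rightarrow> 'j \<Rightarrow> 'a::comm_ring_1" where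
  "unit j = (\<lambda>i. if i = j then 1 else 0)"

definition wedge_list :: "(nat \<Rightarrow> 'a::comm_ring_1) list \<Rightarrow> nat set \<Rightarrow> 'a" where
  "wedge_list vs = foldr wedge vs (unit {})"

lemma scal_simps:
  "scal p (v + w) = scal p v + scal p w" "scal (p + q) w = scal p w + scal q w"
  "scal p (v - w) = scal p v - scal p w" "scal (p - q) w = scal p w - scal q w"
  "scal p 0 = 0" "scal 0 w = 0" "scal 1 w = w" "scal (p * q) w = scal p (scal q w)"
  "scal p (- w) = - scal p w" "scal (- p) w = - scal p w"
  by (auto simp: scal_def algebra_simps fun_eq_iff)

lemma wedge_simps:
  "wedge (u + v) w = wedge u w + wedge v w" "wedge v (w + w') = wedge v w + wedge v w'"
  "wedge (u - v) w = wedge u w - wedge v w" "wedge v (w - w') = wedge v w - wedge v w'"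
  "wedge (scal p v) w = scal p (wedge v w)" "wedge v (scal p w) = scal p (wedge v w)"
  "wedge 0 w = 0" "wedge v 0 = 0" "wedge (- v) w = - wedge v w" "wedge v (- w) = - wedge v w"
  by (auto simp: scal_def wedge_def algebra_simps fun_eq_iff sum.distrib sum_subtractf sum_negf
      sum_distrib_left intro!: sum.cong)

lemma wedge_list_simps [simp]:
  "wedge_list [] = unit {}" "wedge_list (v # vs) = wedge v (wedge_list vs)"
  by (simp_all add: wedge_list_def)

text \<open>The coefficient at \<open>J\<close> is a sum over ordered pairs of distinct indices, and
  the two orders of a pair cancel. No division by 2 occurs, so this covers characteristic 2.\<close>

lemma wedge_self: "wedge v (wedge v w) = 0"
proof
  fix J :: "nat set"
  define c where "c J j = card {i \<in> J. i < j}" for J and j :: nat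
  show "wedge v (wedge v w) J = 0 J"
  proof (cases "finite J")
    \<comment> \<open>A sum over an infinite set is 0 by convention.\<close>
    case False
    then show ?thesis by (simp add: wedge_def)
  next
    case True
    define T where "T j l = (-1) ^ c J j * (-1) ^ c (J - {j}) l * v j * v l * w (J - {j, l})" for j l
    \<comment> \<open>Removing the larger index leaves the rank of the smaller one alone, while
      removing the smaller index lowers the rank of the larger one by 1. So the two signs
      differ.\<close>
    have anti: "T l j = - T j l" if "j \<in> J" "l \<in> J" "l < j" for j l
    proof -
      have 1: "c (J - {j}) l = c J l"
        unfolding c_def using that by (intro arg_cong[where f = card]) auto
      have "{i \<in> J. i < j} = insert l {i \<in> J - {l}. i < j}" using that by auto
      then have 2: "c J j = Suc (c (J - {l}) j)"
        unfolding c_def using True by simp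
      have 3: "J - {l, j} = J - {j, l}" by auto
      show ?thesis unfolding T_def 1 2 3 by (simp add: mult_ac)
    qed
    have "wedge v (wedge v w) J = (\<Sum>j\<in>J. \<Sum>l\<in>J - {j}. T j l)"
      unfolding wedge_def T_def c_def sum_distrib_left
    proof (intro sum.cong refl)
      fix j l
      have "J - {j} - {l} = J - {j, l}" by auto
      then show "(-1) ^ card {i \<in> J. i < j} * v j *
          ((-1) ^ card {i \<in> J - {j}. i < l} * v l * w (J - {j} - {l})) =
        (-1) ^ card {i \<in> J. i < j} * (-1) ^ card {i \<in> J - {j}. i < l} * v j * v l * w (J - {j, l})"
        by (simp add: mult_ac)
    qed
    also have "\<dots> = (\<Sum>j\<in>J. (\<Sum>l | l \<in> J \<and> l < j. T j l) + (\<Sum>l | l \<in> J \<and> j < l. T j l))"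
    proof (intro sum.cong refl)
      fix j assume "j \<in> J"
      have eq: "J - {j} = {l \<in> J. l < j} \<union> {l \<in> J. j < l}" by auto
      show "(\<Sum>l\<in>J - {j}. T j l) = (\<Sum>l | l \<in> J \<and> l < j. T j l) + (\<Sum>l | l \<in> J \<and> j < l. T j l)"
        unfolding eq by (rule sum.union_disjoint) (use True in auto)
    qed
    also have "\<dots> = (\<Sum>j\<in>J. \<Sum>l | l \<in> J \<and> l < j. T j l) + (\<Sum>j\<in>J. \<Sum>l | l \<in> J \<and> j < l. T j l)"
      by (rule sum.distrib)
    \<comment> \<open>Reindexing the upper triangle as the transposed lower one puts the cancelling
      terms side by side.\<close>
    also have "(\<Sum>j\<in>J. \<Sum>l | l \<in> J \<and> j < l. T j l) = (\<Sum>l\<in>J. \<Sum>j | j \<in> J \<and> j < l. T j l)"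
      by (rule sum.swap_restrict[OF True True])
    also have "(\<Sum>j\<in>J. \<Sum>l | l \<in> J \<and> l < j. T j l) + (\<Sum>l\<in>J. \<Sum>j | j \<in> J \<and> j < l. T j l) =
        (\<Sum>j\<in>J. \<Sum>l | l \<in> J \<and> l < j. T j l + T l j)"
      by (simp add: sum.distrib)
    also have "\<dots> = 0"
      using anti by (intro sum.neutral ballI) auto
    finally show ?thesis by simp
  qed
qed

lemma wedge_swap: "wedge u (wedge v w) = - wedge v (wedge u w)"
proof -
  have "0 = wedge (u + v) (wedge (u + v) w)" by (simp add: wedge_self)
  also have "\<dots> = wedge u (wedge v w) + wedge v (wedge u w)"
    by (simp add: wedge_simps wedge_self)
  finally show ?thesis by (simp add: eq_neg_iff_add_eq_0)
qed

text \<open>The sign counts the basis vectors that e_j has to pass on the way to its sorted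
  position.\<close>

lemma wedge_unit:
  assumes "finite J"
  shows "wedge (unit j) (unit J) = (if j \<in> J then 0 else scal ((-1) ^ card {i \<in> J. i < j}) (unit (insert j J)))"
proof
  fix L :: "nat set"
  have "wedge (unit j) (unit J) L = (\<Sum>i\<in>L. if i = j then (-1) ^ card {i \<in> L. i < j} * unit J (L - {j}) else 0)"
    unfolding wedge_def by (intro sum.cong) (auto simp: unit_def)
  also have "\<dots> = (if finite L \<and> j \<in> L then (-1) ^ card {i \<in> L. i < j} * unit J (L - {j}) else 0)"
    by (cases "finite L") auto
  also have "\<dots> = (if j \<in> J then 0 else scal ((-1) ^ card {i \<in> J. i < j}) (unit (insert j J))) L"
  proof (cases "j \<notin> J \<and> L = insert j J")
    case True
    then have "{i \<in> L. i < j} = {i \<in> J. i < j}" by auto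
    then show ?thesis using True assms by (simp add: unit_def scal_def)
  next
    case False
    then show ?thesis by (auto simp: unit_def scal_def zero_fun_def)
  qed
  finally show "wedge (unit j) (unit J) L =
      (if j \<in> J then 0 else scal ((-1) ^ card {i \<in> J. i < j}) (unit (insert j J))) L" .
qed

text \<open>The factor \<open>u\<close> is moved to the right by sign changes until it meets its
  copy.\<close>

lemma wedge_wedge_list_mem: "u \<in> set vs \<Longrightarrow> wedge u (wedge_list vs) = 0"
proof (induction vs)
  case (Cons v vs)
  then show ?case
    using wedge_swap[of u v "wedge_list vs"] by (cases "u = v") (simp_all add: wedge_self wedge_simps del: zero_fun_apply uminus_apply)
qed simp

lemma wedge_list_repeated:
  "i < j \<Longrightarrow> j < length vs \<Longrightarrow> vs ! i = vs ! j \<Longrightarrow> wedge_list vs = 0"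
proof (induction vs arbitrary: i j)
  case (Cons v vs)
  obtain j' where j: "j = Suc j'" using Cons.prems by (cases j) auto
  show ?case
  proof (cases i)
    case 0
    then have "v \<in> set vs" using Cons.prems j by (auto simp: in_set_conv_nth)
    then show ?thesis by (simp add: wedge_wedge_list_mem)
  next
    case (Suc i')
    then show ?thesis using Cons.prems Cons.IH[of i' j'] j by (simp add: wedge_simps del: zero_fun_apply)
  qed
qed simp

lemma wedge_list_update_add:
  "j < length vs \<Longrightarrow> wedge_list (vs[j := u + u']) = wedge_list (vs[j := u]) + wedge_list (vs[j := u'])"
  by (induction vs arbitrary: j) (auto simp: wedge_simps split: nat.splits simp del: plus_fun_apply)

lemma wedge_list_update_scal:
  "j < length vs \<Longrightarrow> wedge_list (vs[j := scal p u]) = scal p (wedge_list (vs[j := u]))"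
  by (induction vs arbitrary: j) (auto simp: wedge_simps split: nat.splits)

text \<open>In a strictly increasing list each new head is smaller than everything after it, so all
  signs are +1.\<close>

lemma wedge_list_units:
  "sorted_wrt (<) js \<Longrightarrow> wedge_list (map unit js) = unit (set js)"
proof (induction js)
  case (Cons j js)
  then have j: "{i \<in> set js. i < j} = {}" "j \<notin> set js" by fastforce+
  show ?case using Cons by (simp add: wedge_unit scal_simps j)
qed simp

subsection \<open>Forms with polynomial coefficients\<close>

text \<open>Vectors in A^n, the coordinates of 1-forms; \<open>fmod\<close> does the same for
  m-forms. Functions vanish outside the index range, so equal coordinates mean equal
  functions.\<close>

definition vmod :: "nat \<Rightarrow> (nat \<Rightarrow> 'k::field mpoly) set" where
  "vmod n = {v. \<forall>j. v j \<in> pcarrier n \<and> (v j \<noteq> 0 \<longrightarrow> j < n)}"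

definition fmod :: "nat \<Rightarrow> nat \<Rightarrow> ('k::field form) set" where
  "fmod n m = {w. \<forall>J. w J \<in> pcarrier n \<and> (w J \<noteq> 0 \<longrightarrow> J \<subseteq> {..<n} \<and> card J = m)}"

lemma vmodI: "(\<And>j. v j \<in> pcarrier n) \<Longrightarrow> (\<And>j. \<not> j < n \<Longrightarrow> v j = 0) \<Longrightarrow> v \<in> vmod n"
  unfolding vmod_def by blast

lemma vmodD: "v \<in> vmod n \<Longrightarrow> v j \<in> pcarrier n" "v \<in> vmod n \<Longrightarrow> \<not> j < n \<Longrightarrow> v j = 0"
  unfolding vmod_def by blast+

lemma fmodI:
  "(\<And>J. w J \<in> pcarrier n) \<Longrightarrow> (\<And>J. \<not> (J \<subseteq> {..<n} \<and> card J = m) \<Longrightarrow> w J = 0) \<Longrightarrow> w \<in> fmod n m"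
  unfolding fmod_def by blast

lemma fmodD:
  "w \<in> fmod n m \<Longrightarrow> w J \<in> pcarrier n"
  "w \<in> fmod n m \<Longrightarrow> \<not> (J \<subseteq> {..<n} \<and> card J = m) \<Longrightarrow> w J = 0"
  unfolding fmod_def by blast+

lemma vmod_zero [simp]: "0 \<in> vmod n"
  and fmod_zero [simp]: "0 \<in> fmod n m"
  by (intro vmodI fmodI; simp)+

lemma vmod_add:
  assumes "v \<in> vmod n" "v' \<in> vmod n"
  shows "v + v' \<in> vmod n"
  using assms[THEN vmodD(2)] by (intro vmodI) (simp_all add: assms[THEN vmodD(1)] pcarrier_add)

lemma fmod_add:
  assumes "w \<in> fmod n m" "w' \<in> fmod n m"
  shows "w + w' \<in> fmod n m"
  using assms[THEN fmodD(2)] by (intro fmodI) (simp_all add: assms[THEN fmodD(1)] pcarrier_add)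

lemma vmod_scal:
  assumes "p \<in> pcarrier n" "v \<in> vmod n"
  shows "scal p v \<in> vmod n"
  using vmodD(2)[OF assms(2)]
  by (intro vmodI) (simp_all add: assms(1) vmodD(1)[OF assms(2)] scal_def pcarrier_mult)

lemma fmod_scal:
  assumes "p \<in> pcarrier n" "w \<in> fmod n m"
  shows "scal p w \<in> fmod n m"
  using fmodD(2)[OF assms(2)]
  by (intro fmodI) (simp_all add: assms(1) fmodD(1)[OF assms(2)] scal_def pcarrier_mult)

lemma fmod_uminus: "w \<in> fmod n m \<Longrightarrow> - w \<in> fmod n m"
  using fmod_scal[of "-1" n w m] by (simp add: scal_simps pcarrier_uminus)

lemma fmod_diff: "w \<in> fmod n m \<Longrightarrow> w' \<in> fmod n m \<Longrightarrow> w - w' \<in> fmod n m"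
  using fmod_add[of w n m "- w'"] fmod_uminus[of w' n m] by simp

lemma unit_vmod: "j < n \<Longrightarrow> unit j \<in> vmod n"
  by (rule vmodI) (auto simp: unit_def)

lemma unit_fmod: "J \<subseteq> {..<n} \<Longrightarrow> card J = m \<Longrightarrow> unit J \<in> fmod n m"
  by (rule fmodI) (auto simp: unit_def)

lemma pcarrier_sign: "p \<in> pcarrier n \<Longrightarrow> (-1) ^ k * p \<in> pcarrier n"
  using pcarrier_uminus[of p n] by (cases "even k") simp_all

lemma wedge_fmod:
  assumes "v \<in> vmod n" "w \<in> fmod n m"
  shows "wedge v w \<in> fmod n (Suc m)"
proof (rule fmodI)
  fix J
  show "wedge v w J \<in> pcarrier n"
    unfolding wedge_def mult.assoc using assms
    by (intro pcarrier_sum pcarrier_sign pcarrier_mult vmodD fmodD)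
  assume J: "\<not> (J \<subseteq> {..<n} \<and> card J = Suc m)"
  show "wedge v w J = 0"
  proof (cases "finite J")
    case True
    have "v j * w (J - {j}) = 0" if "j \<in> J" for j
    proof (cases "j < n")
      case True
      then have "\<not> (J - {j} \<subseteq> {..<n} \<and> card (J - {j}) = m)"
        using J that \<open>finite J\<close> card_Suc_Diff1[of J j] by auto
      then show ?thesis using fmodD(2)[OF assms(2)] by simp
    qed (simp add: vmodD(2)[OF assms(1)])
    then show ?thesis by (simp add: wedge_def mult.assoc)
  qed (simp add: wedge_def)
qed

lemma wedge_list_fmod: "set vs \<subseteq> vmod n \<Longrightarrow> wedge_list vs \<in> fmod n (length vs)"
  by (induction vs) (auto intro: wedge_fmod unit_fmod)

lemma vmod_expand: "v \<in> vmod n \<Longrightarrow> v = (\<Sum>j<n. scal (v j) (unit j))"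
proof
  fix i assume v: "v \<in> vmod n"
  have "(\<Sum>j<n. scal (v j) (unit j)) i = (\<Sum>j<n. if j = i then v j else 0)"
    unfolding scal_def unit_def sum_fun_apply by (intro sum.cong) auto
  then show "v i = (\<Sum>j<n. scal (v j) (unit j)) i" using vmodD(2)[OF v] by auto
qed

abbreviation "subsets n m \<equiv> {J :: nat set. J \<subseteq> {..<n} \<and> card J = m}"

lemma finite_subsets: "finite (subsets n m)"
  by (rule finite_subset[of _ "Pow {..<n}"]) auto

lemma fmod_expand: "w \<in> fmod n m \<Longrightarrow> w = (\<Sum>J\<in>subsets n m. scal (w J) (unit J))"
proof
  fix L assume w: "w \<in> fmod n m"
  have "(\<Sum>J\<in>subsets n m. scal (w J) (unit J)) L = (\<Sum>J\<in>subsets n m. if J = L then w J else 0)"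
    unfolding scal_def unit_def sum_fun_apply by (intro sum.cong) auto
  then show "w L = (\<Sum>J\<in>subsets n m. scal (w J) (unit J)) L"
    using fmodD(2)[OF w] finite_subsets[of n m] by auto
qed

lemma vmod_induct [consumes 1]:
  assumes v: "v \<in> vmod n"
    and z: "P 0"
    and g: "\<And>j. j < n \<Longrightarrow> P (unit j)"
    and a: "\<And>v v'. v \<in> vmod n \<Longrightarrow> v' \<in> vmod n \<Longrightarrow> P v \<Longrightarrow> P v' \<Longrightarrow> P (v + v')"
    and s: "\<And>p v. p \<in> pcarrier n \<Longrightarrow> v \<in> vmod n \<Longrightarrow> P v \<Longrightarrow> P (scal p v)"
  shows "P v"
proof -
  have "sum (\<lambda>j. scal (v j) (unit j)) Y \<in> vmod n \<and> P (sum (\<lambda>j. scal (v j) (unit j)) Y)"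
    if "finite Y" "Y \<subseteq> {..<n}" for Y
    using that
  proof (induction Y rule: finite_induct)
    case empty
    then show ?case using z vmod_zero[of n] by (simp only: sum.empty simp_thms)
  next
    case (insert j Y)
    then have "scal (v j) (unit j) \<in> vmod n" "P (scal (v j) (unit j))"
      using vmodD(1)[OF v] by (auto intro!: vmod_scal s unit_vmod g)
    moreover have "sum (\<lambda>j. scal (v j) (unit j)) Y \<in> vmod n" "P (sum (\<lambda>j. scal (v j) (unit j)) Y)"
      using insert by auto
    ultimately show ?case
      unfolding sum.insert[OF insert(1,2)] using vmod_add a by blast
  qed
  from this[of "{..<n}"] show ?thesis by (simp only: vmod_expand[OF v, symmetric]) simp
qed

lemma fmod_induct [consumes 1]:
  assumes w: "w \<in> fmod n m"
    and z: "P 0"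
    and g: "\<And>J. J \<subseteq> {..<n} \<Longrightarrow> card J = m \<Longrightarrow> P (unit J)"
    and a: "\<And>w w'. w \<in> fmod n m \<Longrightarrow> w' \<in> fmod n m \<Longrightarrow> P w \<Longrightarrow> P w' \<Longrightarrow> P (w + w')"
    and s: "\<And>p w. p \<in> pcarrier n \<Longrightarrow> w \<in> fmod n m \<Longrightarrow> P w \<Longrightarrow> P (scal p w)"
  shows "P w"
proof -
  have "sum (\<lambda>J. scal (w J) (unit J)) Y \<in> fmod n m \<and> P (sum (\<lambda>J. scal (w J) (unit J)) Y)"
    if "finite Y" "Y \<subseteq> subsets n m" for Y
    using that
  proof (induction Y rule: finite_induct)
    case empty
    then show ?case using z fmod_zero[of n m] by (simp only: sum.empty simp_thms)
  next
    case (insert J Y)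
    then have "scal (w J) (unit J) \<in> fmod n m" "P (scal (w J) (unit J))"
      using fmodD(1)[OF w] by (auto intro!: fmod_scal s unit_fmod g)
    moreover have "sum (\<lambda>J. scal (w J) (unit J)) Y \<in> fmod n m" "P (sum (\<lambda>J. scal (w J) (unit J)) Y)"
      using insert by auto
    ultimately show ?case
      unfolding sum.insert[OF insert(1,2)] using fmod_add a by blast
  qed
  from this[of "subsets n m"] show ?thesis
    by (simp only: fmod_expand[OF w, symmetric] finite_subsets)
qed

section \<open>Gradients and the submodules of relations\<close>

definition grad :: "'k::field mpoly \<Rightarrow> nat \<Rightarrow> 'k mpoly" where
  "grad f = (\<lambda>j. pd j f)"

lemma grad_simps:
  "grad (f + g) = grad f + grad g" "grad (f - g) = grad f - grad g" "grad 0 = 0"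
  "grad (f * g) = scal f (grad g) + scal g (grad f)"
  "grad (polyvar j) = unit j" "grad (single 0 c) = 0"
  by (auto simp: grad_def fun_eq_iff pd_add pd_diff pd_mult scal_def unit_def pd_polyvar pd_const)

lemma grad_vmod: "f \<in> pcarrier n \<Longrightarrow> grad f \<in> vmod n"
  by (rule vmodI) (simp_all add: grad_def pcarrier_pd pd_eq_0)

text \<open>The A-submodule generated by \<open>G\<close>. Coordinate functions form a type with
  addition rather than a module record; defining the span as an intersection gives closure,
  induction and monotonicity at once.\<close>

definition pspan :: "nat \<Rightarrow> ('j \<Rightarrow> 'k::field mpoly) set \<Rightarrow> ('j \<Rightarrow> 'k mpoly) set" where
  "pspan n G = \<Inter>{H. 0 \<in> H \<and> G \<subseteq> H \<and> (\<forall>w\<in>H. \<forall>w'\<in>H. w + w' \<in> H) \<and>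
     (\<forall>p\<in>pcarrier n. \<forall>w\<in>H. scal p w \<in> H)}"

lemma pspan_zero: "0 \<in> pspan n G"
  and pspan_gen: "w \<in> G \<Longrightarrow> w \<in> pspan n G"
  and pspan_add: "w \<in> pspan n G \<Longrightarrow> w' \<in> pspan n G \<Longrightarrow> w + w' \<in> pspan n G"
  and pspan_scal: "p \<in> pcarrier n \<Longrightarrow> w \<in> pspan n G \<Longrightarrow> scal p w \<in> pspan n G"
  unfolding pspan_def by blast+

lemma pspan_induct [consumes 1, case_names zero gen add scal]:
  assumes w: "w \<in> pspan n G"
    and z: "P 0"
    and g: "\<And>w. w \<in> G \<Longrightarrow> P w"
    and a: "\<And>w w'. w \<in> pspan n G \<Longrightarrow> P w \<Longrightarrow> w' \<in> pspan n G \<Longrightarrow> P w' \<Longrightarrow> P (w + w')"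
    and s: "\<And>p w. p \<in> pcarrier n \<Longrightarrow> w \<in> pspan n G \<Longrightarrow> P w \<Longrightarrow> P (scal p w)"
  shows "P w"
proof -
  have "pspan n G \<subseteq> {w \<in> pspan n G. P w}"
    unfolding pspan_def[of n G]
    by (rule Inter_lower, unfold pspan_def[symmetric]) (simp add: z g a s pspan_zero pspan_gen pspan_add pspan_scal subset_iff)
  then show ?thesis using w by blast
qed

lemma pspan_uminus: "w \<in> pspan n G \<Longrightarrow> - w \<in> pspan n G"
  using pspan_scal[of "-1" n w G] pcarrier_uminus[of 1 n] by (simp add: scal_simps)

lemma pspan_diff: "w \<in> pspan n G \<Longrightarrow> w' \<in> pspan n G \<Longrightarrow> w - w' \<in> pspan n G"
  using pspan_add[of w n G "- w'"] pspan_uminus[of w' n G] by simp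

lemma pspan_sum: "(\<And>x. x \<in> X \<Longrightarrow> f x \<in> pspan n G) \<Longrightarrow> sum f X \<in> pspan n G"
  by (induction X rule: infinite_finite_induct) (auto intro: pspan_add simp: pspan_zero)

abbreviation vrel_gens :: "nat \<Rightarrow> 'k::field mpoly set \<Rightarrow> (nat \<Rightarrow> 'k mpoly) set" where
  "vrel_gens n I \<equiv> {scal a v | a v. a \<in> I \<and> v \<in> vmod n} \<union> grad ` I"

text \<open>The condition \<open>m = Suc m'\<close> makes the second family empty for m = 0, where
  no 1-form can be split off.\<close>

abbreviation frel_gens :: "nat \<Rightarrow> 'k::field mpoly set \<Rightarrow> nat \<Rightarrow> ('k form) set" where
  "frel_gens n I m \<equiv> {scal a w | a w. a \<in> I \<and> w \<in> fmod n m} \<union>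
     {wedge (grad f) w | f w m'. m = Suc m' \<and> f \<in> I \<and> w \<in> fmod n m'}"

text \<open>
  \<open>frel n I m\<close> is \<open>I \<Omega>\<^sup>m + dI \<and> \<Omega>\<^sup>m\<^sup>-\<^sup>1\<close> over the polynomial ring, in coordinates, and \<open>vrel n I\<close> is the
  case \<open>m = 1\<close>, with vectors in place of 1-forms; \<open>dwedge n I m\<close> is the second summand.
\<close>

definition vrel :: "nat \<Rightarrow> 'k::field mpoly set \<Rightarrow> (nat \<Rightarrow> 'k mpoly) set" where
  "vrel n I = pspan n (vrel_gens n I)"

definition dwedge :: "nat \<Rightarrow> 'k::field mpoly set \<Rightarrow> nat \<Rightarrow> ('k form) set" where
  "dwedge n I m = pspan n {wedge (grad f) w | f w m'. m = Suc m' \<and> f \<in> I \<and> w \<in> fmod n m'}"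

definition frel :: "nat \<Rightarrow> 'k::field mpoly set \<Rightarrow> nat \<Rightarrow> ('k form) set" where
  "frel n I m = pspan n (frel_gens n I m)"

lemma pspan_mono: "G \<subseteq> H \<Longrightarrow> pspan n G \<subseteq> pspan n H"
  unfolding pspan_def by (rule Inter_anti_mono) blast

lemma dwedge_frel: "dwedge n I m \<subseteq> frel n I m"
  unfolding dwedge_def frel_def by (rule pspan_mono) auto

lemma frel_fmod: "I \<subseteq> pcarrier n \<Longrightarrow> frel n I m \<subseteq> fmod n m"
proof
  fix w assume I: "I \<subseteq> pcarrier n" and "w \<in> frel n I m"
  from this(2) show "w \<in> fmod n m" unfolding frel_def
    by (rule pspan_induct[where P = "\<lambda>w. w \<in> fmod n m"]) (use I in \<open>auto intro: fmod_add fmod_scal wedge_fmod grad_vmod\<close>)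
qed

text \<open>Together with \<open>wedge_frel\<close> this makes the wedge product well defined on
  coordinates modulo the relations.\<close>

lemma wedge_vrel:
  assumes "v \<in> vrel n I" "w \<in> fmod n m" "I \<subseteq> pcarrier n"
  shows "wedge v w \<in> frel n I (Suc m)"
  using assms(1) unfolding vrel_def
proof (rule pspan_induct[where P = "\<lambda>v. wedge v w \<in> frel n I (Suc m)"])
  show "wedge 0 w \<in> frel n I (Suc m)" by (simp add: wedge_simps frel_def pspan_zero)
next
  fix v assume gen: "v \<in> vrel_gens n I"
  then consider a v' where "a \<in> I" "v' \<in> vmod n" "v = scal a v'" | f where "f \<in> I" "v = grad f"
    by auto
  then show "wedge v w \<in> frel n I (Suc m)"
  proof cases
    case 1
    then have "wedge v' w \<in> fmod n (Suc m)" using assms by (intro wedge_fmod)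
    then show ?thesis using 1 by (auto simp: wedge_simps frel_def intro!: pspan_gen)
  next
    case 2
    then show ?thesis using assms by (auto simp: frel_def intro!: pspan_gen)
  qed
qed (auto simp: wedge_simps frel_def intro: pspan_add pspan_scal pspan_gen)

lemma wedge_frel:
  assumes "v \<in> vmod n" "w \<in> frel n I m" "I \<subseteq> pcarrier n"
  shows "wedge v w \<in> frel n I (Suc m)"
  using assms(2) unfolding frel_def[of _ _ m]
proof (rule pspan_induct[where P = "\<lambda>w. wedge v w \<in> frel n I (Suc m)"])
  show "wedge v 0 \<in> frel n I (Suc m)" by (simp add: wedge_simps frel_def pspan_zero)
next
  fix w assume gen: "w \<in> frel_gens n I m"
  then consider a w' where "a \<in> I" "w' \<in> fmod n m" "w = scal a w'"
    | f w' m' where "m = Suc m'" "f \<in> I" "w' \<in> fmod n m'" "w = wedge (grad f) w'"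
    by auto
  then show "wedge v w \<in> frel n I (Suc m)"
  proof cases
    case 1
    then have "wedge v w' \<in> fmod n (Suc m)" using assms by (intro wedge_fmod)
    then show ?thesis using 1 by (auto simp: wedge_simps frel_def intro!: pspan_gen)
  next
    case 2
    \<comment> \<open>A generator has the gradient as its first factor, so \<open>v\<close> is moved
      behind it, and the sign is absorbed by the submodule.\<close>
    then have "wedge v w' \<in> fmod n m" using assms by (simp add: wedge_fmod)
    then have "wedge (grad f) (wedge v w') \<in> frel n I (Suc m)"
      using 2 by (auto simp: frel_def intro!: pspan_gen)
    then have "- wedge (grad f) (wedge v w') \<in> frel n I (Suc m)"
      unfolding frel_def by (rule pspan_uminus)
    then show ?thesis unfolding 2(4) wedge_swap[of v "grad f" w'] .
  qed
qed (auto simp: wedge_simps frel_def intro: pspan_add pspan_scal pspan_gen)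

subsection \<open>Homogeneous forms\<close>

lemma homog_wedge:
  assumes "\<And>j. v j \<in> homog d" "\<And>J. w J \<in> homog d'"
  shows "wedge v w J \<in> homog (d + d')"
  unfolding wedge_def mult.assoc using assms by (intro homog_sum) (auto simp: homog_sign intro: homog_mult)

lemma order_ge_wedge:
  assumes "\<And>j. v j \<in> order_ge d" "\<And>J. w J \<in> order_ge d'"
  shows "wedge v w J \<in> order_ge (d + d')"
  unfolding wedge_def mult.assoc using assms
  by (intro order_ge_sum) (auto simp: order_ge_sign intro: order_ge_mult)

lemma unit_homog: "unit j i \<in> homog 0"
  using homog_const[of 1] by (auto simp: unit_def)

lemma wedge_list_homog:
  "(\<And>v j. v \<in> set vs \<Longrightarrow> v j \<in> homog 0) \<Longrightarrow> wedge_list vs J \<in> homog 0"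
proof (induction vs arbitrary: J)
  case (Cons v vs)
  then show ?case using homog_wedge[of v 0 "wedge_list vs" 0 J] by auto
qed (simp add: unit_homog)

text \<open>The key step for the critical degree: modulo order \<open>k\<close>, an element of the
  relations is a homogeneous element of degree k - 1 that already belongs to \<open>dwedge\<close>.
  Multiples by elements of \<open>I\<close> have order at least \<open>k\<close> and vanish here;
  only the products with gradients contribute.\<close>

lemma frel_initial:
  assumes I: "I = pcarrier n \<inter> order_ge k" and k: "k \<ge> 1" and w: "w \<in> frel n I m"
  shows "\<exists>y \<in> dwedge n I m. \<forall>J. y J \<in> homog (k - 1) \<and> (w - y) J \<in> order_ge k"
  using w unfolding frel_def
proof (rule pspan_induct[where P = "\<lambda>w. \<exists>y \<in> dwedge n I m. \<forall>J. y J \<in> homog (k - 1) \<and> (w - y) J \<in> order_ge k"])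
  have "(0 :: 'a form) \<in> dwedge n I m" by (simp add: dwedge_def pspan_zero)
  then show "\<exists>y \<in> dwedge n I m. \<forall>J. y J \<in> homog (k - 1) \<and> (0 - y) J \<in> order_ge k"
    by (rule bexI[rotated]) simp
next
  fix w assume gen: "w \<in> frel_gens n I m"
  then consider a w' where "a \<in> I" "w' \<in> fmod n m" "w = scal a w'"
    | f w' m' where "m = Suc m'" "f \<in> I" "w' \<in> fmod n m'" "w = wedge (grad f) w'"
    by auto
  then show "\<exists>y \<in> dwedge n I m. \<forall>J. y J \<in> homog (k - 1) \<and> (w - y) J \<in> order_ge k"
  proof cases
    case 1
    have "w J \<in> order_ge k" for J
      using 1 order_ge_mult[of a k "w' J" 0] by (auto simp: scal_def I order_ge_0)
    moreover have "(0 :: 'a form) \<in> dwedge n I m" by (simp add: dwedge_def pspan_zero)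
    ultimately show ?thesis by (intro bexI[of _ 0]) simp_all
  next
    case 2
    \<comment> \<open>Only the degree k part of \<open>f\<close> and the constant part of the
      coefficients of \<open>w'\<close> can reach degree k - 1; each remainder gains one degree. The
      part \<open>g\<close> is still in \<open>I\<close> because \<open>I\<close> is cut out by a
      condition on monomials.\<close>
    define g where "g = hpart k f"
    define u where "u = (\<lambda>J. hpart 0 (w' J))"
    have g: "g \<in> homog k" "g \<in> I" "f - g \<in> order_ge (Suc k)"
      using 2(2) hpart_homog[of k f] homog_le_order_ge[of k] pcarrier_hpart[of f n k]
        order_ge_minus_hpart[of f k]
      by (auto simp: g_def I)
    have u: "u J \<in> homog 0" "(w' - u) J \<in> order_ge 1" for J
      using order_ge_minus_hpart[of "w' J" 0] by (auto simp: u_def hpart_homog order_ge_0)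
    have uf: "u \<in> fmod n m'"
      unfolding u_def by (rule fmodI) (simp_all add: pcarrier_hpart fmodD[OF 2(3)])
    have y: "wedge (grad g) u \<in> dwedge n I m"
      unfolding dwedge_def using 2 g uf by (intro pspan_gen) blast
    have "w - wedge (grad g) u = wedge (grad (f - g)) w' + wedge (grad g) (w' - u)"
      using 2 by (simp add: wedge_simps grad_simps)
    moreover have "wedge (grad (f - g)) w' J \<in> order_ge (k + 0)" for J
      using order_ge_pd[OF g(3)] by (intro order_ge_wedge) (auto simp: grad_def order_ge_0)
    moreover have "wedge (grad g) (w' - u) J \<in> order_ge ((k - 1) + 1)" for J
      using order_ge_pd[of g k] homog_le_order_ge g(1) u by (intro order_ge_wedge) (auto simp: grad_def)
    ultimately have "(w - wedge (grad g) u) J \<in> order_ge k" for J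
      using k by (auto intro: order_ge_add)
    moreover have "wedge (grad g) u J \<in> homog (k - 1 + 0)" for J
      using homog_pd[OF g(1)] u by (intro homog_wedge) (auto simp: grad_def)
    ultimately show ?thesis using y by auto
  qed
next
  fix w w'
  assume "\<exists>y \<in> dwedge n I m. \<forall>J. y J \<in> homog (k - 1) \<and> (w - y) J \<in> order_ge k"
    "\<exists>y \<in> dwedge n I m. \<forall>J. y J \<in> homog (k - 1) \<and> (w' - y) J \<in> order_ge k"
  then obtain y y' where "y \<in> dwedge n I m" "\<And>J. y J \<in> homog (k - 1)" "\<And>J. (w - y) J \<in> order_ge k"
    "y' \<in> dwedge n I m" "\<And>J. y' J \<in> homog (k - 1)" "\<And>J. (w' - y') J \<in> order_ge k" by blast
  moreover have "(w + w' - (y + y')) J = (w - y) J + (w' - y') J" for J by simp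
  ultimately show "\<exists>y \<in> dwedge n I m. \<forall>J. y J \<in> homog (k - 1) \<and> (w + w' - y) J \<in> order_ge k"
    by (intro bexI[of _ "y + y'"]) (auto intro: homog_add order_ge_add pspan_add simp: dwedge_def simp del: minus_apply)
next
  fix p :: "'a mpoly" and w
  assume p: "p \<in> pcarrier n" and "\<exists>y \<in> dwedge n I m. \<forall>J. y J \<in> homog (k - 1) \<and> (w - y) J \<in> order_ge k"
  then obtain y where y: "y \<in> dwedge n I m" "\<And>J. y J \<in> homog (k - 1)" "\<And>J. (w - y) J \<in> order_ge k"
    by blast
  \<comment> \<open>Multiplication by \<open>p\<close> keeps degree k - 1 only through the constant
    term of \<open>p\<close>.\<close>
  define q where "q = hpart 0 p"
  have q: "q \<in> homog 0" "q \<in> pcarrier n" "p - q \<in> order_ge 1"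
    using p order_ge_minus_hpart[of p 0] by (auto simp: q_def hpart_homog pcarrier_hpart order_ge_0)
  have "(scal p w - scal q y) J = p * (w - y) J + (p - q) * y J" for J
    by (simp add: scal_def algebra_simps)
  moreover have "p * (w - y) J \<in> order_ge k" for J
    using order_ge_mult[of p 0 "(w - y) J" k] y(3) by (simp add: order_ge_0)
  moreover have "(p - q) * y J \<in> order_ge k" for J
    using order_ge_mult[OF q(3), of "y J" "k - 1"] y(2) homog_le_order_ge k by auto
  moreover have "scal q y \<in> dwedge n I m"
    using y(1) q(2) by (auto simp: dwedge_def intro: pspan_scal)
  moreover have "scal q y J \<in> homog (k - 1)" for J
    using homog_mult[OF q(1) y(2)] by (simp add: scal_def)
  ultimately show "\<exists>y \<in> dwedge n I m. \<forall>J. y J \<in> homog (k - 1) \<and> (scal p w - y) J \<in> order_ge k"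
    by (intro bexI[of _ "scal q y"]) (auto intro: order_ge_add simp del: minus_apply)
qed

lemma frel_homog_low:
  assumes "I = pcarrier n \<inter> order_ge k" "k \<ge> 1" "w \<in> frel n I m" "\<And>J. w J \<in> homog d" "d < k - 1"
  shows "w = 0"
proof
  fix J
  obtain y where y: "\<And>J. y J \<in> homog (k - 1)" "\<And>J. (w - y) J \<in> order_ge k"
    using frel_initial[OF assms(1-3)] by blast
  have "(w - y) J \<in> order_ge (k - 1)"
    using y(2)[of J] order_ge_mono[of "k - 1" k] diff_le_self by blast
  moreover have "y J \<in> order_ge (k - 1)"
    by (rule subsetD[OF homog_le_order_ge y(1)])
  ultimately have "(w - y) J + y J \<in> order_ge (k - 1)" by (rule order_ge_add)
  then have "w J \<in> order_ge (k - 1)" by simp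
  then show "w J = 0 J" using homog_order_ge[OF assms(4) _ assms(5)] by simp
qed

text \<open>The remainder is homogeneous of degree k - 1 and of order at least \<open>k\<close>,
  hence 0, so \<open>w\<close> is its own initial part.\<close>

lemma frel_homog_top:
  assumes "I = pcarrier n \<inter> order_ge k" "k \<ge> 1" "w \<in> frel n I m" "\<And>J. w J \<in> homog (k - 1)"
  shows "w \<in> dwedge n I m"
proof -
  obtain y where y: "y \<in> dwedge n I m" "\<And>J. y J \<in> homog (k - 1)" "\<And>J. (w - y) J \<in> order_ge k"
    using frel_initial[OF assms(1-3)] by blast
  have "(w - y) J = 0" for J
    using homog_order_ge[of "(w - y) J" "k - 1" k] y assms(2,4) by (auto intro: homog_diff)
  then have "w = y" by (auto simp: fun_eq_iff)
  then show ?thesis using y by simp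
qed

section \<open>Differential forms on a quotient of a polynomial ring\<close>

text \<open>As rewrite rules these would turn \<open>0\<close> and \<open>f + g\<close> into abstractions even when not applied.\<close>

declare plus_fun_apply [simp del] zero_fun_apply [simp del]
  uminus_apply [simp del] minus_apply [simp del]

text \<open>Two instances are made: the polynomial ring itself with \<open>\<pi>\<close> the
  identity, and the fat point with \<open>\<pi>\<close> the class map.\<close>

locale poly_quotient = cring B
  for B :: "('k::field, 'b, 's) module_scheme" (structure) +
  fixes n :: nat and \<pi> :: "'k mpoly \<Rightarrow> 'b"
  assumes \<pi>_hom: "\<pi> \<in> Ring.ring_hom (polys n) B"
    and \<pi>_surj: "\<pi> ` pcarrier n = carrier B"
    and \<pi>_smult: "c \<odot> \<one> = \<pi> (single 0 c)"
begin

lemma \<pi>_closed [simp]: "p \<in> pcarrier n \<Longrightarrow> \<pi> p \<in> carrier B"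
  using \<pi>_surj by blast

lemma \<pi>_one [simp]: "\<pi> 1 = \<one>"
  using Ring.ring_hom_one[OF \<pi>_hom] by simp

lemma \<pi>_mult: "p \<in> pcarrier n \<Longrightarrow> q \<in> pcarrier n \<Longrightarrow> \<pi> (p * q) = \<pi> p \<otimes> \<pi> q"
  using Ring.ring_hom_mult[OF \<pi>_hom] by simp

lemma \<pi>_add: "p \<in> pcarrier n \<Longrightarrow> q \<in> pcarrier n \<Longrightarrow> \<pi> (p + q) = \<pi> p \<oplus> \<pi> q"
  using Ring.ring_hom_add[OF \<pi>_hom] by simp

lemma \<pi>_zero [simp]: "\<pi> 0 = \<zero>"
  using \<pi>_add[of 0 0] \<pi>_closed[of 0] by (metis add.l_cancel_one' add_0 pcarrier_zero)

lemma \<pi>_uminus: "p \<in> pcarrier n \<Longrightarrow> \<pi> (- p) = \<ominus> \<pi> p"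
  using \<pi>_add[of "- p" p] by (simp add: pcarrier_uminus minus_equality)

lemma \<pi>_diff: "p \<in> pcarrier n \<Longrightarrow> q \<in> pcarrier n \<Longrightarrow> \<pi> (p - q) = \<pi> p \<ominus> \<pi> q"
  using \<pi>_add[of p "- q"] by (simp add: pcarrier_uminus \<pi>_uminus a_minus_def)

definition I where "I = {p \<in> pcarrier n. \<pi> p = \<zero>}"

lemma I_pcarrier: "I \<subseteq> pcarrier n"
  by (auto simp: I_def)

lemma diff_in_I: "p \<in> pcarrier n \<Longrightarrow> q \<in> pcarrier n \<Longrightarrow> \<pi> p = \<pi> q \<Longrightarrow> p - q \<in> I"
  by (simp add: I_def pcarrier_diff \<pi>_diff a_minus_def r_neg)

sublocale algebra_over "ground :: 'k ring" B
  by unfold_locales (simp add: \<pi>_smult)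

abbreviation "\<Omega>1 \<equiv> kaehler (ground :: 'k ring) B"
abbreviation "d \<equiv> univ_deriv (ground :: 'k ring) B"

sublocale X: exterior B \<Omega>1
  by (intro exterior.intro module_kaehler)

abbreviation "dx j \<equiv> d (\<pi> (polyvar j))"

lemma dx_closed: "j < n \<Longrightarrow> dx j \<in> carrier \<Omega>1"
  by (intro univ_deriv_closed \<pi>_closed pcarrier_polyvar)

subsection \<open>Linear combinations with polynomial coefficients\<close>

text \<open>Common to \<open>\<psi>\<close>, indexed by variables, and \<open>\<Psi>\<close>,
  indexed by sets of variables. Coefficients are polynomials that act through
  \<open>\<pi>\<close>.\<close>

definition comb :: "('b, 'y, 't) module_scheme \<Rightarrow> 'j set \<Rightarrow> ('j \<Rightarrow> 'y) \<Rightarrow> ('j \<Rightarrow> 'k mpoly) \<Rightarrow> 'y" where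
  "comb N Y g w = (\<Oplus>\<^bsub>N\<^esub>x\<in>Y. \<pi> (w x) \<odot>\<^bsub>N\<^esub> g x)"

context
  fixes N :: "('b, 'y, 't) module_scheme" and Y :: "'j set" and g :: "'j \<Rightarrow> 'y"
  assumes N: "Module.module B N" and Y: "finite Y" and g: "\<And>x. x \<in> Y \<Longrightarrow> g x \<in> carrier N"
begin

interpretation N: Module.module B N by (rule N)

lemma comb_closed: "(\<And>x. w x \<in> pcarrier n) \<Longrightarrow> comb N Y g w \<in> carrier N"
  unfolding comb_def using g by (intro N.M.finsum_closed) auto

lemma comb_add:
  assumes "\<And>x. w x \<in> pcarrier n" "\<And>x. w' x \<in> pcarrier n"
  shows "comb N Y g (w + w') = comb N Y g w \<oplus>\<^bsub>N\<^esub> comb N Y g w'"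
proof -
  have "comb N Y g (w + w') = (\<Oplus>\<^bsub>N\<^esub>x\<in>Y. \<pi> (w x) \<odot>\<^bsub>N\<^esub> g x \<oplus>\<^bsub>N\<^esub> \<pi> (w' x) \<odot>\<^bsub>N\<^esub> g x)"
    unfolding comb_def using assms g
    by (intro N.M.finsum_cong') (auto simp: \<pi>_add N.smult_l_distr plus_fun_apply)
  also have "\<dots> = comb N Y g w \<oplus>\<^bsub>N\<^esub> comb N Y g w'"
    unfolding comb_def using assms g by (intro N.M.finsum_addf) auto
  finally show ?thesis .
qed

lemma comb_scal:
  assumes "p \<in> pcarrier n" "\<And>x. w x \<in> pcarrier n"
  shows "comb N Y g (scal p w) = \<pi> p \<odot>\<^bsub>N\<^esub> comb N Y g w"
proof -
  have "comb N Y g (scal p w) = (\<Oplus>\<^bsub>N\<^esub>x\<in>Y. \<pi> p \<odot>\<^bsub>N\<^esub> (\<pi> (w x) \<odot>\<^bsub>N\<^esub> g x))"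
    unfolding comb_def scal_def using assms g
    by (intro N.M.finsum_cong') (auto simp: \<pi>_mult N.smult_assoc1)
  also have "\<dots> = \<pi> p \<odot>\<^bsub>N\<^esub> comb N Y g w"
    unfolding comb_def using assms g Y by (intro N.finsum_smult_ldistr[symmetric]) auto
  finally show ?thesis .
qed

lemma comb_zero: "comb N Y g 0 = \<zero>\<^bsub>N\<^esub>"
  using comb_scal[of 0 0] comb_closed[of 0] by (simp add: scal_simps zero_fun_apply)

lemma comb_unit: "x \<in> Y \<Longrightarrow> comb N Y g (unit x) = g x"
proof -
  assume x: "x \<in> Y"
  have "comb N Y g (unit x) = (\<Oplus>\<^bsub>N\<^esub>y\<in>Y. if x = y then g y else \<zero>\<^bsub>N\<^esub>)"
    unfolding comb_def using g by (intro N.M.finsum_cong') (auto simp: unit_def)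
  also have "\<dots> = g x"
    using x g Y by (intro N.M.finsum_singleton) auto
  finally show ?thesis .
qed

end

subsection \<open>The coordinate map\<close>

definition \<psi> where "\<psi> v = comb \<Omega>1 {..<n} dx v"

definition dX where "dX J = ext_prod B \<Omega>1 (map dx (sorted_list_of_set J))"

definition \<Psi> where "\<Psi> m w = comb (X.\<Lambda> m) (subsets n m) dX w"

lemma finite_subsetD: "J \<subseteq> {..<n} \<Longrightarrow> finite J"
  by (rule finite_subset) auto

lemma dX_closed: "J \<in> subsets n m \<Longrightarrow> dX J \<in> carrier (X.\<Lambda> m)"
  unfolding dX_def using finite_subsetD[of J]
  by (intro X.ext_prod_closed) (auto simp: sorted_list_of_set.length_sorted_key_list_of_set intro!: dx_closed)

lemma \<psi>_closed: "v \<in> vmod n \<Longrightarrow> \<psi> v \<in> carrier \<Omega>1"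
  unfolding \<psi>_def by (intro comb_closed module_kaehler vmodD(1)) (auto intro: dx_closed)

lemma \<psi>_add: "v \<in> vmod n \<Longrightarrow> v' \<in> vmod n \<Longrightarrow> \<psi> (v + v') = \<psi> v \<oplus>\<^bsub>\<Omega>1\<^esub> \<psi> v'"
  unfolding \<psi>_def by (intro comb_add module_kaehler vmodD(1)) (auto intro: dx_closed)

lemma \<psi>_scal: "p \<in> pcarrier n \<Longrightarrow> v \<in> vmod n \<Longrightarrow> \<psi> (scal p v) = \<pi> p \<odot>\<^bsub>\<Omega>1\<^esub> \<psi> v"
  unfolding \<psi>_def by (rule comb_scal[OF module_kaehler]) (auto intro: dx_closed vmodD(1))

lemma \<psi>_zero: "\<psi> 0 = \<zero>\<^bsub>\<Omega>1\<^esub>"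
  unfolding \<psi>_def by (intro comb_zero module_kaehler) (auto intro: dx_closed)

lemma \<psi>_unit: "j < n \<Longrightarrow> \<psi> (unit j) = dx j"
  unfolding \<psi>_def by (intro comb_unit module_kaehler) (auto intro: dx_closed)

lemma \<Psi>_closed: "w \<in> fmod n m \<Longrightarrow> \<Psi> m w \<in> carrier (X.\<Lambda> m)"
  unfolding \<Psi>_def by (intro comb_closed X.module_ext_power fmodD(1) finite_subsets dX_closed)

lemma \<Psi>_add: "w \<in> fmod n m \<Longrightarrow> w' \<in> fmod n m \<Longrightarrow> \<Psi> m (w + w') = \<Psi> m w \<oplus>\<^bsub>X.\<Lambda> m\<^esub> \<Psi> m w'"
  unfolding \<Psi>_def by (intro comb_add X.module_ext_power fmodD(1) finite_subsets dX_closed)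

lemma \<Psi>_scal: "p \<in> pcarrier n \<Longrightarrow> w \<in> fmod n m \<Longrightarrow> \<Psi> m (scal p w) = \<pi> p \<odot>\<^bsub>X.\<Lambda> m\<^esub> \<Psi> m w"
  unfolding \<Psi>_def
  by (rule comb_scal[OF X.module_ext_power finite_subsets]) (auto intro: dX_closed fmodD(1))

lemma \<Psi>_zero: "\<Psi> m 0 = \<zero>\<^bsub>X.\<Lambda> m\<^esub>"
  unfolding \<Psi>_def by (intro comb_zero X.module_ext_power finite_subsets dX_closed)

lemma \<Psi>_unit: "J \<subseteq> {..<n} \<Longrightarrow> card J = m \<Longrightarrow> \<Psi> m (unit J) = dX J"
  unfolding \<Psi>_def by (intro comb_unit X.module_ext_power finite_subsets dX_closed) auto

text \<open>Both sides are additive and obey the Leibniz rule, so it suffices that they agree on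
  constants and variables.\<close>

lemma d_\<pi>: "f \<in> pcarrier n \<Longrightarrow> d (\<pi> f) = \<psi> (grad f)"
proof (induction rule: pcarrier_induct)
  case (const c)
  show ?case
    using univ_deriv_unit_smult[of c] by (simp add: grad_simps \<psi>_zero \<pi>_smult)
next
  case (var j)
  then show ?case by (simp add: grad_simps \<psi>_unit)
next
  case (add p q)
  then show ?case
    by (simp add: \<pi>_add univ_deriv_add grad_simps \<psi>_add grad_vmod)
next
  case (mult p q)
  then show ?case
    by (simp add: \<pi>_mult univ_deriv_mult grad_simps \<psi>_add \<psi>_scal grad_vmod vmod_scal)
qed

text \<open>Sorting \<open>dx j\<close> into an increasing product produces the same sign as
  \<open>wedge_unit\<close> does on coordinates, and a repeated factor gives 0.\<close>

lemma ext_prod_insort: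
  assumes "sorted_wrt (<) js" "set js \<subseteq> {..<n}" "j < n" "length js = m"
  shows "ext_prod B \<Omega>1 (map dx (j # js)) = (if j \<in> set js then \<zero>\<^bsub>X.\<Lambda> (Suc m)\<^esub>
    else \<pi> ((-1) ^ card {i \<in> set js. i < j}) \<odot>\<^bsub>X.\<Lambda> (Suc m)\<^esub> ext_prod B \<Omega>1 (map dx (insort j js)))"
  using assms
proof (induction js arbitrary: m)
  case Nil
  then have "ext_prod B \<Omega>1 [dx j] \<in> carrier (X.\<Lambda> (Suc m))"
    by (intro X.ext_prod_closed) (auto intro: dx_closed)
  then show ?case by simp
next
  case (Cons a js)
  obtain l where m: "m = Suc l" "length js = l" using Cons.prems by auto
  have js: "set (map dx js) \<subseteq> carrier \<Omega>1" "length (map dx js) = l"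
    using Cons.prems m by (auto intro: dx_closed)
  have aj: "dx a \<in> carrier \<Omega>1" "dx j \<in> carrier \<Omega>1"
    using Cons.prems by (auto intro!: dx_closed)
  consider "j < a" | "j = a" | "a < j" by linarith
  then show ?case
  proof cases
    case 1
    then have e: "{i \<in> set (a # js). i < j} = {}" "j \<notin> set (a # js)" "insort j (a # js) = j # a # js"
      using Cons.prems by fastforce+
    have "ext_prod B \<Omega>1 (map dx (j # a # js)) \<in> carrier (X.\<Lambda> (Suc m))"
      using js aj m by (intro X.ext_prod_closed) auto
    then show ?thesis unfolding e(1,3) using e(2) by simp
  next
    case 2
    then show ?thesis using X.ext_prod_Cons_Cons_same[OF aj(1) js] m by simp
  next
    case 3
    let ?P = "ext_prod B \<Omega>1 (map dx js)" and ?Q = "ext_prod B \<Omega>1 (map dx (insort j js))"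
    let ?c = "card {i \<in> set js. i < j}"
    interpret mod_hom B "X.\<Lambda> m" "X.\<Lambda> (Suc m)" "ext_mult B \<Omega>1 (Suc m) (dx a)"
      by (rule X.ext_mult_hom[OF aj(1)])
    have P: "?P \<in> carrier (X.\<Lambda> l)" using js by (intro X.ext_prod_closed)
    have Q: "?Q \<in> carrier (X.\<Lambda> m)"
      using Cons.prems m by (intro X.ext_prod_closed) (auto simp: set_insort_key intro!: dx_closed)
    have aQ: "ext_mult B \<Omega>1 (Suc m) (dx a) ?Q = ext_prod B \<Omega>1 (map dx (a # insort j js))"
      using Cons.prems m aj by (subst X.ext_mult_ext_prod) (auto simp: set_insort_key intro!: dx_closed)
    \<comment> \<open>The new factor passes the smaller head \<open>a\<close> at the cost of one
      sign and is sorted into the tail by the induction hypothesis.\<close>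
    have "ext_prod B \<Omega>1 (map dx (j # a # js)) =
        ext_mult B \<Omega>1 (Suc m) (dx j) (ext_mult B \<Omega>1 m (dx a) ?P)"
      using js aj m by (simp add: X.ext_mult_ext_prod)
    also have "\<dots> = \<ominus>\<^bsub>X.\<Lambda> (Suc m)\<^esub> ext_mult B \<Omega>1 (Suc m) (dx a) (ext_mult B \<Omega>1 m (dx j) ?P)"
      unfolding m(1) by (rule X.ext_mult_swap[OF aj(2,1) P])
    also have "ext_mult B \<Omega>1 m (dx j) ?P = ext_prod B \<Omega>1 (map dx (j # js))"
      using js aj m by (simp add: X.ext_mult_ext_prod)
    also have "\<dots> = (if j \<in> set js then \<zero>\<^bsub>X.\<Lambda> m\<^esub> else \<pi> ((-1) ^ ?c) \<odot>\<^bsub>X.\<Lambda> m\<^esub> ?Q)"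
      using Cons.IH[of l] Cons.prems m by simp
    finally have *: "ext_prod B \<Omega>1 (map dx (j # a # js)) = \<ominus>\<^bsub>X.\<Lambda> (Suc m)\<^esub>
      ext_mult B \<Omega>1 (Suc m) (dx a) (if j \<in> set js then \<zero>\<^bsub>X.\<Lambda> m\<^esub> else \<pi> ((-1) ^ ?c) \<odot>\<^bsub>X.\<Lambda> m\<^esub> ?Q)" .
    show ?thesis
    proof (cases "j \<in> set js")
      case True
      then show ?thesis unfolding * by simp
    next
      case False
      have "a \<notin> {i \<in> set js. i < j}" using Cons.prems by auto
      moreover have "{i \<in> set (a # js). i < j} = insert a {i \<in> set js. i < j}" using 3 by auto
      ultimately have c: "card {i \<in> set (a # js). i < j} = Suc ?c" by simp
      have s: "((-1) ^ ?c :: 'k mpoly) \<in> pcarrier n"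
        using pcarrier_uminus[OF pcarrier_one[of n]] by (rule pcarrier_power)
      have "insort j (a # js) = a # insort j js" using 3 by simp
      moreover have "ext_prod B \<Omega>1 (map dx (a # insort j js)) \<in> carrier (X.\<Lambda> (Suc m))"
        unfolding aQ[symmetric] using Q by simp
      ultimately show ?thesis
        unfolding * c using False 3 s Q aQ by (simp add: \<pi>_uminus X.L.smult_l_minus)
    qed
  qed
qed

lemma \<Psi>_wedge_unit:
  assumes "j < n" "J \<subseteq> {..<n}" "card J = m"
  shows "\<Psi> (Suc m) (wedge (unit j) (unit J)) = ext_mult B \<Omega>1 (Suc m) (dx j) (dX J)"
proof -
  have J: "finite J" using assms finite_subsetD by auto
  let ?js = "sorted_list_of_set J"
  have js: "sorted_wrt (<) ?js" "set ?js = J" "length ?js = m"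
    using J assms by simp_all
  have "ext_mult B \<Omega>1 (Suc m) (dx j) (dX J) = ext_prod B \<Omega>1 (map dx (j # ?js))"
    unfolding dX_def using assms js by (subst X.ext_mult_ext_prod) (auto intro!: dx_closed)
  also have "\<dots> = (if j \<in> J then \<zero>\<^bsub>X.\<Lambda> (Suc m)\<^esub> else
      \<pi> ((-1) ^ card {i \<in> J. i < j}) \<odot>\<^bsub>X.\<Lambda> (Suc m)\<^esub> ext_prod B \<Omega>1 (map dx (insort j ?js)))"
    using ext_prod_insort[of ?js j m] js assms by simp
  also have "\<dots> = \<Psi> (Suc m) (wedge (unit j) (unit J))"
  proof (cases "j \<in> J")
    case True
    then show ?thesis using J by (simp add: wedge_unit \<Psi>_zero)
  next
    case False
    have jJ: "insert j J \<subseteq> {..<n}" "card (insert j J) = Suc m" using assms J False by auto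
    have "((-1) ^ card {i \<in> J. i < j} :: 'k mpoly) \<in> pcarrier n"
      using pcarrier_uminus[OF pcarrier_one[of n]] by (rule pcarrier_power)
    from \<Psi>_scal[OF this unit_fmod[OF jJ]]
    have "\<Psi> (Suc m) (wedge (unit j) (unit J)) =
        \<pi> ((-1) ^ card {i \<in> J. i < j}) \<odot>\<^bsub>X.\<Lambda> (Suc m)\<^esub> dX (insert j J)"
      unfolding \<Psi>_unit[OF jJ] using J False by (simp add: wedge_unit)
    moreover have "insort j ?js = sorted_list_of_set (insert j J)"
      using J False by simp
    ultimately show ?thesis using False by (simp add: dX_def)
  qed
  finally show ?thesis by simp
qed

text \<open>Both sides are additive in \<open>v\<close> and in \<open>w\<close> and compatible with
  scalars through \<open>\<pi>\<close>, which leaves basis vectors to compare.\<close>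

lemma \<Psi>_wedge:
  assumes v: "v \<in> vmod n" and w: "w \<in> fmod n m"
  shows "\<Psi> (Suc m) (wedge v w) = ext_mult B \<Omega>1 (Suc m) (\<psi> v) (\<Psi> m w)"
  using w
proof (rule fmod_induct[where P = "\<lambda>w. \<Psi> (Suc m) (wedge v w) = ext_mult B \<Omega>1 (Suc m) (\<psi> v) (\<Psi> m w)"])
  interpret mod_hom B "X.\<Lambda> m" "X.\<Lambda> (Suc m)" "ext_mult B \<Omega>1 (Suc m) (\<psi> v)"
    by (rule X.ext_mult_hom[OF \<psi>_closed[OF v]])
  show "\<Psi> (Suc m) (wedge v 0) = ext_mult B \<Omega>1 (Suc m) (\<psi> v) (\<Psi> m 0)"
    by (simp add: wedge_simps \<Psi>_zero)
  show "\<Psi> (Suc m) (wedge v (w + w')) = ext_mult B \<Omega>1 (Suc m) (\<psi> v) (\<Psi> m (w + w'))"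
    if "w \<in> fmod n m" "w' \<in> fmod n m" "\<Psi> (Suc m) (wedge v w) = ext_mult B \<Omega>1 (Suc m) (\<psi> v) (\<Psi> m w)"
      "\<Psi> (Suc m) (wedge v w') = ext_mult B \<Omega>1 (Suc m) (\<psi> v) (\<Psi> m w')" for w w'
    using that v by (simp add: wedge_simps \<Psi>_add wedge_fmod \<Psi>_closed)
  show "\<Psi> (Suc m) (wedge v (scal p w)) = ext_mult B \<Omega>1 (Suc m) (\<psi> v) (\<Psi> m (scal p w))"
    if "p \<in> pcarrier n" "w \<in> fmod n m" "\<Psi> (Suc m) (wedge v w) = ext_mult B \<Omega>1 (Suc m) (\<psi> v) (\<Psi> m w)" for p w
    using that v by (simp add: wedge_simps \<Psi>_scal wedge_fmod \<Psi>_closed)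
  fix J assume J: "J \<subseteq> {..<n}" "card J = m"
  then have uJ: "(unit J :: 'k form) \<in> fmod n m" and dJ: "dX J \<in> carrier (X.\<Lambda> m)"
    by (auto intro: unit_fmod dX_closed)
  show "\<Psi> (Suc m) (wedge v (unit J)) = ext_mult B \<Omega>1 (Suc m) (\<psi> v) (\<Psi> m (unit J))"
    unfolding \<Psi>_unit[OF J] using v
  proof (rule vmod_induct[where P = "\<lambda>v. \<Psi> (Suc m) (wedge v (unit J)) = ext_mult B \<Omega>1 (Suc m) (\<psi> v) (dX J)"])
    \<comment> \<open>The zero vector is written as 0 times itself, so that homogeneity in the left
      factor gives the value 0.\<close>
    have "ext_mult B \<Omega>1 (Suc m) (\<zero> \<odot>\<^bsub>\<Omega>1\<^esub> \<zero>\<^bsub>\<Omega>1\<^esub>) (dX J) = \<zero>\<^bsub>X.\<Lambda> (Suc m)\<^esub>"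
      using X.ext_mult_smult_left[of \<zero> "\<zero>\<^bsub>\<Omega>1\<^esub>" "dX J" m] dJ X.ext_mult_closed[of "\<zero>\<^bsub>\<Omega>1\<^esub>" "dX J" m]
      by simp
    then show "\<Psi> (Suc m) (wedge 0 (unit J)) = ext_mult B \<Omega>1 (Suc m) (\<psi> 0) (dX J)"
      by (simp add: wedge_simps \<Psi>_zero \<psi>_zero)
    show "\<Psi> (Suc m) (wedge (unit j) (unit J)) = ext_mult B \<Omega>1 (Suc m) (\<psi> (unit j)) (dX J)"
      if "j < n" for j
      using that J by (simp add: \<Psi>_wedge_unit \<psi>_unit)
    show "\<Psi> (Suc m) (wedge (v + v') (unit J)) = ext_mult B \<Omega>1 (Suc m) (\<psi> (v + v')) (dX J)"
      if "v \<in> vmod n" "v' \<in> vmod n" "\<Psi> (Suc m) (wedge v (unit J)) = ext_mult B \<Omega>1 (Suc m) (\<psi> v) (dX J)"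
      "\<Psi> (Suc m) (wedge v' (unit J)) = ext_mult B \<Omega>1 (Suc m) (\<psi> v') (dX J)" for v v'
      using that uJ dJ
      by (simp add: wedge_simps \<Psi>_add wedge_fmod \<psi>_add X.ext_mult_add_left \<psi>_closed)
    show "\<Psi> (Suc m) (wedge (scal p v) (unit J)) = ext_mult B \<Omega>1 (Suc m) (\<psi> (scal p v)) (dX J)"
      if "p \<in> pcarrier n" "v \<in> vmod n"
        "\<Psi> (Suc m) (wedge v (unit J)) = ext_mult B \<Omega>1 (Suc m) (\<psi> v) (dX J)" for p v
      using that uJ dJ
      by (simp add: wedge_simps \<Psi>_scal wedge_fmod \<psi>_scal X.ext_mult_smult_left \<psi>_closed)
  qed
qed

lemma \<Psi>_wedge_list:
  "set vs \<subseteq> vmod n \<Longrightarrow> \<Psi> (length vs) (wedge_list vs) = ext_prod B \<Omega>1 (map \<psi> vs)"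
proof (induction vs)
  case Nil
  then show ?case by (simp add: \<Psi>_unit dX_def)
next
  case (Cons v vs)
  then have "ext_prod B \<Omega>1 (map \<psi> (v # vs)) =
      ext_mult B \<Omega>1 (Suc (length vs)) (\<psi> v) (ext_prod B \<Omega>1 (map \<psi> vs))"
    by (subst X.ext_mult_ext_prod) (auto intro: \<psi>_closed)
  then show ?case using Cons by (simp add: \<Psi>_wedge wedge_list_fmod)
qed

lemma \<psi>_surj: "x \<in> carrier \<Omega>1 \<Longrightarrow> \<exists>v\<in>vmod n. x = \<psi> v"
proof (induction rule: kaehler_induct)
  case zero
  then show ?case by (intro bexI[of _ 0]) (simp_all add: \<psi>_zero)
next
  case (gen b)
  then obtain f where "f \<in> pcarrier n" "b = \<pi> f" using \<pi>_surj by blast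
  then show ?case by (intro bexI[of _ "grad f"]) (simp_all add: d_\<pi> grad_vmod)
next
  case (add x y)
  then obtain v v' where "v \<in> vmod n" "x = \<psi> v" "v' \<in> vmod n" "y = \<psi> v'" by blast
  then show ?case by (intro bexI[of _ "v + v'"]) (simp_all add: \<psi>_add vmod_add)
next
  case (smult b x)
  then obtain v p where "v \<in> vmod n" "x = \<psi> v" "p \<in> pcarrier n" "b = \<pi> p" using \<pi>_surj by blast
  then show ?case by (intro bexI[of _ "scal p v"]) (simp_all add: \<psi>_scal vmod_scal)
qed

lemma \<Psi>_surj: "x \<in> carrier (X.\<Lambda> m) \<Longrightarrow> \<exists>w\<in>fmod n m. x = \<Psi> m w"
proof (induction rule: X.ext_power_induct)
  case zero
  then show ?case by (intro bexI[of _ 0]) (simp_all add: \<Psi>_zero)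
next
  case (gen xs)
  \<comment> \<open>Coordinates are chosen for every entry of the tuple; \<open>\<Psi>\<close> maps
    their wedge product to the given product.\<close>
  define vs where "vs = map (\<lambda>x. SOME v. v \<in> vmod n \<and> x = \<psi> v) xs"
  have *: "(SOME v. v \<in> vmod n \<and> x = \<psi> v) \<in> vmod n \<and> x = \<psi> (SOME v. v \<in> vmod n \<and> x = \<psi> v)"
    if "x \<in> set xs" for x
    using gen that \<psi>_surj[of x] by (intro someI_ex[of "\<lambda>v. v \<in> vmod n \<and> x = \<psi> v"]) auto
  have "set vs \<subseteq> vmod n" "map \<psi> vs = xs" "length vs = m"
    using * gen by (auto simp: vs_def intro!: map_idI)
  then show ?case using \<Psi>_wedge_list[of vs] wedge_list_fmod[of vs n] by (intro bexI[of _ "wedge_list vs"]) auto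
next
  case (add x y)
  then obtain v v' where "v \<in> fmod n m" "x = \<Psi> m v" "v' \<in> fmod n m" "y = \<Psi> m v'" by blast
  then show ?case by (intro bexI[of _ "v + v'"]) (simp_all add: \<Psi>_add fmod_add)
next
  case (smult b x)
  then obtain v p where "v \<in> fmod n m" "x = \<Psi> m v" "p \<in> pcarrier n" "b = \<pi> p" using \<pi>_surj by blast
  then show ?case by (intro bexI[of _ "scal p v"]) (simp_all add: \<Psi>_scal fmod_scal)
qed

lemma \<psi>_grad_I: "f \<in> I \<Longrightarrow> \<psi> (grad f) = \<zero>\<^bsub>\<Omega>1\<^esub>"
  using d_\<pi>[of f] univ_deriv_unit_smult[of 0] by (simp add: I_def \<pi>_smult)

lemma \<Psi>_frel:
  assumes "w \<in> frel n I m"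
  shows "\<Psi> m w = \<zero>\<^bsub>X.\<Lambda> m\<^esub>"
proof -
  \<comment> \<open>Membership in \<open>fmod\<close> is carried through the induction because
    \<open>\<Psi>\<close> is known to be linear only there.\<close>
  have "w \<in> fmod n m \<and> \<Psi> m w = \<zero>\<^bsub>X.\<Lambda> m\<^esub>"
    using assms unfolding frel_def
  proof (rule pspan_induct[where P = "\<lambda>w. w \<in> fmod n m \<and> \<Psi> m w = \<zero>\<^bsub>X.\<Lambda> m\<^esub>"])
    show "0 \<in> fmod n m \<and> \<Psi> m 0 = \<zero>\<^bsub>X.\<Lambda> m\<^esub>"
      by (simp add: \<Psi>_zero)
    fix w assume "w \<in> frel_gens n I m"
    then consider a w' where "a \<in> I" "w' \<in> fmod n m" "w = scal a w'"
      | f w' m' where "m = Suc m'" "f \<in> I" "w' \<in> fmod n m'" "w = wedge (grad f) w'"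
      by auto
    then show "w \<in> fmod n m \<and> \<Psi> m w = \<zero>\<^bsub>X.\<Lambda> m\<^esub>"
    proof cases
      case 1
      then show ?thesis using I_pcarrier by (auto simp: \<Psi>_scal fmod_scal \<Psi>_closed I_def)
    next
      case 2
      have "\<zero>\<^bsub>\<Omega>1\<^esub> \<in> carrier \<Omega>1" "\<Psi> m' w' \<in> carrier (X.\<Lambda> m')" using 2 by (auto intro: \<Psi>_closed)
      then have "ext_mult B \<Omega>1 (Suc m') (\<zero> \<odot>\<^bsub>\<Omega>1\<^esub> \<zero>\<^bsub>\<Omega>1\<^esub>) (\<Psi> m' w') = \<zero>\<^bsub>X.\<Lambda> (Suc m')\<^esub>"
        using X.ext_mult_closed[of "\<zero>\<^bsub>\<Omega>1\<^esub>" "\<Psi> m' w'" m'] by (subst X.ext_mult_smult_left) auto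
      then have "ext_mult B \<Omega>1 (Suc m') \<zero>\<^bsub>\<Omega>1\<^esub> (\<Psi> m' w') = \<zero>\<^bsub>X.\<Lambda> (Suc m')\<^esub>"
        by simp
      moreover have "grad f \<in> vmod n" using 2 I_pcarrier by (auto intro: grad_vmod)
      ultimately show ?thesis using 2 by (simp add: wedge_fmod \<Psi>_wedge \<psi>_grad_I)
    qed
  next
    fix w w' assume "w \<in> fmod n m \<and> \<Psi> m w = \<zero>\<^bsub>X.\<Lambda> m\<^esub>" "w' \<in> fmod n m \<and> \<Psi> m w' = \<zero>\<^bsub>X.\<Lambda> m\<^esub>"
    then show "w + w' \<in> fmod n m \<and> \<Psi> m (w + w') = \<zero>\<^bsub>X.\<Lambda> m\<^esub>"
      by (simp add: fmod_add \<Psi>_add)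
  next
    fix p :: "'k mpoly" and w assume "p \<in> pcarrier n" "w \<in> fmod n m \<and> \<Psi> m w = \<zero>\<^bsub>X.\<Lambda> m\<^esub>"
    then show "scal p w \<in> fmod n m \<and> \<Psi> m (scal p w) = \<zero>\<^bsub>X.\<Lambda> m\<^esub>"
      by (simp add: fmod_scal \<Psi>_scal)
  qed
  then show ?thesis ..
qed

end

subsection \<open>The kernel of the coordinate map\<close>

text \<open>Congruence modulo a submodule is written as membership of the difference; this and the
  next five rules are its calculus.\<close>

lemma pspan_cong_sym: "x - y \<in> pspan n G \<Longrightarrow> y - x \<in> pspan n G"
  using pspan_uminus[of "x - y" n G] by simp

lemma pspan_cong_trans: "x - y \<in> pspan n G \<Longrightarrow> y - z \<in> pspan n G \<Longrightarrow> x - z \<in> pspan n G"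
  using pspan_add[of "x - y" n G "y - z"] by simp

lemma pspan_cong_add:
  "x - y \<in> pspan n G \<Longrightarrow> x' - y' \<in> pspan n G \<Longrightarrow> (x + x') - (y + y') \<in> pspan n G"
  using pspan_add[of "x - y" n G "x' - y'"] by (simp add: algebra_simps)

lemma pspan_cong_diff:
  "x - y \<in> pspan n G \<Longrightarrow> x' - y' \<in> pspan n G \<Longrightarrow> (x - x') - (y - y') \<in> pspan n G"
  using pspan_diff[of "x - y" n G "x' - y'"] by (simp add: algebra_simps)

lemma pspan_cong_scal:
  "p \<in> pcarrier n \<Longrightarrow> x - y \<in> pspan n G \<Longrightarrow> scal p x - scal p y \<in> pspan n G"
  using pspan_scal[of p n "x - y" G] by (simp add: scal_simps)

lemma pspan_cong_mem: "x - y \<in> pspan n G \<Longrightarrow> y \<in> pspan n G \<Longrightarrow> x \<in> pspan n G"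
  using pspan_add[of "x - y" n G y] by simp

context poly_quotient
begin

definition rep where "rep b = (SOME p. p \<in> pcarrier n \<and> \<pi> p = b)"

lemma rep:
  assumes "b \<in> carrier B"
  shows "rep b \<in> pcarrier n" "\<pi> (rep b) = b"
proof -
  have "\<exists>p. p \<in> pcarrier n \<and> \<pi> p = b" using assms unfolding \<pi>_surj[symmetric] by auto
  then have "rep b \<in> pcarrier n \<and> \<pi> (rep b) = b" unfolding rep_def by (rule someI_ex)
  then show "rep b \<in> pcarrier n" "\<pi> (rep b) = b" by auto
qed

text \<open>
  An inverse of \<open>\<Psi>\<close> would require polynomial representatives of elements of \<open>B\<close>. With arbitrarily
  chosen ones, maps out of a free \<open>B\<close>-module are linear only up to the submodules \<open>vrel\<close> and \<open>frel\<close>,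
  which is enough to determine the kernel of \<open>\<Psi>\<close>.
\<close>

definition lift :: "('x \<Rightarrow> 'j \<Rightarrow> 'k mpoly) \<Rightarrow> ('x \<Rightarrow> 'b) \<Rightarrow> 'j \<Rightarrow> 'k mpoly" where
  "lift h f = (\<Sum>x | f x \<noteq> \<zero>. scal (rep (f x)) (h x))"

text \<open>Two representatives of an element of \<open>B\<close> differ by an element of
  \<open>I\<close>, so \<open>hG\<close> makes the choice made by \<open>rep\<close> immaterial
  modulo the span of \<open>G\<close>.\<close>

context
  fixes Y :: "'x set" and h :: "'x \<Rightarrow> 'j \<Rightarrow> 'k mpoly" and G :: "('j \<Rightarrow> 'k mpoly) set"
  assumes hG: "\<And>a x. a \<in> I \<Longrightarrow> x \<in> Y \<Longrightarrow> scal a (h x) \<in> pspan n G"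
begin

text \<open>The sum may run over any larger finite set: \<open>rep \<zero>\<close> need not be 0,
  but it lies in \<open>I\<close>. This lets functions with different supports be compared over one
  index set.\<close>

lemma lift_superset:
  assumes f: "f \<in> carrier (free_module B Y)" and Z: "finite Z" "{x. f x \<noteq> \<zero>} \<subseteq> Z" "Z \<subseteq> Y"
  shows "(\<Sum>x\<in>Z. scal (rep (f x)) (h x)) - lift h f \<in> pspan n G"
proof -
  let ?g = "\<lambda>x. scal (rep (f x)) (h x)"
  have "rep \<zero> \<in> I" using rep[of \<zero>] by (simp add: I_def)
  have "sum ?g Z - lift h f = sum ?g (Z - {x. f x \<noteq> \<zero>})"
    unfolding lift_def using sum.subset_diff[OF Z(2,1), of ?g] by simp
  also have "\<dots> \<in> pspan n G"
    using \<open>rep \<zero> \<in> I\<close> Z by (intro pspan_sum) (auto intro: hG)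
  finally show ?thesis .
qed

lemma lift_add:
  assumes f: "f \<in> carrier (free_module B Y)" and g: "g \<in> carrier (free_module B Y)"
  shows "lift h (\<lambda>x. f x \<oplus> g x) - (lift h f + lift h g) \<in> pspan n G"
proof -
  interpret F: Module.module B "free_module B Y" by (rule module_free_module)
  have fg: "(\<lambda>x. f x \<oplus> g x) \<in> carrier (free_module B Y)"
    using F.M.a_closed[OF f g] by (simp add: free_module_simps)
  define Z where "Z = {x. f x \<noteq> \<zero>} \<union> {x. g x \<noteq> \<zero>}"
  have Z: "finite Z" "Z \<subseteq> Y" "{x. f x \<noteq> \<zero>} \<subseteq> Z" "{x. g x \<noteq> \<zero>} \<subseteq> Z" "{x. f x \<oplus> g x \<noteq> \<zero>} \<subseteq> Z"
    using free_module_memD(2,3)[OF f] free_module_memD(2,3)[OF g] by (auto simp: Z_def)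
  let ?s = "\<lambda>f. \<Sum>x\<in>Z. scal (rep (f x)) (h x)"
  have "?s (\<lambda>x. f x \<oplus> g x) - (?s f + ?s g) = (\<Sum>x\<in>Z. scal (rep (f x \<oplus> g x) - (rep (f x) + rep (g x))) (h x))"
    by (simp add: sum.distrib sum_subtractf scal_simps)
  also have "\<dots> \<in> pspan n G"
  proof (intro pspan_sum hG diff_in_I)
    fix x assume "x \<in> Z"
    then show "x \<in> Y" using Z by auto
    have "f x \<in> carrier B" "g x \<in> carrier B" by (rule free_module_memD(1)[OF f] free_module_memD(1)[OF g])+
    then show "rep (f x \<oplus> g x) \<in> pcarrier n" "rep (f x) + rep (g x) \<in> pcarrier n"
      "\<pi> (rep (f x \<oplus> g x)) = \<pi> (rep (f x) + rep (g x))"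
      by (auto simp: rep \<pi>_add intro: pcarrier_add)
  qed
  finally have 1: "?s (\<lambda>x. f x \<oplus> g x) - (?s f + ?s g) \<in> pspan n G" .
  have 2: "?s f - lift h f \<in> pspan n G" "?s g - lift h g \<in> pspan n G"
    "?s (\<lambda>x. f x \<oplus> g x) - lift h (\<lambda>x. f x \<oplus> g x) \<in> pspan n G"
    using f g fg Z by (intro lift_superset; simp)+
  show ?thesis
    by (rule pspan_cong_trans[OF pspan_cong_sym[OF 2(3)] pspan_cong_trans[OF 1 pspan_cong_add[OF 2(1,2)]]])
qed

lemma lift_smult:
  assumes b: "b \<in> carrier B" and f: "f \<in> carrier (free_module B Y)"
  shows "lift h (\<lambda>x. b \<otimes> f x) - scal (rep b) (lift h f) \<in> pspan n G"
proof -
  interpret F: Module.module B "free_module B Y" by (rule module_free_module)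
  have bf: "(\<lambda>x. b \<otimes> f x) \<in> carrier (free_module B Y)"
    using F.smult_closed[OF b f] by (simp add: free_module_simps)
  define Z where "Z = {x. f x \<noteq> \<zero>}"
  have Z: "finite Z" "Z \<subseteq> Y" "{x. b \<otimes> f x \<noteq> \<zero>} \<subseteq> Z"
    using free_module_memD(2,3)[OF f] b by (auto simp: Z_def)
  let ?s = "\<lambda>f. \<Sum>x\<in>Z. scal (rep (f x)) (h x)"
  have scal_sum: "scal p (sum u Z) = (\<Sum>x\<in>Z. scal p (u x))" for p and u :: "'x \<Rightarrow> 'j \<Rightarrow> 'k mpoly"
    using Z(1) by (induction Z rule: finite_induct) (auto simp: scal_simps)
  have "?s (\<lambda>x. b \<otimes> f x) - scal (rep b) (?s f) = (\<Sum>x\<in>Z. scal (rep (b \<otimes> f x) - rep b * rep (f x)) (h x))"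
    by (simp add: sum_subtractf scal_simps scal_sum)
  also have "\<dots> \<in> pspan n G"
  proof (intro pspan_sum hG diff_in_I)
    fix x assume "x \<in> Z"
    then show "x \<in> Y" using Z by auto
    have "f x \<in> carrier B" by (rule free_module_memD(1)[OF f])
    then show "rep (b \<otimes> f x) \<in> pcarrier n" "rep b * rep (f x) \<in> pcarrier n"
      "\<pi> (rep (b \<otimes> f x)) = \<pi> (rep b * rep (f x))"
      using b by (auto simp: rep \<pi>_mult intro: pcarrier_mult)
  qed
  finally have 1: "?s (\<lambda>x. b \<otimes> f x) - scal (rep b) (lift h f) \<in> pspan n G"
    by (simp add: lift_def Z_def)
  have 2: "?s (\<lambda>x. b \<otimes> f x) - lift h (\<lambda>x. b \<otimes> f x) \<in> pspan n G"
    using bf Z by (intro lift_superset) simp_all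
  show ?thesis by (rule pspan_cong_trans[OF pspan_cong_sym[OF 2] 1])
qed

lemma lift_minus:
  assumes f: "f \<in> carrier (free_module B Y)" and g: "g \<in> carrier (free_module B Y)"
  shows "lift h (f \<ominus>\<^bsub>free_module B Y\<^esub> g) - (lift h f - lift h g) \<in> pspan n G"
proof -
  interpret F: Module.module B "free_module B Y" by (rule module_free_module)
  let ?k = "f \<ominus>\<^bsub>free_module B Y\<^esub> g"
  have k: "?k \<in> carrier (free_module B Y)" using f g by simp
  have "?k \<oplus>\<^bsub>free_module B Y\<^esub> g = f"
    using f g by (simp add: a_minus_def F.M.a_assoc F.M.l_neg)
  then have "(\<lambda>x. ?k x \<oplus> g x) = f" by (simp add: free_module_simps)
  then have "lift h f - (lift h ?k + lift h g) \<in> pspan n G" using lift_add[OF k g] by simp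
  then have "(lift h ?k + lift h g) - lift h f \<in> pspan n G" by (rule pspan_cong_sym)
  then show ?thesis by (simp add: algebra_simps)
qed

lemma lift_gen:
  assumes "x \<in> Y"
  shows "lift h (free_gen B x) - h x \<in> pspan n G"
proof -
  have 1: "(\<Sum>y\<in>{x}. scal (rep (free_gen B x y)) (h y)) - lift h (free_gen B x) \<in> pspan n G"
    using assms by (intro lift_superset free_gen_closed) (auto simp: free_gen_def)
  have "(\<Sum>y\<in>{x}. scal (rep (free_gen B x y)) (h y)) - h x = scal (rep \<one> - 1) (h x)"
    by (simp add: free_gen_def scal_simps)
  moreover have "scal (rep \<one> - 1) (h x) \<in> pspan n G"
    using assms by (intro hG diff_in_I) (auto simp: rep)
  ultimately have 2: "(\<Sum>y\<in>{x}. scal (rep (free_gen B x y)) (h y)) - h x \<in> pspan n G" by simp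
  show ?thesis by (rule pspan_cong_trans[OF pspan_cong_sym[OF 1] 2])
qed

lemma lift_kernel:
  assumes f: "f \<in> LinearCombinations.module.span B (free_module B Y) S"
    and S: "S \<subseteq> carrier (free_module B Y)" "\<And>r. r \<in> S \<Longrightarrow> lift h r \<in> pspan n G"
  shows "lift h f \<in> pspan n G"
proof -
  interpret F: Module.module B "free_module B Y" by (rule module_free_module)
  from S(1) f show ?thesis
  proof (induction rule: F.span_induct)
    case zero
    then show ?case by (simp add: free_module_simps lift_def pspan_zero)
  next
    case (gen r)
    then show ?case by (rule S(2))
  next
    case (add f g)
    then have "lift h f + lift h g \<in> pspan n G" by (intro pspan_add)
    then show ?case
      unfolding free_module_simps by (rule pspan_cong_mem[OF lift_add[OF add(1,2)]])
  next
    case (smult b f)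
    then have "scal (rep b) (lift h f) \<in> pspan n G" by (intro pspan_scal rep)
    then show ?case
      unfolding free_module_simps by (rule pspan_cong_mem[OF lift_smult[OF smult(1,2)]])
  qed
qed

lemma lift_mem:
  assumes "f \<in> carrier (free_module B Y)" "\<And>x. x \<in> Y \<Longrightarrow> h x \<in> H" "0 \<in> H"
    "\<And>v w. v \<in> H \<Longrightarrow> w \<in> H \<Longrightarrow> v + w \<in> H" "\<And>p w. p \<in> pcarrier n \<Longrightarrow> w \<in> H \<Longrightarrow> scal p w \<in> H"
  shows "lift h f \<in> H"
proof -
  have "sum (\<lambda>x. scal (rep (f x)) (h x)) Z \<in> H" if "finite Z" "Z \<subseteq> Y" for Z
    using that free_module_memD(1)[OF assms(1)] assms(2-)
    by (induction Z rule: finite_induct) (auto simp: rep)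
  then show ?thesis unfolding lift_def using free_module_memD(2,3)[OF assms(1)] by blast
qed

end

subsubsection \<open>Coordinates of a Kaehler differential, modulo \<open>vrel\<close>\<close>

text \<open>It sends the symbol d b to the gradient of a representative of \<open>b\<close>, still
  on the free module, before any relation is divided out.\<close>

definition "gr = lift (\<lambda>b. grad (rep b))"

lemma gr_hG:
  "a \<in> I \<Longrightarrow> b \<in> carrier B \<Longrightarrow> scal a (grad (rep b)) \<in>
    pspan n (vrel_gens n I)"
  by (rule pspan_gen) (use grad_vmod[OF rep(1)] in blast)

lemma grad_vrel: "f \<in> I \<Longrightarrow> grad f \<in> vrel n I"
  unfolding vrel_def by (rule pspan_gen) blast

lemma gr_vmod: "f \<in> carrier FB \<Longrightarrow> gr f \<in> vmod n"
  unfolding gr_def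
  by (rule lift_mem[where h = "\<lambda>b. grad (rep b)" and Y = "carrier B", OF gr_hG]) (auto intro: grad_vmod rep vmod_add vmod_scal)

lemma gr_add:
  "f \<in> carrier FB \<Longrightarrow> g \<in> carrier FB \<Longrightarrow>
    gr (\<lambda>x. f x \<oplus> g x) - (gr f + gr g) \<in> vrel n I"
  unfolding gr_def vrel_def by (rule lift_add[where h = "\<lambda>b. grad (rep b)" and Y = "carrier B"]) (rule gr_hG)

lemma gr_smult:
  "b \<in> carrier B \<Longrightarrow> f \<in> carrier FB \<Longrightarrow> gr (\<lambda>x. b \<otimes> f x) - scal (rep b) (gr f) \<in> vrel n I"
  unfolding gr_def vrel_def by (rule lift_smult[where h = "\<lambda>b. grad (rep b)" and Y = "carrier B"]) (rule gr_hG)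

lemma gr_minus:
  "f \<in> carrier FB \<Longrightarrow> g \<in> carrier FB \<Longrightarrow> gr (f \<ominus>\<^bsub>FB\<^esub> g) - (gr f - gr g) \<in> vrel n I"
  unfolding gr_def vrel_def by (rule lift_minus[where h = "\<lambda>b. grad (rep b)" and Y = "carrier B"]) (rule gr_hG)

lemma gr_gen: "b \<in> carrier B \<Longrightarrow> gr (free_gen B b) - grad (rep b) \<in> vrel n I"
  unfolding gr_def vrel_def
  by (rule lift_gen[where h = "\<lambda>b. grad (rep b)" and Y = "carrier B"]) (rule gr_hG)

lemmas vrel_cong_trans = pspan_cong_trans[where G = "vrel_gens n I" and n = n, folded vrel_def]
lemmas vrel_cong_sym = pspan_cong_sym[where G = "vrel_gens n I" and n = n, folded vrel_def]
lemmas vrel_cong_add = pspan_cong_add[where G = "vrel_gens n I" and n = n, folded vrel_def]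
lemmas vrel_cong_diff = pspan_cong_diff[where G = "vrel_gens n I" and n = n, folded vrel_def]
lemmas vrel_cong_scal = pspan_cong_scal[where G = "vrel_gens n I" and n = n, folded vrel_def]
lemmas vrel_cong_mem = pspan_cong_mem[where G = "vrel_gens n I" and n = n, folded vrel_def]

text \<open>Modulo \<open>vrel\<close>, each relation goes to the gradient of a polynomial that
  measures how far \<open>rep\<close> is from being additive, multiplicative or the identity on
  constants. These polynomials lie in \<open>I\<close>, so their gradients lie in
  \<open>vrel\<close>.\<close>

lemma gr_kaehler_rels:
  assumes "r \<in> kaehler_rels (ground :: 'k ring) B"
  shows "gr r \<in> vrel n I"
proof -
  have r: "r \<in> {free_gen B (a \<oplus> b) \<ominus>\<^bsub>FB\<^esub> (free_gen B a \<oplus>\<^bsub>FB\<^esub> free_gen B b) | a b.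
      a \<in> carrier B \<and> b \<in> carrier B}
    \<union> {free_gen B (a \<otimes> b) \<ominus>\<^bsub>FB\<^esub> ((a \<odot>\<^bsub>FB\<^esub> free_gen B b) \<oplus>\<^bsub>FB\<^esub> (b \<odot>\<^bsub>FB\<^esub> free_gen B a)) | a b.
         a \<in> carrier B \<and> b \<in> carrier B}
    \<union> {free_gen B (c \<odot> \<one>) | c. c \<in> carrier (ground :: 'k ring)}"
    using assms unfolding kaehler_rels_def Let_def .
  then consider a b where "a \<in> carrier B" "b \<in> carrier B"
      "r = free_gen B (a \<oplus> b) \<ominus>\<^bsub>FB\<^esub> (free_gen B a \<oplus>\<^bsub>FB\<^esub> free_gen B b)"
    | a b where "a \<in> carrier B" "b \<in> carrier B"
      "r = free_gen B (a \<otimes> b) \<ominus>\<^bsub>FB\<^esub> ((a \<odot>\<^bsub>FB\<^esub> free_gen B b) \<oplus>\<^bsub>FB\<^esub> (b \<odot>\<^bsub>FB\<^esub> free_gen B a))"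
    | c where "r = free_gen B (c \<odot> \<one>)"
    by (elim UnE CollectE exE conjE) blast+
  then show ?thesis
  proof cases
    case (1 a b)
    let ?p = "rep (a \<oplus> b) - (rep a + rep b)"
    have "gr (free_gen B a \<oplus>\<^bsub>FB\<^esub> free_gen B b) - (gr (free_gen B a) + gr (free_gen B b)) \<in> vrel n I"
      using gr_add[of "free_gen B a" "free_gen B b"] 1 by (simp add: free_module_simps free_gen_closed)
    moreover have "gr (free_gen B a) + gr (free_gen B b) - (grad (rep a) + grad (rep b)) \<in> vrel n I"
      using 1 by (intro vrel_cong_add gr_gen)
    ultimately have "gr (free_gen B a \<oplus>\<^bsub>FB\<^esub> free_gen B b) - (grad (rep a) + grad (rep b)) \<in> vrel n I"
      by (rule vrel_cong_trans)
    with gr_gen[of "a \<oplus> b"]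
    have "gr (free_gen B (a \<oplus> b)) - gr (free_gen B a \<oplus>\<^bsub>FB\<^esub> free_gen B b) -
       (grad (rep (a \<oplus> b)) - (grad (rep a) + grad (rep b))) \<in> vrel n I"
      using 1 by (intro vrel_cong_diff) auto
    moreover have "gr r - (gr (free_gen B (a \<oplus> b)) - gr (free_gen B a \<oplus>\<^bsub>FB\<^esub> free_gen B b)) \<in> vrel n I"
      unfolding 1(3) using 1 by (intro gr_minus) (auto intro!: free_gen_closed)
    ultimately have "gr r - grad ?p \<in> vrel n I"
      unfolding grad_simps by (metis (no_types) vrel_cong_trans)
    moreover have "?p \<in> I"
      using 1 by (intro diff_in_I) (auto simp: rep \<pi>_add intro!: pcarrier_add)
    ultimately show ?thesis using grad_vrel vrel_cong_mem by blast
  next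
    case (2 a b)
    let ?u = "a \<odot>\<^bsub>FB\<^esub> free_gen B b" and ?w = "b \<odot>\<^bsub>FB\<^esub> free_gen B a"
    let ?p = "rep (a \<otimes> b) - rep a * rep b"
    have uw: "?u \<in> carrier FB" "?w \<in> carrier FB" using 2 by (auto intro: free_gen_closed)
    have *: "gr (a \<odot>\<^bsub>FB\<^esub> free_gen B b) - scal (rep a) (grad (rep b)) \<in> vrel n I"
      if "a \<in> carrier B" "b \<in> carrier B" for a b
    proof -
      have "gr (a \<odot>\<^bsub>FB\<^esub> free_gen B b) - scal (rep a) (gr (free_gen B b)) \<in> vrel n I"
        using gr_smult[of a "free_gen B b"] that by (simp add: free_module_simps free_gen_closed)
      moreover have "scal (rep a) (gr (free_gen B b)) - scal (rep a) (grad (rep b)) \<in> vrel n I"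
        using that by (intro vrel_cong_scal gr_gen rep)
      ultimately show ?thesis by (rule vrel_cong_trans)
    qed
    have "gr (?u \<oplus>\<^bsub>FB\<^esub> ?w) - (gr ?u + gr ?w) \<in> vrel n I"
      using gr_add[OF uw] by (simp add: free_module_simps)
    moreover have "gr ?u + gr ?w - (scal (rep a) (grad (rep b)) + scal (rep b) (grad (rep a))) \<in> vrel n I"
      using 2 by (intro vrel_cong_add *)
    ultimately have "gr (?u \<oplus>\<^bsub>FB\<^esub> ?w) - (scal (rep a) (grad (rep b)) + scal (rep b) (grad (rep a))) \<in> vrel n I"
      by (rule vrel_cong_trans)
    with gr_gen[of "a \<otimes> b"]
    have "gr (free_gen B (a \<otimes> b)) - gr (?u \<oplus>\<^bsub>FB\<^esub> ?w) -
       (grad (rep (a \<otimes> b)) - (scal (rep a) (grad (rep b)) + scal (rep b) (grad (rep a)))) \<in> vrel n I"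
      using 2 by (intro vrel_cong_diff) auto
    moreover have "gr r - (gr (free_gen B (a \<otimes> b)) - gr (?u \<oplus>\<^bsub>FB\<^esub> ?w)) \<in> vrel n I"
      unfolding 2(3) using 2 uw by (intro gr_minus) (auto intro!: free_gen_closed)
    ultimately have "gr r - grad ?p \<in> vrel n I"
      unfolding grad_simps by (metis (no_types) vrel_cong_trans)
    moreover have "?p \<in> I"
      using 2 by (intro diff_in_I) (auto simp: rep \<pi>_mult intro!: pcarrier_mult)
    ultimately show ?thesis using grad_vrel vrel_cong_mem by blast
  next
    case (3 c)
    have c: "c \<odot> \<one> \<in> carrier B" by (simp add: \<pi>_smult)
    have "gr r - grad (rep (c \<odot> \<one>)) \<in> vrel n I" unfolding 3 by (rule gr_gen[OF c])
    moreover have "rep (c \<odot> \<one>) - single 0 c \<in> I"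
      using rep[OF c] by (intro diff_in_I) (auto simp: \<pi>_smult)
    then have "grad (rep (c \<odot> \<one>) - single 0 c) \<in> vrel n I" by (rule grad_vrel)
    then have "grad (rep (c \<odot> \<one>)) \<in> vrel n I" by (simp add: grad_simps)
    ultimately show ?thesis by (rule vrel_cong_mem)
  qed
qed

lemma gr_kaehler_kernel:
  assumes "f \<in> kaehler_kernel (ground :: 'k ring) B"
  shows "gr f \<in> vrel n I"
  unfolding gr_def vrel_def
proof (rule lift_kernel[where h = "\<lambda>b. grad (rep b)" and Y = "carrier B"])
  show "f \<in> FB.span (kaehler_rels (ground :: 'k ring) B)"
    using assms by (simp add: kaehler_kernel_def)
  show "lift (\<lambda>b. grad (rep b)) r \<in> pspan n (vrel_gens n I)"
    if "r \<in> kaehler_rels (ground :: 'k ring) B" for r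
    using gr_kaehler_rels[OF that] by (simp add: gr_def vrel_def)
qed (rule gr_hG kaehler_rels_closed; assumption)+

text \<open>\<open>gr\<close> on a chosen representative of the coset; by \<open>coord_cls\<close>
  another representative changes the result only within \<open>vrel\<close>.\<close>

definition "coord x = gr (SOME f. f \<in> carrier FB \<and> KB.cls f = x)"

lemma coord_ex:
  assumes "x \<in> carrier \<Omega>1"
  obtains f where "f \<in> carrier FB" "KB.cls f = x" "coord x = gr f"
proof -
  have "\<exists>f. f \<in> carrier FB \<and> KB.cls f = x"
    using assms by (auto simp: kaehler_quot KB.carrier_quot)
  from someI_ex[OF this] show ?thesis using that unfolding coord_def by blast
qed

lemma coord_vmod: "x \<in> carrier \<Omega>1 \<Longrightarrow> coord x \<in> vmod n"
  by (metis coord_ex gr_vmod)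

lemma coord_cls:
  assumes f: "f \<in> carrier FB"
  shows "coord (KB.cls f) - gr f \<in> vrel n I"
proof -
  have "KB.cls f \<in> carrier \<Omega>1" using f by (auto simp: kaehler_quot KB.carrier_quot)
  then obtain g where g: "g \<in> carrier FB" "KB.cls g = KB.cls f" "coord (KB.cls f) = gr g"
    by (rule coord_ex)
  then have 1: "gr (g \<ominus>\<^bsub>FB\<^esub> f) \<in> vrel n I"
    using f KB.cls_eq_iff by (intro gr_kaehler_kernel) blast
  have 2: "gr g - gr f - gr (g \<ominus>\<^bsub>FB\<^esub> f) \<in> vrel n I"
    using g f by (intro vrel_cong_sym[OF gr_minus])
  show ?thesis unfolding g(3) by (rule vrel_cong_mem[OF 2 1])
qed

lemma coord_add:
  assumes x: "x \<in> carrier \<Omega>1" and y: "y \<in> carrier \<Omega>1"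
  shows "coord (x \<oplus>\<^bsub>\<Omega>1\<^esub> y) - (coord x + coord y) \<in> vrel n I"
proof -
  obtain f where f: "f \<in> carrier FB" "KB.cls f = x" "coord x = gr f" using x by (rule coord_ex)
  obtain g where g: "g \<in> carrier FB" "KB.cls g = y" "coord y = gr g" using y by (rule coord_ex)
  have "x \<oplus>\<^bsub>\<Omega>1\<^esub> y = KB.cls (f \<oplus>\<^bsub>FB\<^esub> g)"
    using f g by (auto simp: kaehler_quot KB.add_quot)
  then have "coord (x \<oplus>\<^bsub>\<Omega>1\<^esub> y) - gr (f \<oplus>\<^bsub>FB\<^esub> g) \<in> vrel n I"
    using f g by (simp add: coord_cls)
  moreover have "gr (f \<oplus>\<^bsub>FB\<^esub> g) - (gr f + gr g) \<in> vrel n I"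
    using gr_add[OF f(1) g(1)] by (simp add: free_module_simps)
  ultimately show ?thesis unfolding f(3) g(3) by (rule vrel_cong_trans)
qed

lemma coord_smult:
  assumes b: "b \<in> carrier B" and x: "x \<in> carrier \<Omega>1"
  shows "coord (b \<odot>\<^bsub>\<Omega>1\<^esub> x) - scal (rep b) (coord x) \<in> vrel n I"
proof -
  obtain f where f: "f \<in> carrier FB" "KB.cls f = x" "coord x = gr f" using x by (rule coord_ex)
  have "b \<odot>\<^bsub>\<Omega>1\<^esub> x = KB.cls (b \<odot>\<^bsub>FB\<^esub> f)"
    using f b by (auto simp: kaehler_quot KB.smult_quot)
  then have "coord (b \<odot>\<^bsub>\<Omega>1\<^esub> x) - gr (b \<odot>\<^bsub>FB\<^esub> f) \<in> vrel n I"
    using f b by (simp add: coord_cls)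
  moreover have "gr (b \<odot>\<^bsub>FB\<^esub> f) - scal (rep b) (gr f) \<in> vrel n I"
    using gr_smult[OF b f(1)] by (simp add: free_module_simps)
  ultimately show ?thesis unfolding f(3) by (rule vrel_cong_trans)
qed

lemma coord_dx:
  assumes j: "j < n"
  shows "coord (dx j) - unit j \<in> vrel n I"
proof -
  have b: "\<pi> (polyvar j) \<in> carrier B" using j by (intro \<pi>_closed pcarrier_polyvar)
  have "coord (dx j) - gr (free_gen B (\<pi> (polyvar j))) \<in> vrel n I"
    unfolding univ_deriv_cls using b by (intro coord_cls free_gen_closed)
  moreover have "gr (free_gen B (\<pi> (polyvar j))) - grad (rep (\<pi> (polyvar j))) \<in> vrel n I"
    using b by (rule gr_gen)
  moreover have "rep (\<pi> (polyvar j)) - polyvar j \<in> I"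
    using j by (intro diff_in_I rep b pcarrier_polyvar)
  then have "grad (rep (\<pi> (polyvar j)) - polyvar j) \<in> vrel n I" by (rule grad_vrel)
  then have "grad (rep (\<pi> (polyvar j))) - unit j \<in> vrel n I" by (simp add: grad_simps)
  ultimately show ?thesis by (metis (no_types) vrel_cong_trans)
qed

subsubsection \<open>Coordinates of a form, modulo \<open>frel\<close>\<close>

lemmas frel_cong_trans = pspan_cong_trans[where G = "frel_gens n I m" and n = n for m, folded frel_def]
lemmas frel_cong_sym = pspan_cong_sym[where G = "frel_gens n I m" and n = n for m, folded frel_def]
lemmas frel_cong_add = pspan_cong_add[where G = "frel_gens n I m" and n = n for m, folded frel_def]
lemmas frel_cong_diff = pspan_cong_diff[where G = "frel_gens n I m" and n = n for m, folded frel_def]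
lemmas frel_cong_scal = pspan_cong_scal[where G = "frel_gens n I m" and n = n for m, folded frel_def]
lemmas frel_cong_mem = pspan_cong_mem[where G = "frel_gens n I m" and n = n for m, folded frel_def]
lemmas frel_zero = pspan_zero[where G = "frel_gens n I m" and n = n for m, folded frel_def]

text \<open>The difference of two products is telescoped: first the tails are exchanged behind the
  old head, then the heads in front of the new tail.\<close>

lemma wedge_list_cong:
  "list_all2 (\<lambda>u u'. u \<in> vmod n \<and> u' \<in> vmod n \<and> u - u' \<in> vrel n I) us us' \<Longrightarrow>
    wedge_list us - wedge_list us' \<in> frel n I (length us)"
proof (induction rule: list_all2_induct)
  case Nil
  show ?case by (simp add: frel_zero)
next
  case (Cons u us u' us')
  have "set us' \<subseteq> vmod n"
    using Cons.hyps by (auto simp: list_all2_conv_all_nth in_set_conv_nth)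
  then have "wedge_list us' \<in> fmod n (length us)"
    using wedge_list_fmod list_all2_lengthD[OF Cons.hyps(2)] by metis
  then have "wedge (u - u') (wedge_list us') \<in> frel n I (Suc (length us))"
    using Cons by (intro wedge_vrel I_pcarrier) auto
  moreover have "wedge u (wedge_list us - wedge_list us') \<in> frel n I (Suc (length us))"
    using Cons by (intro wedge_frel I_pcarrier) auto
  ultimately have "wedge u (wedge_list us - wedge_list us') + wedge (u - u') (wedge_list us')
      \<in> frel n I (Suc (length us))"
    unfolding frel_def by (intro pspan_add)
  then show ?case by (simp add: wedge_simps)
qed

definition "WL xs = wedge_list (map coord xs)"

lemma WL_fmod: "xs \<in> tuples \<Omega>1 m \<Longrightarrow> WL xs \<in> fmod n m"
  using wedge_list_fmod[of "map coord xs" n] unfolding WL_def tuples_iff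
  by (auto intro!: coord_vmod)

lemma WL_hG: "a \<in> I \<Longrightarrow> xs \<in> tuples \<Omega>1 m \<Longrightarrow> scal a (WL xs) \<in> pspan n (frel_gens n I m)"
  by (rule pspan_gen) (use WL_fmod in blast)

lemma coord_update_cong:
  assumes xs: "xs \<in> tuples \<Omega>1 m" and j: "j < m" and u: "u \<in> vmod n" and u': "u' \<in> vmod n"
    and c: "u - u' \<in> vrel n I"
  shows "wedge_list ((map coord xs)[j := u]) - wedge_list ((map coord xs)[j := u']) \<in> frel n I m"
proof -
  have "xs ! i \<in> carrier \<Omega>1" if "i < m" for i
    using xs that nth_mem[of i xs] unfolding tuples_iff by blast
  then have l: "length xs = m" "\<And>i. i < m \<Longrightarrow> coord (xs ! i) \<in> vmod n"
    using xs by (auto simp: tuples_iff intro!: coord_vmod)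
  have "list_all2 (\<lambda>u u'. u \<in> vmod n \<and> u' \<in> vmod n \<and> u - u' \<in> vrel n I)
      ((map coord xs)[j := u]) ((map coord xs)[j := u'])"
    unfolding list_all2_conv_all_nth
  proof (intro conjI allI impI)
    fix i assume i: "i < length ((map coord xs)[j := u])"
    show "(map coord xs)[j := u] ! i \<in> vmod n" "(map coord xs)[j := u'] ! i \<in> vmod n"
      "(map coord xs)[j := u] ! i - (map coord xs)[j := u'] ! i \<in> vrel n I"
      using i l u u' c j pspan_zero by (auto simp: nth_list_update vrel_def)
  qed simp
  from wedge_list_cong[OF this] l show ?thesis by simp
qed

lemma WL_update_add:
  assumes "xs \<in> tuples \<Omega>1 m" "j < m" "x \<in> carrier \<Omega>1" "y \<in> carrier \<Omega>1"
  shows "WL (xs[j := x \<oplus>\<^bsub>\<Omega>1\<^esub> y]) - (WL (xs[j := x]) + WL (xs[j := y])) \<in> frel n I m"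
proof -
  have "j < length (map coord xs)" using assms by (simp add: tuples_iff)
  moreover have "wedge_list ((map coord xs)[j := coord (x \<oplus>\<^bsub>\<Omega>1\<^esub> y)]) -
      wedge_list ((map coord xs)[j := coord x + coord y]) \<in> frel n I m"
    using assms by (intro coord_update_cong coord_add coord_vmod vmod_add) auto
  ultimately show ?thesis
    by (simp add: WL_def map_update wedge_list_update_add)
qed

lemma WL_update_smult:
  assumes "xs \<in> tuples \<Omega>1 m" "j < m" "b \<in> carrier B" "x \<in> carrier \<Omega>1"
  shows "WL (xs[j := b \<odot>\<^bsub>\<Omega>1\<^esub> x]) - scal (rep b) (WL (xs[j := x])) \<in> frel n I m"
proof -
  have "j < length (map coord xs)" using assms by (simp add: tuples_iff)
  moreover have "wedge_list ((map coord xs)[j := coord (b \<odot>\<^bsub>\<Omega>1\<^esub> x)]) -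
      wedge_list ((map coord xs)[j := scal (rep b) (coord x)]) \<in> frel n I m"
    using assms by (intro coord_update_cong coord_smult coord_vmod vmod_scal rep) auto
  ultimately show ?thesis
    by (simp add: WL_def map_update wedge_list_update_scal)
qed

text \<open>Equal entries receive the same chosen coordinates, so the alternating relation holds
  exactly and not merely modulo \<open>frel\<close>.\<close>

lemma WL_alt:
  "xs \<in> tuples \<Omega>1 m \<Longrightarrow> i < j \<Longrightarrow> j < m \<Longrightarrow> xs ! i = xs ! j \<Longrightarrow> WL xs = 0"
  unfolding WL_def by (rule wedge_list_repeated[of i j]) (auto simp: tuples_iff)

text \<open>The map back: on a tuple of differentials it is the wedge product of their coordinates.
  Modulo \<open>frel\<close> it inverts \<open>\<Psi>\<close>.\<close>

definition "\<Phi> = lift WL"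

lemma \<Phi>_add:
  "f \<in> carrier (X.F m) \<Longrightarrow> g \<in> carrier (X.F m) \<Longrightarrow> \<Phi> (\<lambda>x. f x \<oplus> g x) - (\<Phi> f + \<Phi> g) \<in> frel n I m"
  unfolding \<Phi>_def frel_def by (rule lift_add[where h = WL and Y = "tuples \<Omega>1 m"]) (rule WL_hG)

lemma \<Phi>_smult:
  "b \<in> carrier B \<Longrightarrow> f \<in> carrier (X.F m) \<Longrightarrow> \<Phi> (\<lambda>x. b \<otimes> f x) - scal (rep b) (\<Phi> f) \<in> frel n I m"
  unfolding \<Phi>_def frel_def by (rule lift_smult[where h = WL and Y = "tuples \<Omega>1 m"]) (rule WL_hG)

lemma \<Phi>_minus:
  "f \<in> carrier (X.F m) \<Longrightarrow> g \<in> carrier (X.F m) \<Longrightarrow> \<Phi> (f \<ominus>\<^bsub>X.F m\<^esub> g) - (\<Phi> f - \<Phi> g) \<in> frel n I m"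
  unfolding \<Phi>_def frel_def by (rule lift_minus[where h = WL and Y = "tuples \<Omega>1 m"]) (rule WL_hG)

lemma \<Phi>_gen: "xs \<in> tuples \<Omega>1 m \<Longrightarrow> \<Phi> (free_gen B xs) - WL xs \<in> frel n I m"
  unfolding \<Phi>_def frel_def by (rule lift_gen[where h = WL and Y = "tuples \<Omega>1 m"]) (rule WL_hG)

text \<open>The multilinear relations hold modulo \<open>frel\<close> because \<open>coord\<close>
  is linear modulo \<open>vrel\<close> in every slot.\<close>

lemma \<Phi>_ext_rels:
  assumes "r \<in> ext_rels B \<Omega>1 m"
  shows "\<Phi> r \<in> frel n I m"
  using assms
proof (cases rule: X.ext_rels_cases)
  case (add xs j x y)
  let ?e = "\<lambda>z. free_gen B (xs[j := z])"
  have t: "xs[j := x \<oplus>\<^bsub>\<Omega>1\<^esub> y] \<in> tuples \<Omega>1 m" "xs[j := x] \<in> tuples \<Omega>1 m" "xs[j := y] \<in> tuples \<Omega>1 m"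
    using add by (auto intro!: tuples_list_update)
  note e = t[THEN free_gen_closed]
  have "\<Phi> (?e x \<oplus>\<^bsub>X.F m\<^esub> ?e y) - (\<Phi> (?e x) + \<Phi> (?e y)) \<in> frel n I m"
    using \<Phi>_add[OF e(2,3)] by (simp add: free_module_simps)
  from frel_cong_trans[OF this frel_cong_add[OF \<Phi>_gen[OF t(2)] \<Phi>_gen[OF t(3)]]]
  have "\<Phi> (?e (x \<oplus>\<^bsub>\<Omega>1\<^esub> y)) - \<Phi> (?e x \<oplus>\<^bsub>X.F m\<^esub> ?e y) -
     (WL (xs[j := x \<oplus>\<^bsub>\<Omega>1\<^esub> y]) - (WL (xs[j := x]) + WL (xs[j := y]))) \<in> frel n I m"
    by (rule frel_cong_diff[OF \<Phi>_gen[OF t(1)]])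
  moreover have "\<Phi> r - (\<Phi> (?e (x \<oplus>\<^bsub>\<Omega>1\<^esub> y)) - \<Phi> (?e x \<oplus>\<^bsub>X.F m\<^esub> ?e y)) \<in> frel n I m"
    unfolding add(5) using e by (intro \<Phi>_minus) auto
  ultimately have "\<Phi> r - (WL (xs[j := x \<oplus>\<^bsub>\<Omega>1\<^esub> y]) - (WL (xs[j := x]) + WL (xs[j := y]))) \<in> frel n I m"
    by (metis (no_types) frel_cong_trans)
  then show ?thesis
    by (rule frel_cong_mem) (rule WL_update_add[OF add(1-4)])
next
  case (smult xs j b x)
  let ?e = "\<lambda>z. free_gen B (xs[j := z])"
  have t: "xs[j := b \<odot>\<^bsub>\<Omega>1\<^esub> x] \<in> tuples \<Omega>1 m" "xs[j := x] \<in> tuples \<Omega>1 m"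
    using smult by (auto intro!: tuples_list_update)
  note e = t[THEN free_gen_closed]
  have "\<Phi> (b \<odot>\<^bsub>X.F m\<^esub> ?e x) - scal (rep b) (\<Phi> (?e x)) \<in> frel n I m"
    using \<Phi>_smult[OF smult(3) e(2)] by (simp add: free_module_simps)
  from frel_cong_trans[OF this frel_cong_scal[OF rep(1)[OF smult(3)] \<Phi>_gen[OF t(2)]]]
  have "\<Phi> (?e (b \<odot>\<^bsub>\<Omega>1\<^esub> x)) - \<Phi> (b \<odot>\<^bsub>X.F m\<^esub> ?e x) -
     (WL (xs[j := b \<odot>\<^bsub>\<Omega>1\<^esub> x]) - scal (rep b) (WL (xs[j := x]))) \<in> frel n I m"
    by (rule frel_cong_diff[OF \<Phi>_gen[OF t(1)]])
  moreover have "\<Phi> r - (\<Phi> (?e (b \<odot>\<^bsub>\<Omega>1\<^esub> x)) - \<Phi> (b \<odot>\<^bsub>X.F m\<^esub> ?e x)) \<in> frel n I m"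
    unfolding smult(5) using e smult by (intro \<Phi>_minus) auto
  ultimately have "\<Phi> r - (WL (xs[j := b \<odot>\<^bsub>\<Omega>1\<^esub> x]) - scal (rep b) (WL (xs[j := x]))) \<in> frel n I m"
    by (metis (no_types) frel_cong_trans)
  then show ?thesis
    by (rule frel_cong_mem) (rule WL_update_smult[OF smult(1-4)])
next
  case (alt xs i j)
  then show ?thesis
    using \<Phi>_gen[OF alt(1)] WL_alt[OF alt(1-4)] by simp
qed

lemma \<Phi>_ext_kernel:
  assumes "f \<in> ext_kernel B \<Omega>1 m"
  shows "\<Phi> f \<in> frel n I m"
  unfolding \<Phi>_def frel_def
proof (rule lift_kernel[where h = WL and Y = "tuples \<Omega>1 m"])
  show "f \<in> X.F.span m (ext_rels B \<Omega>1 m)"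
    using assms by (simp add: ext_kernel_def)
  show "lift WL r \<in> pspan n (frel_gens n I m)" if "r \<in> ext_rels B \<Omega>1 m" for r
    using \<Phi>_ext_rels[OF that] by (simp add: \<Phi>_def frel_def)
qed (rule WL_hG X.ext_rels_closed; assumption)+

text \<open>Each \<open>coord (dx j)\<close> is congruent to a unit vector, and an increasing
  product of unit vectors is a basis element without sign.\<close>

lemma \<Phi>_dX:
  assumes J: "J \<subseteq> {..<n}" "card J = m"
  shows "\<Phi> (free_gen B (map dx (sorted_list_of_set J))) - unit J \<in> frel n I m"
proof -
  let ?js = "sorted_list_of_set J"
  have js: "set ?js = J" "length ?js = m" "sorted_wrt (<) ?js"
    using J finite_subsetD by auto
  have t: "map dx ?js \<in> tuples \<Omega>1 m"
    using js J by (auto simp: tuples_iff intro!: dx_closed)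
  have "list_all2 (\<lambda>u u'. u \<in> vmod n \<and> u' \<in> vmod n \<and> u - u' \<in> vrel n I)
     (map coord (map dx ?js)) (map unit ?js)"
    unfolding list_all2_conv_all_nth
  proof (intro conjI allI impI)
    fix i assume "i < length (map coord (map dx ?js))"
    then have i: "i < length ?js" by simp
    then have "?js ! i \<in> J" using js(1) nth_mem by blast
    then have "?js ! i < n" using J by auto
    then show "map coord (map dx ?js) ! i \<in> vmod n" "map unit ?js ! i \<in> vmod n"
      "map coord (map dx ?js) ! i - map unit ?js ! i \<in> vrel n I"
      using i by (auto simp: coord_dx intro!: coord_vmod dx_closed unit_vmod)
  qed simp
  from wedge_list_cong[OF this] have "WL (map dx ?js) - wedge_list (map unit ?js) \<in> frel n I m"
    using js(2) by (simp add: WL_def del: map_map sorted_list_of_set.length_sorted_key_list_of_set)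
  then have "WL (map dx ?js) - unit J \<in> frel n I m"
    unfolding wedge_list_units[OF js(3)] js(1) .
  with \<Phi>_gen[OF t] show ?thesis by (metis (no_types) frel_cong_trans)
qed

text \<open>\<Phi> after \<Psi> is the identity modulo \<open>frel\<close>. Since
  \<open>\<Phi>\<close> lives on the free module and not on its quotient, this is expressed by a
  suitable representative \<open>f\<close> of \<open>\<Psi> m w\<close>.\<close>

lemma \<Psi>_representative:
  assumes w: "w \<in> fmod n m"
  shows "\<exists>f\<in>carrier (X.F m). X.E.cls m f = \<Psi> m w \<and> \<Phi> f - w \<in> frel n I m"
  using w
proof (rule fmod_induct[where P = "\<lambda>w. \<exists>f\<in>carrier (X.F m). X.E.cls m f = \<Psi> m w \<and> \<Phi> f - w \<in> frel n I m"])
  have "X.E.cls m \<zero>\<^bsub>X.F m\<^esub> = \<Psi> m 0"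
    using X.E.cls_eq_zero_iff[of "\<zero>\<^bsub>X.F m\<^esub>" m] X.E.N.zero_closed[of m] X.F.M.zero_closed[of m]
    unfolding \<Psi>_zero X.ext_power_quot X.E.zero_quot by blast
  moreover have "\<Phi> \<zero>\<^bsub>X.F m\<^esub> - 0 \<in> frel n I m"
    by (simp add: \<Phi>_def lift_def free_module_simps frel_zero)
  ultimately show "\<exists>f\<in>carrier (X.F m). X.E.cls m f = \<Psi> m 0 \<and> \<Phi> f - 0 \<in> frel n I m"
    using X.F.M.zero_closed[of m] by blast
next
  fix J assume J: "J \<subseteq> {..<n}" "card J = m"
  let ?xs = "map dx (sorted_list_of_set J)"
  have t: "?xs \<in> tuples \<Omega>1 m"
    using J finite_subsetD[OF J(1)] by (auto simp: tuples_iff intro!: dx_closed)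
  then have "X.E.cls m (free_gen B ?xs) = \<Psi> m (unit J)"
    unfolding \<Psi>_unit[OF J] dX_def by (intro X.ext_prod_cls[symmetric]) (simp add: tuples_iff)
  with \<Phi>_dX[OF J] free_gen_closed[OF t]
  show "\<exists>f\<in>carrier (X.F m). X.E.cls m f = \<Psi> m (unit J) \<and> \<Phi> f - unit J \<in> frel n I m" by blast
next
  fix w w' :: "'k form" assume w: "w \<in> fmod n m" "w' \<in> fmod n m"
  assume "\<exists>f\<in>carrier (X.F m). X.E.cls m f = \<Psi> m w \<and> \<Phi> f - w \<in> frel n I m"
  then obtain f where f: "f \<in> carrier (X.F m)" "X.E.cls m f = \<Psi> m w" "\<Phi> f - w \<in> frel n I m" by blast
  assume "\<exists>f\<in>carrier (X.F m). X.E.cls m f = \<Psi> m w' \<and> \<Phi> f - w' \<in> frel n I m"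
  then obtain g where g: "g \<in> carrier (X.F m)" "X.E.cls m g = \<Psi> m w'" "\<Phi> g - w' \<in> frel n I m" by blast
  have "X.E.cls m (f \<oplus>\<^bsub>X.F m\<^esub> g) = \<Psi> m (w + w')"
    using f g w by (simp add: \<Psi>_add X.ext_power_quot flip: X.E.add_quot)
  moreover have "\<Phi> (f \<oplus>\<^bsub>X.F m\<^esub> g) - (w + w') \<in> frel n I m"
    using frel_cong_trans[OF \<Phi>_add[OF f(1) g(1)] frel_cong_add[OF f(3) g(3)]]
    by (simp add: free_module_simps)
  ultimately show "\<exists>f\<in>carrier (X.F m). X.E.cls m f = \<Psi> m (w + w') \<and> \<Phi> f - (w + w') \<in> frel n I m"
    using X.F.M.a_closed[OF f(1) g(1)] by blast
next
  fix p :: "'k mpoly" and w :: "'k form" assume p: "p \<in> pcarrier n" and w: "w \<in> fmod n m"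
  assume "\<exists>f\<in>carrier (X.F m). X.E.cls m f = \<Psi> m w \<and> \<Phi> f - w \<in> frel n I m"
  then obtain f where f: "f \<in> carrier (X.F m)" "X.E.cls m f = \<Psi> m w" "\<Phi> f - w \<in> frel n I m" by blast
  have b: "\<pi> p \<in> carrier B" using p by simp
  have "X.E.cls m (\<pi> p \<odot>\<^bsub>X.F m\<^esub> f) = \<Psi> m (scal p w)"
    using f w p by (simp add: \<Psi>_scal X.ext_power_quot flip: X.E.smult_quot)
  moreover have "rep (\<pi> p) - p \<in> I" using p rep[OF b] by (intro diff_in_I) auto
  then have "scal (rep (\<pi> p) - p) w \<in> frel n I m"
    unfolding frel_def using w by (intro pspan_gen) blast
  then have "scal (rep (\<pi> p)) w - scal p w \<in> frel n I m" by (simp add: scal_simps)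
  from frel_cong_trans[OF \<Phi>_smult[OF b f(1)] frel_cong_trans[OF frel_cong_scal[OF rep(1)[OF b] f(3)] this]]
  have "\<Phi> (\<pi> p \<odot>\<^bsub>X.F m\<^esub> f) - scal p w \<in> frel n I m"
    by (simp add: free_module_simps)
  ultimately show "\<exists>f\<in>carrier (X.F m). X.E.cls m f = \<Psi> m (scal p w) \<and> \<Phi> f - scal p w \<in> frel n I m"
    using X.F.smult_closed[OF b f(1)] by blast
qed

text \<open>If \<open>\<Psi> m w\<close> is 0, its representative \<open>f\<close> is a combination
  of relations, so \<open>\<Phi> f\<close> lies in \<open>frel\<close>, and \<open>w\<close> is
  congruent to \<open>\<Phi> f\<close>.\<close>

theorem \<Psi>_eq_zero_iff:
  assumes w: "w \<in> fmod n m"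
  shows "\<Psi> m w = \<zero>\<^bsub>X.\<Lambda> m\<^esub> \<longleftrightarrow> w \<in> frel n I m"
proof
  assume 0: "\<Psi> m w = \<zero>\<^bsub>X.\<Lambda> m\<^esub>"
  obtain f where f: "f \<in> carrier (X.F m)" "X.E.cls m f = \<Psi> m w" "\<Phi> f - w \<in> frel n I m"
    using \<Psi>_representative[OF w] by blast
  have "f \<in> ext_kernel B \<Omega>1 m"
    using f(1,2) 0 X.E.cls_eq_zero_iff[of f m] by (simp add: X.ext_power_quot X.E.zero_quot)
  then have "\<Phi> f \<in> frel n I m" by (rule \<Phi>_ext_kernel)
  with frel_cong_sym[OF f(3)] show "w \<in> frel n I m" by (rule frel_cong_mem)
qed (rule \<Psi>_frel)

end

section \<open>Dimension of the space of homogeneous forms\<close>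

text \<open>A coefficient of degree d sits in form degree d + m. The equation is between integers
  because \<open>i\<close> may be smaller than \<open>m\<close>, and then only 0 remains.\<close>

definition fhom :: "nat \<Rightarrow> nat \<Rightarrow> int \<Rightarrow> ('k::field form) set" where
  "fhom n m i = {w \<in> fmod n m. \<forall>J. \<forall>t\<in>keys (w J). int (mdeg t) + int m = i}"

definition form_space :: "('k::field form) set \<Rightarrow> ('k, 'k form) module" where
  "form_space W =
    \<lparr> carrier = W, monoid.mult = undefined, monoid.one = undefined, ring.zero = 0, add = (+),
      module.smult = (\<lambda>c w. scal (single 0 c) w) \<rparr>"

lemma form_space_simps [simp]:
  "carrier (form_space W) = W" "\<zero>\<^bsub>form_space W\<^esub> = 0" "v \<oplus>\<^bsub>form_space W\<^esub> w = v + w"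
  "c \<odot>\<^bsub>form_space W\<^esub> w = scal (single 0 c) w"
  by (simp_all add: form_space_def)

lemma form_space_carrier_update [simp]: "(form_space W)\<lparr>carrier := W'\<rparr> = form_space W'"
  by (simp add: form_space_def)

text \<open>Closure under constants is enough to make \<open>form_space W\<close> a vector space,
  negatives coming from the scalar -1. Homogeneous forms are not closed under all polynomial
  multiples.\<close>

definition const_closed :: "('k::field form) set \<Rightarrow> bool" where
  "const_closed W \<longleftrightarrow> 0 \<in> W \<and> (\<forall>v\<in>W. \<forall>w\<in>W. v + w \<in> W) \<and>
     (\<forall>c. \<forall>w\<in>W. scal (single 0 c) w \<in> W)"

lemma cring_ground: "cring (ground :: 'k::field ring)"
  by (rule class_cring.cring_axioms)

lemma field_ground: "Ring.field (ground :: 'k::field ring)"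
  by (rule class_field.field_axioms)

lemma const_minus_one: "single 0 (-1 :: 'k::field) = (-1 :: 'k mpoly)"
  by (simp add: single_uminus)

lemma vectorspace_form_space:
  fixes W :: "('k::field form) set"
  assumes "const_closed W"
  shows "vectorspace ground (form_space W)"
proof -
  have neg: "- w \<in> W" if "w \<in> W" for w
  proof -
    have "scal (single 0 (-1)) w \<in> W" using that assms by (auto simp: const_closed_def)
    then show ?thesis unfolding const_minus_one by (simp add: scal_simps)
  qed
  have "Module.module ground (form_space W)"
  proof (rule module_criteria)
    show "\<forall>v\<in>carrier (form_space W). \<exists>w\<in>carrier (form_space W). v \<oplus>\<^bsub>form_space W\<^esub> w = \<zero>\<^bsub>form_space W\<^esub>"
      using neg by (auto intro: bexI[of _ "- v" for v])
    show "\<forall>a b v. a \<in> carrier ground \<and> b \<in> carrier ground \<and> v \<in> carrier (form_space W) \<longrightarrow>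
      (a \<otimes>\<^bsub>ground\<^esub> b) \<odot>\<^bsub>form_space W\<^esub> v = a \<odot>\<^bsub>form_space W\<^esub> (b \<odot>\<^bsub>form_space W\<^esub> v)"
      by (simp add: scal_simps(8)[symmetric] mult_single)
  qed (use assms in \<open>auto simp: const_closed_def cring_ground scal_simps single_add add_ac\<close>)
  then show ?thesis by (intro vectorspace.intro field_ground)
qed

lemma fhom_const_closed: "const_closed (fhom n m i)"
  unfolding const_closed_def
proof (intro conjI ballI allI)
  show "0 \<in> fhom n m i" by (simp add: fhom_def zero_fun_apply)
  show "v + w \<in> fhom n m i" if "v \<in> fhom n m i" "w \<in> fhom n m i" for v w :: "'a form"
    using that Poly_Mapping.keys_add[of "v J" "w J" for J]
    by (fastforce simp: fhom_def fmod_add plus_fun_apply)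
  show "scal (single 0 c) w \<in> fhom n m i" if "w \<in> fhom n m i" for c and w :: "'a form"
  proof -
    have "keys (scal (single 0 c) w J) \<subseteq> keys (w J)" for J
      using keys_mult[of "single 0 c" "w J"] by (cases "c = 0") (auto simp: scal_def)
    moreover have "scal (single 0 c) w \<in> fmod n m"
      using that by (intro fmod_scal) (auto simp: fhom_def)
    ultimately show ?thesis using that unfolding fhom_def by blast
  qed
qed

section \<open>Monomial basis of the homogeneous forms\<close>

definition monomials :: "nat \<Rightarrow> nat \<Rightarrow> (nat \<Rightarrow>\<^sub>0 nat) set" where
  "monomials n d = {t. keys t \<subseteq> {..<n} \<and> mdeg t = d}"

lemma mdeg_eq_sum: "keys t \<subseteq> {..<n} \<Longrightarrow> mdeg t = (\<Sum>j<n. lookup t j)"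
  unfolding mdeg_def by (rule sum.mono_neutral_left) (auto simp: in_keys_iff)

text \<open>Stars and bars, after identifying a monomial with its list of n exponents.\<close>

lemma card_monomials:
  assumes "n \<ge> 1"
  shows "card (monomials n d) = (n + d - 1) choose (n - 1)" "finite (monomials n d)"
proof -
  let ?f = "\<lambda>t. map (lookup t) [0..<n]"
  let ?L = "{l :: nat list. length l = n \<and> sum_list l = d}"
  have bij: "bij_betw ?f (monomials n d) ?L"
  proof (rule bij_betwI')
    fix s t assume st: "s \<in> monomials n d" "t \<in> monomials n d"
    show "?f s = ?f t \<longleftrightarrow> s = t"
    proof
      assume eq: "?f s = ?f t"
      show "s = t"
      proof (rule poly_mapping_eqI)
        fix j
        show "lookup s j = lookup t j"
        proof (cases "j < n")
          case True
          then show ?thesis using arg_cong[OF eq, of "\<lambda>l. l ! j"] by simp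
        next
          case False
          then have "j \<notin> keys s" "j \<notin> keys t"
            using st by (auto simp: monomials_def)
          then show ?thesis by (simp add: in_keys_iff)
        qed
      qed
    qed simp
  next
    fix t assume "t \<in> monomials n d"
    then have "keys t \<subseteq> {..<n}" "mdeg t = d" by (auto simp: monomials_def)
    then show "?f t \<in> ?L"
      using mdeg_eq_sum[of t n] by (simp add: sum_list_distinct_conv_sum_set atLeast0LessThan)
  next
    fix l assume l: "l \<in> ?L"
    define t where "t = Abs_poly_mapping (\<lambda>j. if j < n then l ! j else 0)"
    have "finite {j. (if j < n then l ! j else 0) \<noteq> 0}"
      by (rule finite_subset[of _ "{..<n}"]) auto
    then have t: "lookup t = (\<lambda>j. if j < n then l ! j else 0)"
      unfolding t_def by (rule lookup_Abs_poly_mapping)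
    have k: "keys t \<subseteq> {..<n}" by (auto simp: in_keys_iff t split: if_splits)
    have "?f t = map ((!) l) [0..<length l]" using l by (intro map_cong) (auto simp: t)
    then have f: "?f t = l" by (simp add: map_nth)
    have "mdeg t = sum_list (?f t)"
      unfolding mdeg_eq_sum[OF k] by (simp add: sum_list_distinct_conv_sum_set atLeast0LessThan)
    then have "t \<in> monomials n d" using k l f by (simp add: monomials_def)
    then show "\<exists>t\<in>monomials n d. l = ?f t" using f by metis
  qed
  have "card (monomials n d) = (d + n - 1) choose d"
    using bij_betw_same_card[OF bij] card_length_sum_list[of n d] by simp
  also have "\<dots> = (n + d - 1) choose (n - 1)"
    using binomial_symmetric[of d "d + n - 1"] assms by (simp add: add.commute)
  finally show "card (monomials n d) = (n + d - 1) choose (n - 1)" .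
  \<comment> \<open>An infinite set has cardinality 0, so a positive count proves
    finiteness.\<close>
  moreover have "(n + d - 1) choose (n - 1) > 0" using assms by simp
  ultimately show "finite (monomials n d)" by (metis card_ge_0_finite)
qed

definition fbasis :: "nat \<Rightarrow> nat \<Rightarrow> nat \<Rightarrow> ('k::field form) set" where
  "fbasis n m d = (\<lambda>(J, t). scal (single t 1) (unit J)) ` (subsets n m \<times> monomials n d)"

lemma lookup_fbasis:
  "lookup (scal (single t c) (unit J) L) s = (if J = L \<and> s = t then c else 0)"
  by (auto simp: scal_def unit_def lookup_single when_def)

lemma fbasis_inj:
  "inj (\<lambda>(J :: nat set, t :: nat \<Rightarrow>\<^sub>0 nat). scal (single t (1 :: 'k::field)) (unit J))"
proof (rule injI)
  fix x y :: "nat set \<times> (nat \<Rightarrow>\<^sub>0 nat)"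
  assume eq: "(\<lambda>(J, t). scal (single t (1 :: 'k)) (unit J)) x =
    (\<lambda>(J, t). scal (single t (1 :: 'k)) (unit J)) y"
  obtain J s L t where xy: "x = (J, s)" "y = (L, t)" by (cases x, cases y)
  have "lookup (scal (single s (1 :: 'k)) (unit J) J) s =
    lookup (scal (single t 1) (unit L) J) s"
    using eq unfolding xy prod.case by (rule arg_cong)
  then show "x = y" unfolding lookup_fbasis xy by (simp split: if_splits)
qed

lemma fbasis_card:
  assumes "n \<ge> 1"
  shows "finite (fbasis n m d :: ('k::field form) set)"
    "card (fbasis n m d :: ('k::field form) set) = (n choose m) * ((n + d - 1) choose (n - 1))"
proof -
  show "finite (fbasis n m d :: ('k::field form) set)"
    unfolding fbasis_def using finite_subsets card_monomials[OF assms] by blast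
  have "card (subsets n m) = n choose m" using n_subsets[of "{..<n}" m] by simp
  then show "card (fbasis n m d :: ('k::field form) set) = (n choose m) * ((n + d - 1) choose (n - 1))"
    unfolding fbasis_def
    by (subst card_image[OF inj_on_subset[OF fbasis_inj]])
      (simp_all add: card_cartesian_product card_monomials[OF assms])
qed

lemma fbasis_fhom: "fbasis n m d \<subseteq> fhom n m (int d + int m)"
proof
  fix w :: "'a form" assume "w \<in> fbasis n m d"
  then obtain J t where w: "w = scal (single t 1) (unit J)" "J \<in> subsets n m" "t \<in> monomials n d"
    by (auto simp: fbasis_def)
  have "w \<in> fmod n m"
    unfolding w(1) using w by (intro fmod_scal pcarrier_singleI unit_fmod) (auto simp: monomials_def)
  moreover have "mdeg s = d" if "s \<in> keys (w L)" for s L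
    using that w by (auto simp: w(1) in_keys_iff lookup_fbasis monomials_def split: if_splits)
  ultimately show "w \<in> fhom n m (int d + int m)" by (auto simp: fhom_def)
qed

lemma fhom_basis:
  assumes "n \<ge> 1"
  shows "vectorspace.basis (ground :: 'k::field ring) (form_space (fhom n m (int d + int m))) (fbasis n m d)"
proof -
  let ?V = "form_space (fhom n m (int d + int m) :: ('k form) set)"
  interpret V: vectorspace ground ?V by (rule vectorspace_form_space[OF fhom_const_closed])
  let ?B = "fbasis n m d :: ('k form) set"
  have BV: "?B \<subseteq> carrier ?V" using fbasis_fhom by simp
  \<comment> \<open>The sum of the module record becomes the ordinary sum of functions, whose
    coefficients can be read off.\<close>
  have finsum: "finsum ?V f A = sum f A" if "finite A" "f \<in> A \<rightarrow> carrier ?V" for f and A :: "('k form) set"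
    using that by (induction A rule: finite_induct) (auto simp: V.M.finsum_insert)
  have indep: "V.lin_indpt ?B"
  proof (rule V.finite_lin_indpt2[OF fbasis_card(1)[OF assms] BV])
    fix a assume "V.lincomb a ?B = \<zero>\<^bsub>?V\<^esub>"
    moreover have "V.lincomb a ?B = (\<Sum>v\<in>?B. scal (single 0 (a v)) v)"
    proof -
      have "scal (single 0 (a v)) v \<in> fhom n m (int d + int m)" if "v \<in> ?B" for v
        using subsetD[OF fbasis_fhom that] fhom_const_closed[where 'a = 'k] unfolding const_closed_def by blast
      then show ?thesis
        unfolding V.lincomb_def by (subst finsum[OF fbasis_card(1)[OF assms]]) auto
    qed
    ultimately have 0: "(\<Sum>v\<in>?B. scal (single 0 (a v)) v) = 0" by simp
    show "\<forall>v\<in>?B. a v = \<zero>\<^bsub>ground\<^esub>"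
    proof
      fix b assume "b \<in> ?B"
      then obtain J t where b: "b = scal (single t 1) (unit J)" by (auto simp: fbasis_def)
      \<comment> \<open>Reading the coefficient of the monomial \<open>t\<close> at the index
        \<open>J\<close> isolates the scalar of the basis element \<open>b\<close>.\<close>
      have "lookup (scal (single 0 (a v)) v J) t = (if v = b then a v else 0)"
        if "v \<in> ?B" for v
      proof -
        obtain L s where v: "v = scal (single s 1) (unit L)" using \<open>v \<in> ?B\<close> by (auto simp: fbasis_def)
        have "scal (single 0 (a v)) v = scal (single s (a v)) (unit L)"
          using v by (simp add: scal_simps(8)[symmetric] mult_single)
        moreover have "v = b \<longleftrightarrow> L = J \<and> t = s"
          using injD[OF fbasis_inj, of "(L, s)" "(J, t)"] v b by auto
        ultimately show ?thesis by (simp add: lookup_fbasis)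
      qed
      then have "lookup ((\<Sum>v\<in>?B. scal (single 0 (a v)) v) J) t = a b"
        using \<open>b \<in> ?B\<close>
        by (simp add: sum_fun_apply lookup_sum fbasis_card(1)[OF assms])
      then show "a b = \<zero>\<^bsub>ground\<^esub>" using 0 by (simp add: zero_fun_apply)
    qed
  qed
  have span: "LinearCombinations.submodule ground (V.span ?B) ?V" by (rule V.span_is_submodule[OF BV])
  have span_sum: "sum f X \<in> V.span ?B" if "\<And>x. x \<in> X \<Longrightarrow> f x \<in> V.span ?B"
    for X :: "'z set" and f :: "'z \<Rightarrow> 'k form"
    using that submodule.zero_closed[OF span] submodule.m_closed[OF span]
    by (induction X rule: infinite_finite_induct) auto
  have gen: "w \<in> V.span ?B" if w: "w \<in> fhom n m (int d + int m)" for w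
  proof -
    have wf: "w \<in> fmod n m" using w by (simp add: fhom_def)
    have "scal (w J) (unit J) \<in> V.span ?B" if J: "J \<in> subsets n m" for J
    proof -
      have "scal (w J) (unit J) =
          (\<Sum>t\<in>keys (w J). scal (single t (lookup (w J) t)) (unit J))"
      proof -
        have "scal (\<Sum>t\<in>T. single t (lookup (w J) t)) (unit J) =
          (\<Sum>t\<in>T. scal (single t (lookup (w J) t)) (unit J :: 'k form))" for T
          by (induction T rule: infinite_finite_induct) (auto simp: scal_simps)
        from this[of "keys (w J)"] show ?thesis by (simp add: sum_single)
      qed
      also have "\<dots> \<in> V.span ?B"
      proof (rule span_sum)
        fix t assume t: "t \<in> keys (w J)"
        let ?b = "scal (single t 1) (unit J) :: 'k form"
        have "t \<in> monomials n d"
          using t w fmodD(1)[OF wf, of J] by (auto simp: monomials_def fhom_def pcarrier_iff)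
        then have "?b \<in> ?B" using J by (auto simp: fbasis_def)
        then have "lookup (w J) t \<odot>\<^bsub>?V\<^esub> ?b \<in> V.span ?B"
          by (intro submodule.smult_closed[OF span] V.span_gen[OF BV]) auto
        then show "scal (single t (lookup (w J) t)) (unit J) \<in> V.span ?B"
          by (simp add: scal_simps(8)[symmetric] mult_single)
      qed
      finally show ?thesis .
    qed
    then have "(\<Sum>J\<in>subsets n m. scal (w J) (unit J)) \<in> V.span ?B" by (rule span_sum)
    then show ?thesis using fmod_expand[OF wf] by simp
  qed
  show ?thesis
    unfolding V.basis_def using indep BV gen V.span_is_subset2[OF BV] by auto
qed

lemma fhom_below: "i < int m \<Longrightarrow> fhom n m i = {0}"
proof -
  assume i: "i < int m"
  have "w = 0" if w: "w \<in> fhom n m i" for w :: "'a form"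
  proof
    fix J
    have "keys (w J) = {}" using w i by (force simp: fhom_def)
    then show "w J = 0 J" by (simp add: zero_fun_apply)
  qed
  then show ?thesis using fhom_const_closed[of n m i] by (auto simp: const_closed_def)
qed

lemma fhom_dim:
  fixes n m :: nat and i :: int
  assumes "n \<ge> 1"
  defines "V \<equiv> form_space (fhom n m i :: ('k::field form) set)"
  shows "vectorspace.fin_dim (ground :: 'k ring) V"
    "vectorspace.dim (ground :: 'k ring) V = (n choose m) * int_binomial (int n + i - int m - 1) (n - 1)"
proof -
  interpret V: vectorspace ground V unfolding V_def by (rule vectorspace_form_space[OF fhom_const_closed])
  have "V.fin_dim \<and> V.dim = (n choose m) * int_binomial (int n + i - int m - 1) (n - 1)"
  proof (cases "i < int m")
    case True
    have "carrier V = {\<zero>\<^bsub>V\<^esub>}" by (simp add: V_def fhom_below[OF True])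
    then have "V.basis {}"
      unfolding V.basis_def V.lin_dep_def V.span_def V.lincomb_def by auto
    then have "V.dim = 0" "V.fin_dim" using V.dim_basis[of "{}"] unfolding V.fin_dim_def V.basis_def by auto
    \<comment> \<open>The upper entry is at most n - 2, so it is either negative or a natural number
      below n - 1. For n = 1 it is negative, and the convention for negative entries
      decides.\<close>
    moreover have "int_binomial (int n + i - int m - 1) (n - 1) = 0"
      using True assms(1) by (auto simp: int_binomial_def intro!: binomial_eq_0)
    ultimately show ?thesis by simp
  next
    case False
    then obtain d where i: "i = int d + int m" by (metis add.commute zle_iff_zadd not_less)
    have b: "V.basis (fbasis n m d)" unfolding V_def i by (rule fhom_basis[OF assms(1)])
    then have "V.dim = (n choose m) * ((n + d - 1) choose (n - 1))" "V.fin_dim"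
      using V.dim_basis[OF fbasis_card(1)[OF assms(1)] b] fbasis_card[OF assms(1)]
      unfolding V.fin_dim_def V.basis_def by auto
    moreover have "nat (int n + i - int m - 1) = n + d - 1" "\<not> int n + i - int m - 1 < 0"
      using i assms(1) by auto
    ultimately show ?thesis by (simp add: int_binomial_def)
  qed
  then show "V.fin_dim" "V.dim = (n choose m) * int_binomial (int n + i - int m - 1) (n - 1)" by auto
qed

section \<open>Homogeneous components\<close>

text \<open>Independent sets of the subspace stay independent in the whole space, which bounds their
  size; a maximal one exists and is a basis.\<close>

lemma (in vectorspace) subspace_fin_dim:
  assumes fd: "fin_dim" and sub: "subspace K N V"
  shows "vectorspace.fin_dim K (vs N)"
proof -
  have N: "LinearCombinations.submodule K N V" using sub by (simp add: subspace_def)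
  interpret W: vectorspace K "vs N" by (rule subspace_is_vs[OF sub])
  have small: "finite A \<and> card A \<le> dim" if "A \<subseteq> N" "W.lin_indpt A" for A
    using that li_le_dim[OF fd, of A] span_li_not_depend(2)[OF that(1) N] submodule.subset[OF N]
    by auto
  have "W.lin_indpt {}" unfolding W.lin_dep_def by auto
  then have "\<exists>A. finite A \<and> maximal A (\<lambda>S. S \<subseteq> carrier (vs N) \<and> W.lin_indpt S)"
    using small by (intro maximal_exists[where N = dim and B = "{}"]) auto
  then obtain A where A: "finite A" "maximal A (\<lambda>S. S \<subseteq> carrier (vs N) \<and> W.lin_indpt S)" by blast
  then have "W.basis A" by (intro W.max_li_is_basis)
  then show ?thesis using A(1) unfolding W.fin_dim_def W.basis_def by blast
qed

lemma fhom_iff: "w \<in> fhom n m (int d + int m) \<longleftrightarrow> w \<in> fmod n m \<and> (\<forall>J. w J \<in> homog d)"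
  by (auto simp: fhom_def homog_def)

context poly_quotient
begin

abbreviation "RS m \<equiv> restrict_scalars B (forms (ground :: 'k ring) B m)"

lemma forms_eq: "forms (ground :: 'k ring) B m = X.\<Lambda> m"
  by (simp add: forms_def)

lemma RS_simps:
  "carrier (RS m) = carrier (X.\<Lambda> m)" "\<zero>\<^bsub>RS m\<^esub> = \<zero>\<^bsub>X.\<Lambda> m\<^esub>"
  "x \<oplus>\<^bsub>RS m\<^esub> y = x \<oplus>\<^bsub>X.\<Lambda> m\<^esub> y" "c \<odot>\<^bsub>RS m\<^esub> x = \<pi> (single 0 c) \<odot>\<^bsub>X.\<Lambda> m\<^esub> x"
  by (simp_all add: restrict_scalars_def forms_eq \<pi>_smult)

lemma fmod_const_closed: "const_closed (fmod n m :: ('k form) set)"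
  by (auto simp: const_closed_def fmod_add fmod_scal)

lemma \<Psi>_vectorspace:
  assumes W: "const_closed W" "W \<subseteq> fmod n m"
  shows "vectorspace ground ((RS m)\<lparr>carrier := \<Psi> m ` W\<rparr>)"
proof -
  interpret V: vectorspace ground "form_space W" by (rule vectorspace_form_space[OF W(1)])
  have "Module.module ground ((RS m)\<lparr>carrier := \<Psi> m ` W\<rparr>)"
    using W(2) by (intro module_image[where q = "\<Psi> m", OF V.module_axioms])
      (auto simp: RS_simps \<Psi>_zero \<Psi>_add \<Psi>_scal subset_iff)
  then show ?thesis by (intro vectorspace.intro field_ground)
qed

lemma \<Psi>_linear:
  assumes W: "const_closed W" "W \<subseteq> fmod n m"
  shows "linear_map ground (form_space W) ((RS m)\<lparr>carrier := \<Psi> m ` W\<rparr>) (\<Psi> m)"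
proof -
  interpret V: vectorspace ground "form_space W" by (rule vectorspace_form_space[OF W(1)])
  interpret U: vectorspace ground "(RS m)\<lparr>carrier := \<Psi> m ` W\<rparr>" by (rule \<Psi>_vectorspace[OF W])
  have "\<Psi> m \<in> LinearCombinations.module_hom ground (form_space W) ((RS m)\<lparr>carrier := \<Psi> m ` W\<rparr>)"
    unfolding LinearCombinations.module_hom_def using W(2)
    by (auto simp: RS_simps \<Psi>_add \<Psi>_scal subset_iff)
  then show ?thesis
    by (intro linear_map.intro mod_hom.intro mod_hom_axioms.intro V.vectorspace_axioms
        U.vectorspace_axioms V.module_axioms U.module_axioms)
qed

text \<open>Rank and nullity of \<open>\<Psi>\<close> restricted to \<open>W\<close>, with the
  kernel supplied by \<open>\<Psi>_eq_zero_iff\<close>.\<close>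

lemma \<Psi>_dim:
  assumes W: "const_closed W" "W \<subseteq> fmod n m" and fd: "vectorspace.fin_dim ground (form_space W)"
  shows "vectorspace.fin_dim ground ((RS m)\<lparr>carrier := \<Psi> m ` W\<rparr>)"
    "vectorspace.dim ground ((RS m)\<lparr>carrier := \<Psi> m ` W\<rparr>) +
      vectorspace.dim ground (form_space (W \<inter> frel n I m)) = vectorspace.dim ground (form_space W)"
proof -
  interpret T: linear_map ground "form_space W" "(RS m)\<lparr>carrier := \<Psi> m ` W\<rparr>" "\<Psi> m"
    by (rule \<Psi>_linear[OF W])
  have ker: "T.kerT = W \<inter> frel n I m"
    using W(2) \<Psi>_eq_zero_iff by (auto simp: T.ker_def RS_simps)
  have im: "T.imT = \<Psi> m ` W" by (simp add: T.im_def)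
  show "T.W.fin_dim" by (rule T.rank_nullity_main(2)[OF fd]) simp
  show "vectorspace.dim ground ((RS m)\<lparr>carrier := \<Psi> m ` W\<rparr>) +
      vectorspace.dim ground (form_space (W \<inter> frel n I m)) = vectorspace.dim ground (form_space W)"
    using T.rank_nullity[OF fd] unfolding ker im by simp
qed

lemma vectorspace_RS: "vectorspace ground (RS m)"
proof -
  have "\<Psi> m ` fmod n m = carrier (RS m)"
    using \<Psi>_surj \<Psi>_closed by (auto simp: RS_simps)
  then show ?thesis using \<Psi>_vectorspace[OF fmod_const_closed order_refl, of m] by simp
qed

text \<open>A generator with an arbitrary list \<open>js\<close> comes from a wedge product of unit
  vectors, whose coefficients are constants, so its degree is decided by the scalar. Conversely,
  expanding \<open>w\<close> in the basis needs only generators with sorted lists.\<close>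

lemma component_eq:
  "forms_component (ground :: 'k ring) B (\<lambda>d. \<pi> ` polys_component n d) (\<lambda>j. \<pi> (polyvar j)) n m i =
    \<Psi> m ` fhom n m i"
proof -
  interpret V: vectorspace ground "RS m" by (rule vectorspace_RS)
  define S where "S = {s \<odot>\<^bsub>X.\<Lambda> m\<^esub> ext_prod B \<Omega>1 (map dx js) | s d js.
         s \<in> \<pi> ` polys_component n d \<and> length js = m \<and> set js \<subseteq> {..<n} \<and> int d + int m = i}"
  have fc: "forms_component (ground :: 'k ring) B (\<lambda>d. \<pi> ` polys_component n d) (\<lambda>j. \<pi> (polyvar j)) n m i = V.span S"
    unfolding forms_component_def S_def forms_eq ..
  have sub: "LinearCombinations.submodule ground (\<Psi> m ` fhom n m i) (RS m)"
  proof (rule submodule.intro[OF V.module_axioms])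
    have f: "w \<in> fmod n m" if "w \<in> fhom n m i" for w :: "'k form"
      using that by (simp add: fhom_def)
    note cl = fhom_const_closed[of n m i, where 'a = 'k, unfolded const_closed_def]
    show "\<Psi> m ` fhom n m i \<subseteq> carrier (RS m)"
      using \<Psi>_closed f by (auto simp: RS_simps)
    show "\<zero>\<^bsub>RS m\<^esub> \<in> \<Psi> m ` fhom n m i"
      unfolding RS_simps \<Psi>_zero[symmetric] using cl by blast
    show "v \<oplus>\<^bsub>RS m\<^esub> w \<in> \<Psi> m ` fhom n m i" if "v \<in> \<Psi> m ` fhom n m i" "w \<in> \<Psi> m ` fhom n m i" for v w
      using that cl f unfolding RS_simps by (auto simp flip: \<Psi>_add)
    show "c \<odot>\<^bsub>RS m\<^esub> w \<in> \<Psi> m ` fhom n m i" if "w \<in> \<Psi> m ` fhom n m i" for c w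
      using that cl f unfolding RS_simps by (auto simp flip: \<Psi>_scal)
  qed
  have "S \<subseteq> \<Psi> m ` fhom n m i"
  proof
    fix x assume "x \<in> S"
    then obtain p d js where x: "x = \<pi> p \<odot>\<^bsub>X.\<Lambda> m\<^esub> ext_prod B \<Omega>1 (map dx js)" "p \<in> polys_component n d"
      "length js = m" "set js \<subseteq> {..<n}" "int d + int m = i"
      unfolding S_def by blast
    define w :: "'k form" where "w = wedge_list (map unit js)"
    have us: "set (map unit js) \<subseteq> vmod n" using x(4) by (auto intro!: unit_vmod)
    then have w: "w \<in> fmod n m"
      using wedge_list_fmod[OF us] x(3) by (simp add: w_def)
    have "map \<psi> (map unit js) = map dx js" using x(4) by (auto simp: \<psi>_unit)
    then have "ext_prod B \<Omega>1 (map dx js) = \<Psi> m w"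
      using \<Psi>_wedge_list[OF us] x(3) by (simp only: w_def length_map)
    then have "x = \<Psi> m (scal p w)"
      using x(1,2) w by (simp add: \<Psi>_scal polys_component_eq)
    moreover have "w J \<in> homog 0" for J
      unfolding w_def by (rule wedge_list_homog) (auto simp: unit_homog)
    then have "scal p w J \<in> homog d" for J
      using homog_mult[of p d "w J" 0] x(2) by (simp add: scal_def polys_component_eq)
    then have "scal p w \<in> fhom n m i"
      using x(2,5) w unfolding x(5)[symmetric] fhom_iff by (simp add: polys_component_eq fmod_scal)
    ultimately show "x \<in> \<Psi> m ` fhom n m i" by blast
  qed
  then have 1: "V.span S \<subseteq> \<Psi> m ` fhom n m i" and SV: "S \<subseteq> carrier (RS m)"
    using V.span_is_subset[OF _ sub] submodule.subset[OF sub] by auto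
  have span: "LinearCombinations.submodule ground (V.span S) (RS m)" by (rule V.span_is_submodule[OF SV])
  have "\<Psi> m w \<in> V.span S" if w: "w \<in> fhom n m i" for w
  proof -
    have wf: "w \<in> fmod n m" using w by (simp add: fhom_def)
    have summand: "\<Psi> m (scal (w J) (unit J)) \<in> V.span S" if J: "J \<subseteq> {..<n}" "card J = m" for J
    proof (cases "w J = 0")
      \<comment> \<open>A zero coefficient has no monomial to read a degree from, so this summand is
        treated separately.\<close>
      case True
      have "\<zero>\<^bsub>RS m\<^esub> \<in> V.span S" by (rule submodule.zero_closed[OF span])
      then show ?thesis using True by (simp add: scal_simps \<Psi>_zero RS_simps)
    next
      case False
      \<comment> \<open>Any monomial of \<open>w J\<close> supplies the natural number d that the
        generators ask for.\<close>
      then obtain t where t: "t \<in> keys (w J)" by (metis keys_eq_empty ex_in_conv)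
      have "mdeg s = mdeg t" if "s \<in> keys (w J)" for s
      proof -
        have "int (mdeg s) + int m = i" "int (mdeg t) + int m = i"
          using w t that by (auto simp: fhom_def)
        then show ?thesis by simp
      qed
      then have "w J \<in> polys_component n (mdeg t)"
        using fmodD(1)[OF wf] by (simp add: polys_component_eq homog_def)
      moreover have "int (mdeg t) + int m = i" using w t by (auto simp: fhom_def)
      ultimately have "\<pi> (w J) \<odot>\<^bsub>X.\<Lambda> m\<^esub> ext_prod B \<Omega>1 (map dx (sorted_list_of_set J)) \<in> S"
        unfolding S_def using J finite_subsetD[OF J(1)]
        by (intro CollectI exI[of _ "\<pi> (w J)"] exI[of _ "mdeg t"] exI[of _ "sorted_list_of_set J"]) auto
      then have "\<pi> (w J) \<odot>\<^bsub>X.\<Lambda> m\<^esub> dX J \<in> V.span S"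
        unfolding dX_def by (rule V.span_gen[OF SV])
      then show ?thesis
        using \<Psi>_scal[OF fmodD(1)[OF wf] unit_fmod[OF J]] by (simp add: \<Psi>_unit J)
    qed
    have "(\<Sum>J\<in>Y. scal (w J) (unit J)) \<in> fmod n m \<and> \<Psi> m (\<Sum>J\<in>Y. scal (w J) (unit J)) \<in> V.span S"
      if "finite Y" "Y \<subseteq> subsets n m" for Y
      using that
    proof (induction Y rule: finite_induct)
      case empty
      have "\<zero>\<^bsub>RS m\<^esub> \<in> V.span S" by (rule submodule.zero_closed[OF span])
      then show ?case by (simp add: \<Psi>_zero RS_simps)
    next
      case (insert J Y)
      have "scal (w J) (unit J) \<in> fmod n m"
        using insert fmodD(1)[OF wf] by (intro fmod_scal unit_fmod) auto
      then show ?case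
        using insert summand[of J] submodule.m_closed[OF span, of "\<Psi> m (scal (w J) (unit J))"]
        by (simp add: fmod_add \<Psi>_add RS_simps)
    qed
    from this[OF finite_subsets order_refl] show ?thesis using fmod_expand[OF wf] by simp
  qed
  then show ?thesis unfolding fc using 1 by blast
qed

end

section \<open>The polynomial ring and the fat point\<close>

lemma cring_polys: "cring (polys n :: ('k::field, 'k mpoly) module)"
proof (rule cringI)
  show "abelian_group (polys n :: ('k, 'k mpoly) module)"
  proof (rule abelian_groupI)
    show "\<exists>y\<in>carrier (polys n). y \<oplus>\<^bsub>polys n\<^esub> x = \<zero>\<^bsub>polys n\<^esub>" if "x \<in> carrier (polys n)" for x :: "'k mpoly"
      using that by (intro bexI[of _ "- x"]) (auto intro: pcarrier_uminus)
  qed (auto simp: add_ac intro: pcarrier_add)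
  show "Group.comm_monoid (polys n :: ('k, 'k mpoly) module)"
    by (rule comm_monoidI) (auto simp: mult_ac intro: pcarrier_mult)
qed (simp add: distrib_right)

lemma a_inv_polys:
  fixes p :: "'k::field mpoly"
  assumes "p \<in> pcarrier n"
  shows "\<ominus>\<^bsub>polys n\<^esub> p = - p"
proof -
  interpret P: cring "polys n :: ('k, 'k mpoly) module" by (rule cring_polys)
  show ?thesis using assms P.minus_equality[of "- p" p] by (auto intro: pcarrier_uminus)
qed

lemma poly_quotient_id: "poly_quotient (polys n :: ('k::field, 'k mpoly) module) n (\<lambda>p. p)"
proof (intro poly_quotient.intro poly_quotient_axioms.intro cring_polys)
  show "(\<lambda>p. p) \<in> Ring.ring_hom (polys n :: ('k, 'k mpoly) module) (polys n)" by (rule ring_hom_memI) auto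
qed auto

text \<open>Membership is tested monomial by monomial, unlike in the recursively defined power
  \<open>irrelevant_pow\<close>, with which it agrees.\<close>

definition ord_ideal :: "nat \<Rightarrow> nat \<Rightarrow> 'k::field mpoly set" where
  "ord_ideal n k = pcarrier n \<inter> order_ge k"

lemma ord_ideal_ideal: "ideal (ord_ideal n k :: 'k::field mpoly set) (polys n)"
proof (rule idealI)
  show "Ring.ring (polys n :: ('k, 'k mpoly) module)" using cring_polys by (rule cring.axioms)
  show "subgroup (ord_ideal n k) (add_monoid (polys n :: ('k, 'k mpoly) module))"
  proof (intro group.subgroupI)
    show "Group.group (add_monoid (polys n :: ('k, 'k mpoly) module))"
      using cring_polys cring.axioms(1) ring.is_abelian_group abelian_group.a_group by blast
    show "inv\<^bsub>add_monoid (polys n)\<^esub> a \<in> ord_ideal n k" if "a \<in> ord_ideal n k" for a :: "'k mpoly"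
      using that a_inv_polys[of a n, unfolded a_inv_def]
      by (auto simp: ord_ideal_def intro: pcarrier_uminus order_ge_uminus)
    show "ord_ideal n k \<noteq> ({} :: 'k mpoly set)"
      unfolding ord_ideal_def using pcarrier_zero order_ge_zero by blast
  qed (auto simp: ord_ideal_def intro: pcarrier_add order_ge_add)
  fix a x :: "'k mpoly" assume "a \<in> ord_ideal n k" "x \<in> pcarrier n"
  then have "x * a \<in> ord_ideal n k"
    using order_ge_mult[of x 0 a k] by (auto simp: ord_ideal_def order_ge_0 intro: pcarrier_mult)
  then show "x \<otimes>\<^bsub>polys n\<^esub> a \<in> ord_ideal n k" "a \<otimes>\<^bsub>polys n\<^esub> x \<in> ord_ideal n k"
    by (simp_all add: mult.commute)
qed

text \<open>A polynomial is a sum of constant multiples of its monomials, so for inclusion in an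
  ideal only monomials with coefficient 1 have to be checked.\<close>

lemma ord_ideal_subset:
  fixes J :: "'k::field mpoly set"
  assumes J: "ideal J (polys n)" and mono: "\<And>t. keys t \<subseteq> {..<n} \<Longrightarrow> k \<le> mdeg t \<Longrightarrow> single t 1 \<in> J"
  shows "ord_ideal n k \<subseteq> J"
proof
  interpret J: ideal J "polys n" by (rule J)
  fix p :: "'k mpoly" assume p: "p \<in> ord_ideal n k"
  have s: "single t c \<in> J" if "t \<in> keys p" for t c
  proof -
    have "single t 1 \<in> J"
      using p that by (intro mono) (auto simp: ord_ideal_def pcarrier_iff order_ge_def)
    then have "single 0 c \<otimes>\<^bsub>polys n\<^esub> single t 1 \<in> J"
      by (intro J.I_l_closed) auto
    then show ?thesis by (simp add: mult_single)
  qed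
  have "0 \<in> J" using additive_subgroup.zero_closed[OF J.is_additive_subgroup] by simp
  moreover have "q + r \<in> J" if "q \<in> J" "r \<in> J" for q r
    using additive_subgroup.a_closed[OF J.is_additive_subgroup that] by simp
  ultimately show "p \<in> J" using mpoly_induct[of "\<lambda>p. p \<in> J" p] s by blast
qed

lemma ord_ideal_1: "genideal (polys n) (polyvar ` {..<n}) = (ord_ideal n 1 :: 'k::field mpoly set)"
proof
  interpret P: cring "polys n :: ('k, 'k mpoly) module" by (rule cring_polys)
  have v: "(polyvar ` {..<n} :: 'k mpoly set) \<subseteq> pcarrier n" by (auto intro: pcarrier_polyvar)
  have "(polyvar ` {..<n} :: 'k mpoly set) \<subseteq> ord_ideal n 1"
    using v by (auto simp: ord_ideal_def polyvar_def intro: order_ge_single)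
  then show "genideal (polys n) (polyvar ` {..<n}) \<subseteq> (ord_ideal n 1 :: 'k mpoly set)"
    by (rule P.genideal_minimal[OF ord_ideal_ideal])
  interpret J: ideal "genideal (polys n) (polyvar ` {..<n}) :: 'k mpoly set" "polys n"
    by (rule P.genideal_ideal[OF v])
  show "(ord_ideal n 1 :: 'k mpoly set) \<subseteq> genideal (polys n) (polyvar ` {..<n})"
  proof (rule ord_ideal_subset[OF J.is_ideal])
    fix t :: "nat \<Rightarrow>\<^sub>0 nat" assume t: "keys t \<subseteq> {..<n}" "1 \<le> mdeg t"
    then have "t \<noteq> 0" by auto
    then obtain j where j: "j \<in> keys t" by (metis keys_eq_empty ex_in_conv)
    then have "lookup t j > 0" by (simp add: in_keys_iff)
    \<comment> \<open>A monomial of positive degree is divisible by one of its variables.\<close>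
    note e = single_eq_polyvar_mult[OF this]
    have "(polyvar j :: 'k mpoly) \<in> genideal (polys n) (polyvar ` {..<n})"
      using j t P.genideal_self[OF v] by auto
    then have "polyvar j \<otimes>\<^bsub>polys n\<^esub> single (t - single j 1) (1 :: 'k)
        \<in> genideal (polys n) (polyvar ` {..<n})"
      using t keys_minus_subset[of t "single j 1"]
      by (intro J.I_r_closed pcarrier_singleI) auto
    then show "single t (1 :: 'k) \<in> genideal (polys n) (polyvar ` {..<n})"
      unfolding e by simp
  qed
qed

text \<open>A product has at least the sum of the orders; conversely a monomial of degree above
  \<open>k\<close> is a variable times a monomial of degree at least \<open>k\<close>.\<close>

lemma ord_ideal_Suc: "ideal_prod (polys n) (ord_ideal n k) (ord_ideal n 1) = (ord_ideal n (Suc k) :: 'k::field mpoly set)"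
proof
  interpret P: cring "polys n :: ('k, 'k mpoly) module" by (rule cring_polys)
  show "ideal_prod (polys n) (ord_ideal n k) (ord_ideal n 1) \<subseteq> (ord_ideal n (Suc k) :: 'k mpoly set)"
  proof
    fix p :: "'k mpoly" assume "p \<in> ideal_prod (polys n) (ord_ideal n k) (ord_ideal n 1)"
    then show "p \<in> ord_ideal n (Suc k)"
    proof (induction rule: ideal_prod.induct)
      case (prod i j)
      then show ?case
        using order_ge_mult[of i k j 1] by (auto simp: ord_ideal_def intro: pcarrier_mult)
    next
      case (sum s1 s2)
      then show ?case by (auto simp: ord_ideal_def intro: pcarrier_add order_ge_add)
    qed
  qed
  interpret J: ideal "ideal_prod (polys n) (ord_ideal n k) (ord_ideal n 1) :: 'k mpoly set" "polys n"
    by (rule P.ideal_prod_is_ideal[OF ord_ideal_ideal ord_ideal_ideal])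
  show "(ord_ideal n (Suc k) :: 'k mpoly set) \<subseteq> ideal_prod (polys n) (ord_ideal n k) (ord_ideal n 1)"
  proof (rule ord_ideal_subset[OF J.is_ideal])
    fix t :: "nat \<Rightarrow>\<^sub>0 nat" assume t: "keys t \<subseteq> {..<n}" "Suc k \<le> mdeg t"
    then have "t \<noteq> 0" by auto
    then obtain j where j: "j \<in> keys t" by (metis keys_eq_empty ex_in_conv)
    then have l: "lookup t j > 0" by (simp add: in_keys_iff)
    let ?s = "t - single j 1"
    have "mdeg ?s = mdeg t - 1" by (rule mdeg_minus_single[OF l])
    then have "single ?s (1 :: 'k) \<in> ord_ideal n k"
      using t keys_minus_subset[of t "single j 1"]
      unfolding ord_ideal_def by (intro IntI pcarrier_singleI order_ge_single) auto
    moreover have "(polyvar j :: 'k mpoly) \<in> ord_ideal n 1"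
      using j t unfolding ord_ideal_def polyvar_def
      by (intro IntI pcarrier_singleI order_ge_single) auto
    ultimately have "single ?s (1 :: 'k) \<otimes>\<^bsub>polys n\<^esub> polyvar j
        \<in> ideal_prod (polys n) (ord_ideal n k) (ord_ideal n 1)"
      by (rule ideal_prod.prod)
    then show "single t (1 :: 'k) \<in> ideal_prod (polys n) (ord_ideal n k) (ord_ideal n 1)"
      unfolding single_eq_polyvar_mult[OF l] by (simp add: mult.commute)
  qed
qed

lemma irrelevant_pow_eq: "irrelevant_pow n k = ord_ideal n k"
proof (induction k)
  case 0
  \<comment> \<open>The zeroth power in the monoid of ideals is the whole ring, in agreement with
    \<open>order_ge 0\<close>.\<close>
  show ?case
    by (simp add: irrelevant_pow_def ideals_set_def ord_ideal_def order_ge_0 nat_pow_def)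
next
  case (Suc k)
  then show ?case
    unfolding irrelevant_pow_def ord_ideal_1
    by (simp add: ideals_set_def nat_pow_def ord_ideal_Suc[unfolded One_nat_def])
qed

text \<open>The record \<open>fat_point\<close> copies the ring operations of the factor ring but
  has another type, so the ring axioms are transferred through these equations.\<close>

lemma fat_point_simps:
  "carrier (fat_point n k) = carrier (polys n Quot ord_ideal n k)"
  "\<one>\<^bsub>fat_point n k\<^esub> = \<one>\<^bsub>polys n Quot ord_ideal n k\<^esub>"
  "\<zero>\<^bsub>fat_point n k\<^esub> = \<zero>\<^bsub>polys n Quot ord_ideal n k\<^esub>"
  "monoid.mult (fat_point n k) = monoid.mult (polys n Quot ord_ideal n k)"
  "add (fat_point n k) = add (polys n Quot ord_ideal n k)"
  by (simp_all add: fat_point_def quot_module_def irrelevant_pow_eq)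

lemma cring_fat_point: "cring (fat_point n k :: ('k::field, 'k mpoly set) module)"
proof -
  interpret I: ideal "ord_ideal n k :: 'k mpoly set" "polys n" by (rule ord_ideal_ideal)
  interpret Q: cring "(polys n :: ('k, 'k mpoly) module) Quot ord_ideal n k"
    by (rule I.quotient_is_cring[OF cring_polys])
  show ?thesis
  proof (rule cringI)
    show "abelian_group (fat_point n k :: ('k::field, 'k mpoly set) module)"
    proof (rule abelian_groupI)
      show "\<exists>y\<in>carrier (fat_point n k). y \<oplus>\<^bsub>fat_point n k\<^esub> x = \<zero>\<^bsub>fat_point n k\<^esub>"
        if "x \<in> carrier (fat_point n k)" for x :: "'k mpoly set"
        using that Q.l_neg[of x] Q.a_inv_closed[of x] unfolding fat_point_simps by blast
    qed (auto simp: fat_point_simps Q.a_ac)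
    show "Group.comm_monoid (fat_point n k :: ('k::field, 'k mpoly set) module)"
      by (rule comm_monoidI) (auto simp: fat_point_simps Q.m_ac)
  qed (auto simp: fat_point_simps Q.l_distr)
qed

lemma poly_quotient_fat_point:
  "poly_quotient (fat_point n k :: ('k::field, 'k mpoly set) module) n (fat_point_class n k)"
proof (intro poly_quotient.intro poly_quotient_axioms.intro cring_fat_point)
  interpret I: ideal "ord_ideal n k :: 'k mpoly set" "polys n" by (rule ord_ideal_ideal)
  have cls: "(fat_point_class n k :: 'k mpoly \<Rightarrow> _) = (+>\<^bsub>polys n\<^esub>) (ord_ideal n k)"
    by (simp add: fat_point_class_def irrelevant_pow_eq fun_eq_iff)
  show "(fat_point_class n k :: 'k mpoly \<Rightarrow> _) \<in> Ring.ring_hom (polys n) (fat_point n k)"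
    using I.rcos_ring_hom unfolding cls Ring.ring_hom_def by (simp add: fat_point_simps)
  show "(fat_point_class n k :: 'k mpoly \<Rightarrow> _) ` pcarrier n = carrier (fat_point n k)"
    by (auto simp: cls fat_point_simps FactRing_def A_RCOSETS_def')
  show "c \<odot>\<^bsub>fat_point n k\<^esub> \<one>\<^bsub>fat_point n k\<^esub> = fat_point_class n k (single 0 c)" for c :: 'k
  proof -
    interpret P: cring "polys n :: ('k, 'k mpoly) module" by (rule cring_polys)
    have one: "\<one>\<^bsub>fat_point n k :: ('k, 'k mpoly set) module\<^esub> = ord_ideal n k +>\<^bsub>polys n\<^esub> 1"
      by (simp add: fat_point_simps FactRing_def)
    have 1: "(1 :: 'k mpoly) \<in> ord_ideal n k +>\<^bsub>polys n\<^esub> 1"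
      using I.a_rcos_self[of 1] by simp
    \<comment> \<open>The scalar product is a union over all representatives of the class of 1; each
      of them yields the same coset.\<close>
    have "ord_ideal n k +>\<^bsub>polys n\<^esub> (single 0 c * x) =
        ord_ideal n k +>\<^bsub>polys n\<^esub> single 0 c"
      if x: "x \<in> ord_ideal n k +>\<^bsub>polys n\<^esub> 1" for x
    proof -
      have "x \<in> pcarrier n" using x I.a_elemrcos_carrier[of 1 x] by simp
      moreover have "ord_ideal n k +>\<^bsub>polys n\<^esub> x = ord_ideal n k +>\<^bsub>polys n\<^esub> 1"
        using I.a_repr_independence'[OF x] by simp
      ultimately show ?thesis
        using I.rcoset_mult_add[of "single 0 c" x] I.rcoset_mult_add[of "single 0 c" 1]
        by simp
    qed
    then show ?thesis
      using 1 unfolding one cls by (auto simp: fat_point_def quot_module_def irrelevant_pow_eq)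
  qed
qed

section \<open>The Hilbert function\<close>

text \<open>For the polynomial ring itself this makes \<open>\<Psi>\<close> injective, so that its
  forms are free on the products of the dX_j.\<close>

lemma frel_zero_ideal: "frel n {0} m = ({0} :: ('k::field form) set)"
proof
  show "frel n {0} m \<subseteq> ({0} :: ('k form) set)"
  proof
    fix w :: "'k form" assume "w \<in> frel n {0} m"
    then show "w \<in> {0}" unfolding frel_def
    proof (rule pspan_induct[where P = "\<lambda>w. w \<in> {0}"])
      fix w :: "'k form" assume "w \<in> {scal a w |a w. a \<in> {0} \<and> w \<in> fmod n m} \<union>
        {wedge (grad f) w |f w m'. m = Suc m' \<and> f \<in> {0} \<and> w \<in> fmod n m'}"
      then show "w \<in> {0}" by (auto simp: scal_simps grad_simps wedge_simps)
    qed (auto simp: scal_simps)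
  qed
  show "({0} :: ('k form) set) \<subseteq> frel n {0} m" by (simp add: frel_def pspan_zero)
qed

lemma dwedge_fmod: "P \<subseteq> pcarrier n \<Longrightarrow> dwedge n P m \<subseteq> fmod n m"
  using dwedge_frel frel_fmod by blast

context poly_quotient
begin

lemma \<Psi>_inj:
  assumes "I = {0}" "v \<in> fmod n m" "w \<in> fmod n m" "\<Psi> m v = \<Psi> m w"
  shows "v = w"
proof -
  have "\<Psi> m (v - w) \<oplus>\<^bsub>X.\<Lambda> m\<^esub> \<Psi> m w = \<Psi> m w"
    using \<Psi>_add[OF fmod_diff[OF assms(2,3)] assms(3)] assms(4) by simp
  then have "\<Psi> m (v - w) = \<zero>\<^bsub>X.\<Lambda> m\<^esub>"
    using \<Psi>_closed[OF fmod_diff[OF assms(2,3)]] \<Psi>_closed[OF assms(3)] X.L.M.add.r_cancel_one by blast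
  then have "v - w \<in> frel n I m" using \<Psi>_eq_zero_iff[OF fmod_diff[OF assms(2,3)]] by simp
  then show ?thesis unfolding assms(1) frel_zero_ideal by simp
qed

text \<open>The left side spans products whose first factor runs through a whole submodule, while
  \<open>dwedge\<close> is generated by products with single gradients. Linearity in the first
  factor bridges the two.\<close>

lemma \<Psi>_dwedge:
  assumes IP: "P \<subseteq> pcarrier n"
  shows "X.L.span (Suc m) {ext_mult B \<Omega>1 (Suc m) u w | u w.
      u \<in> X.span ((\<lambda>f. d (\<pi> f)) ` P) \<and> w \<in> carrier (X.\<Lambda> m)} =
    \<Psi> (Suc m) ` dwedge n P (Suc m)"
proof -
  let ?M = "\<Omega>1" and ?L = "X.\<Lambda> (Suc m)"
  define S where "S = (\<lambda>f. d (\<pi> f)) ` P"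
  have SM: "S \<subseteq> carrier ?M"
    using univ_deriv_closed \<pi>_closed IP by (auto simp: S_def)
  have dqM: "X.span S \<subseteq> carrier ?M" by (rule X.span_is_subset2[OF SM])
  define G where "G = {ext_mult B ?M (Suc m) u w | u w. u \<in> X.span S \<and> w \<in> carrier (X.\<Lambda> m)}"
  have GL: "G \<subseteq> carrier ?L"
    using dqM X.ext_mult_closed unfolding G_def by blast
  note dwf = subsetD[OF dwedge_fmod[OF IP]]
  have D: "0 \<in> dwedge n P (Suc m)"
    "\<And>v w. v \<in> dwedge n P (Suc m) \<Longrightarrow> w \<in> dwedge n P (Suc m) \<Longrightarrow> v + w \<in> dwedge n P (Suc m)"
    "\<And>p w. p \<in> pcarrier n \<Longrightarrow> w \<in> dwedge n P (Suc m) \<Longrightarrow> scal p w \<in> dwedge n P (Suc m)"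
    unfolding dwedge_def by (rule pspan_zero pspan_add pspan_scal; assumption)+
  have sub: "LinearCombinations.submodule B (\<Psi> (Suc m) ` dwedge n P (Suc m)) ?L"
  proof (rule submodule.intro[OF X.module_ext_power])
    show "\<Psi> (Suc m) ` dwedge n P (Suc m) \<subseteq> carrier ?L"
      using \<Psi>_closed dwf by blast
    show "\<zero>\<^bsub>?L\<^esub> \<in> \<Psi> (Suc m) ` dwedge n P (Suc m)"
      unfolding \<Psi>_zero[symmetric] using D(1) by blast
    show "v \<oplus>\<^bsub>?L\<^esub> w \<in> \<Psi> (Suc m) ` dwedge n P (Suc m)"
      if "v \<in> \<Psi> (Suc m) ` dwedge n P (Suc m)" "w \<in> \<Psi> (Suc m) ` dwedge n P (Suc m)" for v w
      using that D(2) dwf by (auto simp flip: \<Psi>_add)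
    show "p \<odot>\<^bsub>?L\<^esub> w \<in> \<Psi> (Suc m) ` dwedge n P (Suc m)"
      if b: "p \<in> carrier B" and w: "w \<in> \<Psi> (Suc m) ` dwedge n P (Suc m)" for p w
    proof -
      obtain q where "q \<in> pcarrier n" "p = \<pi> q" using b unfolding \<pi>_surj[symmetric] by blast
      then show ?thesis using w D(3) dwf by (auto simp flip: \<Psi>_scal)
    qed
  qed
  \<comment> \<open>The claim quantifies over all \<open>w\<close>, so that the induction over the
    span may vary the first factor alone.\<close>
  have mult: "\<forall>w\<in>carrier (X.\<Lambda> m). ext_mult B ?M (Suc m) u w \<in> \<Psi> (Suc m) ` dwedge n P (Suc m)"
    if "u \<in> X.span S" for u
    using SM that
  proof (induction rule: X.span_induct)
    case zero
    show ?case
    proof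
      fix w assume w: "w \<in> carrier (X.\<Lambda> m)"
      have "ext_mult B ?M (Suc m) (\<zero> \<odot>\<^bsub>?M\<^esub> \<zero>\<^bsub>?M\<^esub>) w = \<zero>\<^bsub>?L\<^esub>"
        using X.ext_mult_smult_left[of \<zero> "\<zero>\<^bsub>?M\<^esub>" w m] w X.ext_mult_closed[of "\<zero>\<^bsub>?M\<^esub>" w m]
        by simp
      then show "ext_mult B ?M (Suc m) \<zero>\<^bsub>?M\<^esub> w \<in> \<Psi> (Suc m) ` dwedge n P (Suc m)"
        using submodule.zero_closed[OF sub] by simp
    qed
  next
    case (gen u)
    then obtain f where f: "f \<in> P" "u = d (\<pi> f)" by (auto simp: S_def)
    show ?case
    proof
      fix w assume "w \<in> carrier (X.\<Lambda> m)"
      then obtain w' where w': "w' \<in> fmod n m" "w = \<Psi> m w'" using \<Psi>_surj by blast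
      have fP: "f \<in> pcarrier n" using f IP by blast
      have "ext_mult B ?M (Suc m) u w = \<Psi> (Suc m) (wedge (grad f) w')"
        using \<Psi>_wedge[OF grad_vmod[OF fP] w'(1)] d_\<pi>[OF fP] f w' by simp
      moreover have "wedge (grad f) w' \<in> dwedge n P (Suc m)"
        unfolding dwedge_def using f w' by (intro pspan_gen) blast
      ultimately show "ext_mult B ?M (Suc m) u w \<in> \<Psi> (Suc m) ` dwedge n P (Suc m)" by blast
    qed
  next
    case (add x y)
    then show ?case
      using submodule.m_closed[OF sub] by (simp add: X.ext_mult_add_left)
  next
    case (smult a x)
    then show ?case
      using submodule.smult_closed[OF sub] by (simp add: X.ext_mult_smult_left)
  qed
  then have "G \<subseteq> \<Psi> (Suc m) ` dwedge n P (Suc m)"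
    unfolding G_def by blast
  then have 1: "X.L.span (Suc m) G \<subseteq> \<Psi> (Suc m) ` dwedge n P (Suc m)"
    by (rule X.L.span_is_subset[OF _ sub])
  have spG: "LinearCombinations.submodule B (X.L.span (Suc m) G) ?L"
    by (rule X.L.span_is_submodule[OF GL])
  have 2: "\<Psi> (Suc m) ` dwedge n P (Suc m) \<subseteq> X.L.span (Suc m) G"
  proof
    fix x assume "x \<in> \<Psi> (Suc m) ` dwedge n P (Suc m)"
    then obtain w where w: "x = \<Psi> (Suc m) w" "w \<in> dwedge n P (Suc m)" by blast
    have "w \<in> fmod n (Suc m) \<and> \<Psi> (Suc m) w \<in> X.L.span (Suc m) G"
      using w(2) unfolding dwedge_def
    proof (rule pspan_induct[where P = "\<lambda>w. w \<in> fmod n (Suc m) \<and> \<Psi> (Suc m) w \<in> X.L.span (Suc m) G"])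
      show "0 \<in> fmod n (Suc m) \<and> \<Psi> (Suc m) 0 \<in> X.L.span (Suc m) G"
        using submodule.zero_closed[OF spG] by (simp add: \<Psi>_zero)
      fix w assume "w \<in> {wedge (grad f) w |f w m'. Suc m = Suc m' \<and> f \<in> P \<and> w \<in> fmod n m'}"
      then obtain f w' where f: "w = wedge (grad f) w'" "f \<in> P" "w' \<in> fmod n m" by auto
      have fP: "f \<in> pcarrier n" using f IP by blast
      have "\<Psi> (Suc m) w = ext_mult B ?M (Suc m) (d (\<pi> f)) (\<Psi> m w')"
        using \<Psi>_wedge[OF grad_vmod[OF fP] f(3)] d_\<pi>[OF fP] f by simp
      moreover have "d (\<pi> f) \<in> X.span S" using f by (intro X.span_gen[OF SM]) (simp add: S_def)
      ultimately have "\<Psi> (Suc m) w \<in> G"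
        unfolding G_def using \<Psi>_closed[OF f(3)] by blast
      then show "w \<in> fmod n (Suc m) \<and> \<Psi> (Suc m) w \<in> X.L.span (Suc m) G"
        using X.L.span_gen[OF GL] f wedge_fmod[OF grad_vmod[OF fP] f(3)] by simp
    next
      fix v w :: "'k form" assume "v \<in> fmod n (Suc m) \<and> \<Psi> (Suc m) v \<in> X.L.span (Suc m) G"
        "w \<in> fmod n (Suc m) \<and> \<Psi> (Suc m) w \<in> X.L.span (Suc m) G"
      then show "v + w \<in> fmod n (Suc m) \<and> \<Psi> (Suc m) (v + w) \<in> X.L.span (Suc m) G"
        using submodule.m_closed[OF spG] by (simp add: fmod_add \<Psi>_add)
    next
      fix p :: "'k mpoly" and w assume "p \<in> pcarrier n" "w \<in> fmod n (Suc m) \<and> \<Psi> (Suc m) w \<in> X.L.span (Suc m) G"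
      then show "scal p w \<in> fmod n (Suc m) \<and> \<Psi> (Suc m) (scal p w) \<in> X.L.span (Suc m) G"
        using submodule.smult_closed[OF spG] by (simp add: fmod_scal \<Psi>_scal)
    qed
    then show "x \<in> X.L.span (Suc m) G" unfolding w(1) by simp
  qed
  from 1 2 show ?thesis unfolding G_def S_def by blast
qed

end

lemma dwedge_fhom_const_closed:
  "const_closed (fhom n m i \<inter> dwedge n (ord_ideal n k) m :: ('k::field form) set)"
  using fhom_const_closed[of n m i, where 'a = 'k] pcarrier_const[of _ n]
  unfolding const_closed_def dwedge_def by (auto intro: pspan_zero pspan_add pspan_scal)

lemma delta_eq:
  assumes n: "n \<ge> 1"
  shows "delta TYPE('k::field) n k (Suc m) = vectorspace.dim ground
    (form_space (fhom n (Suc m) (int (Suc m) + int k - 1) \<inter> dwedge n (ord_ideal n k) (Suc m) ::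
      ('k form) set))"
proof -
  interpret A: poly_quotient "polys n :: ('k, 'k mpoly) module" n "\<lambda>p. p"
    by (rule poly_quotient_id)
  have I0: "A.I = {0}"
    unfolding A.I_def polys_simps using pcarrier_zero by blast
  let ?I = "ord_ideal n k :: 'k mpoly set"
  let ?F = "fhom n (Suc m) (int (Suc m) + int k - 1) :: ('k form) set"
  let ?W = "?F \<inter> dwedge n ?I (Suc m)"
  interpret V: vectorspace ground "form_space ?F" by (rule vectorspace_form_space[OF fhom_const_closed])
  have IP: "?I \<subseteq> pcarrier n" by (auto simp: ord_ideal_def)
  have dw: "d_irrelevant_pow_wedge n k (Suc m) = A.\<Psi> (Suc m) ` dwedge n ?I (Suc m)"
    using A.\<Psi>_dwedge[OF IP, of m]
    by (simp add: d_irrelevant_pow_wedge_def d_irrelevant_pow_def irrelevant_pow_eq forms_def)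
  have comp: "forms_component ground (polys n) (polys_component n) polyvar n (Suc m) (int (Suc m) + int k - 1) =
      A.\<Psi> (Suc m) ` ?F"
    using A.component_eq[of "Suc m" "int (Suc m) + int k - 1"] by simp
  have Ff: "?F \<subseteq> fmod n (Suc m)" by (auto simp: fhom_def)
  have Wf: "?W \<subseteq> fmod n (Suc m)" using Ff by blast
  have inj: "inj_on (A.\<Psi> (Suc m)) (fmod n (Suc m))"
    by (rule inj_onI) (rule A.\<Psi>_inj[OF I0])
  \<comment> \<open>Taking images commutes with this intersection because \<open>\<Psi>\<close> is
    injective for the zero ideal.\<close>
  have "d_irrelevant_pow_wedge n k (Suc m) \<inter> A.\<Psi> (Suc m) ` ?F = A.\<Psi> (Suc m) ` ?W"
    unfolding dw using inj_on_image_Int[OF inj dwedge_fmod[OF IP] Ff] by (simp add: Int_commute)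
  then have ds: "delta_space n k (Suc m) = (A.RS (Suc m))\<lparr>carrier := A.\<Psi> (Suc m) ` ?W\<rparr>"
    unfolding delta_space_def comp by simp
  have cc: "const_closed ?W" by (rule dwedge_fhom_const_closed)
  have "LinearCombinations.submodule ground ?W (form_space ?F)"
    using cc by (intro submodule.intro V.module_axioms) (auto simp: const_closed_def)
  then have "subspace ground ?W (form_space ?F)"
    by (intro subspace.intro V.vectorspace_axioms)
  then have fd: "vectorspace.fin_dim ground (form_space ?W)"
    using V.subspace_fin_dim[OF fhom_dim(1)[OF n]] by simp
  interpret T: linear_map ground "form_space ?W" "(A.RS (Suc m))\<lparr>carrier := A.\<Psi> (Suc m) ` ?W\<rparr>" "A.\<Psi> (Suc m)"
    by (rule A.\<Psi>_linear[OF cc Wf])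
  \<comment> \<open>\<open>\<Psi>\<close> maps the coordinate space bijectively onto
    \<open>delta_space\<close>, so the dimensions agree.\<close>
  have "T.V.dim = T.W.dim"
    using inj_on_subset[OF inj Wf] by (intro T.dim_eq[OF fd]) auto
  then show ?thesis unfolding delta_def ds by simp
qed

text \<open>Rank plus nullity on the forms of degree \<open>i\<close>, kept as a sum because
  subtraction of natural numbers would truncate.\<close>

lemma fat_point_dim:
  fixes n k m :: nat and i :: int
  assumes n: "n \<ge> 1"
  shows "vectorspace.fin_dim (ground :: 'k::field ring)
      ((fat_point_forms n k m)\<lparr>carrier := fat_point_forms_component n k m i\<rparr>)"
    "hilbert_function (ground :: 'k ring) (fat_point_forms n k m) (fat_point_forms_component n k m) i +
      vectorspace.dim (ground :: 'k ring) (form_space (fhom n m i \<inter> frel n (pcarrier n \<inter> order_ge k) m)) =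
      (n choose m) * int_binomial (int n + i - int m - 1) (n - 1)"
proof -
  interpret S: poly_quotient "fat_point n k :: ('k, 'k mpoly set) module" n "fat_point_class n k"
    by (rule poly_quotient_fat_point)
  interpret I: ideal "ord_ideal n k :: 'k mpoly set" "polys n" by (rule ord_ideal_ideal)
  have "fat_point_class n k p = \<zero>\<^bsub>fat_point n k\<^esub> \<longleftrightarrow> p \<in> ord_ideal n k" if "p \<in> pcarrier n" for p :: "'k mpoly"
    using that I.a_rcos_const[of p] I.a_rcos_self[of p]
    by (auto simp: fat_point_class_def irrelevant_pow_eq fat_point_simps FactRing_def)
  then have I: "S.I = pcarrier n \<inter> order_ge k" by (auto simp: S.I_def ord_ideal_def)
  have comp: "fat_point_forms_component n k m i = S.\<Psi> m ` fhom n m i"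
    unfolding fat_point_forms_component_def by (rule S.component_eq)
  have sub: "fhom n m i \<subseteq> (fmod n m :: ('k form) set)" by (auto simp: fhom_def)
  note * = S.\<Psi>_dim[OF fhom_const_closed sub fhom_dim(1)[OF n]]
  show "vectorspace.fin_dim (ground :: 'k ring)
      ((fat_point_forms n k m)\<lparr>carrier := fat_point_forms_component n k m i\<rparr>)"
    unfolding fat_point_forms_def comp by (rule *(1))
  show "hilbert_function (ground :: 'k ring) (fat_point_forms n k m) (fat_point_forms_component n k m) i +
      vectorspace.dim (ground :: 'k ring) (form_space (fhom n m i \<inter> frel n (pcarrier n \<inter> order_ge k) m)) =
      (n choose m) * int_binomial (int n + i - int m - 1) (n - 1)"
    using *(2) unfolding hilbert_function_def fat_point_forms_def comp I
      fhom_dim(2)[OF n] .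
qed

section \<open>The three ranges of the degree\<close>

lemma dim_zero_space: "vectorspace.dim (ground :: 'k::field ring) (form_space {0 :: 'k form}) = 0"
  \<comment> \<open>The zero space is realized as the 0-forms of degree -1 in one variable, whose
    dimension is already known.\<close>
  using fhom_dim(2)[of 1 0 "-1", where 'k = 'k] fhom_below[of "-1" 0 1, where 'a = 'k]
  by (simp add: int_binomial_def)

text \<open>For i >= m the coefficients have degree i - m < k - 1, below everything that occurs in
  the relations; for i < m there is no nonzero form at all.\<close>

lemma fhom_frel_low:
  assumes "k \<ge> 1" "i < int m + int k - 1"
  shows "fhom n m i \<inter> frel n (pcarrier n \<inter> order_ge k) m = ({0} :: ('k::field form) set)"
proof -
  have "w = 0" if w: "w \<in> fhom n m i" "w \<in> frel n (pcarrier n \<inter> order_ge k) m" for w :: "'k form"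
  proof (cases "i < int m")
    case True
    then show ?thesis using w(1) fhom_below[OF True, of n, where 'a = 'k] by simp
  next
    case False
    then obtain d where i: "i = int d + int m" by (metis add.commute zle_iff_zadd not_less)
    then have "\<And>J. w J \<in> homog d" using w(1) fhom_iff by blast
    moreover have "d < k - 1" using i assms by linarith
    ultimately show ?thesis by (rule frel_homog_low[OF refl assms(1) w(2)])
  qed
  moreover have "(0 :: 'k form) \<in> fhom n m i \<inter> frel n (pcarrier n \<inter> order_ge k) m"
    using fhom_const_closed[of n m i, where 'a = 'k] by (simp add: const_closed_def frel_def pspan_zero)
  ultimately show ?thesis by blast
qed

text \<open>The coefficients have degree k - 1, where by \<open>frel_homog_top\<close> the relations
  reduce to those with gradients.\<close>

lemma fhom_frel_top:
  assumes "k \<ge> 1" "i = int m + int k - 1"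
  shows "fhom n m i \<inter> frel n (pcarrier n \<inter> order_ge k) m =
    (fhom n m i \<inter> dwedge n (ord_ideal n k) m :: ('k::field form) set)"
proof -
  have i: "i = int (k - 1) + int m" using assms by auto
  have "w \<in> dwedge n (ord_ideal n k) m"
    if "w \<in> fhom n m i" "w \<in> frel n (pcarrier n \<inter> order_ge k) m" for w :: "'k form"
  proof -
    have "\<And>J. w J \<in> homog (k - 1)" using that(1) unfolding i fhom_iff by blast
    then show ?thesis
      unfolding ord_ideal_def by (rule frel_homog_top[OF refl assms(1) that(2)])
  qed
  then show ?thesis using dwedge_frel[of n "ord_ideal n k" m] unfolding ord_ideal_def by blast
qed

text \<open>Every coefficient has degree at least \<open>k\<close> and so lies in the ideal; each
  term of the basis expansion is then a generator of the first kind.\<close>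

lemma fhom_frel_high:
  assumes "i > int m + int k - 1"
  shows "fhom n m i \<subseteq> (frel n (pcarrier n \<inter> order_ge k) m :: ('k::field form) set)"
proof
  fix w :: "'k form" assume w: "w \<in> fhom n m i"
  then have wf: "w \<in> fmod n m" by (simp add: fhom_def)
  have "(\<Sum>J\<in>subsets n m. scal (w J) (unit J)) \<in> frel n (pcarrier n \<inter> order_ge k) m"
    unfolding frel_def
  proof (intro pspan_sum pspan_gen UnI1)
    fix J assume J: "J \<in> subsets n m"
    have "k \<le> mdeg t" if "t \<in> keys (w J)" for t
    proof -
      have "int (mdeg t) + int m = i" using w that by (auto simp: fhom_def)
      then show ?thesis using assms by linarith
    qed
    then have "w J \<in> pcarrier n \<inter> order_ge k"
      using fmodD(1)[OF wf] by (auto simp: order_ge_def)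
    moreover have "unit J \<in> (fmod n m :: ('k form) set)" using J by (auto intro: unit_fmod)
    ultimately show "scal (w J) (unit J) \<in> {scal a w |a w. a \<in> pcarrier n \<inter> order_ge k \<and> w \<in> fmod n m}"
      by blast
  qed
  then show "w \<in> frel n (pcarrier n \<inter> order_ge k) m" using fmod_expand[OF wf] by simp
qed

text \<open>Finite-dimensionality is part of the claim, since the value of \<open>dim\<close>
  carries information only for finite-dimensional spaces.\<close>

theorem proposition7p2:
  fixes n k m :: nat and i :: int
  assumes "perfect_field TYPE('k::field)"
    and "n \<ge> 1" and "k \<ge> 2" and "1 \<le> m" and "m \<le> n"
  shows "vectorspace.fin_dim (ground :: 'k ring)
      ((fat_point_forms n k m)\<lparr>carrier := fat_point_forms_component n k m i\<rparr>) \<and>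
    int (hilbert_function (ground :: 'k ring)
          (fat_point_forms n k m) (fat_point_forms_component n k m) i) =
      (if i < int m + int k - 1 then
         int ((n choose m) * int_binomial (int n + i - int m - 1) (n - 1))
       else if i = int m + int k - 1 then
         int ((n choose m) * ((n + k - 2) choose (n - 1))) - int (delta TYPE('k) n k m)
       else 0)"
proof -
  have n: "n \<ge> 1" and k: "k \<ge> 1" using assms by auto
  let ?H = "hilbert_function (ground :: 'k ring)
          (fat_point_forms n k m) (fat_point_forms_component n k m) i"
  let ?N = "(n choose m) * int_binomial (int n + i - int m - 1) (n - 1)"
  let ?F = "fhom n m i :: ('k form) set"
  note dim = fat_point_dim(2)[OF n, of k m i, where 'k = 'k]
  have "int ?H = (if i < int m + int k - 1 then int ?N
       else if i = int m + int k - 1 then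
         int ((n choose m) * ((n + k - 2) choose (n - 1))) - int (delta TYPE('k) n k m)
       else 0)"
  proof -
    consider "i < int m + int k - 1" | "i = int m + int k - 1" | "i > int m + int k - 1" by linarith
    then show ?thesis
    proof cases
      case 1
      then show ?thesis using dim unfolding fhom_frel_low[OF k 1] dim_zero_space by simp
    next
      case 2
      obtain m' where m: "m = Suc m'" using assms(4) by (cases m) auto
      have "vectorspace.dim (ground :: 'k ring) (form_space (?F \<inter> frel n (pcarrier n \<inter> order_ge k) m)) =
          delta TYPE('k) n k m"
        unfolding fhom_frel_top[OF k 2] unfolding 2 m delta_eq[OF n] ..
      \<comment> \<open>The subtraction in \<open>n + k - 2\<close> is one of natural numbers; the
        bounds on \<open>n\<close> and \<open>k\<close> keep it from truncating.\<close>
      moreover have "int n + i - int m - 1 = int (n + k - 2)" using 2 assms(2,3) by auto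
      ultimately have "?H + delta TYPE('k) n k m = (n choose m) * ((n + k - 2) choose (n - 1))"
        using dim by (simp add: int_binomial_def)
      \<comment> \<open>The equation is carried over to the integers as a sum, before \<delta> is
        brought to the other side.\<close>
      then have "int ?H + int (delta TYPE('k) n k m) = int ((n choose m) * ((n + k - 2) choose (n - 1)))"
        unfolding of_nat_add[symmetric] by (simp only:)
      then show ?thesis using 2 by simp
    next
      case 3
      then have "?F \<inter> frel n (pcarrier n \<inter> order_ge k) m = ?F" using fhom_frel_high by blast
      then have "?H = 0" using dim fhom_dim(2)[OF n, of m i, where 'k = 'k] by simp
      then show ?thesis using 3 by simp
    qed
  qed
  then show ?thesis using fat_point_dim(1)[OF n, of k m i, where 'k = 'k] by simp
qed

end
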